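(* Let $0<\alpha_1<\alpha_2\le1$, $\alpha=(\alpha_1,\alpha_2)$, let $A=(a_{ij})\in\mathbb R^{2\times2}$, and set $$q_1=\frac{\sin\frac{\alpha_1\pi}{2}}{\sin\frac{(\alpha_1+\alpha_2)\pi}{2}},\qquad q_2=\frac{\sin\frac{\alpha_2\pi}{2}}{\sin\frac{(\alpha_1+\alpha_2)\pi}{2}}.$$ Let $f=(f_1,f_2):[0,\infty)\to\mathbb R^2$ be continuous and exponentially bounded (i.e. there are $M>0,\gamma>0$ with $\|f(t)\|\le Me^{\gamma t}$ for all $t\ge0$), and consider $${}^{C}D^{\alpha}_{0^+}x(t)=Ax(t)+f(t)\quad (t>0),\qquad x(0)=x^0\in\mathbb R^2. \qquad (\ast)$$ Assume that one of the following conditions is satisfied: (i) $a_{11},a_{22}\le0$ and $\det A>0$; (ii) $a_{11}=0$, $a_{22}>0$, $\det A>0$ and $(a_{22}q_1)^{\alpha_1/\alpha_2}a_{22}q_2<\det A$; (iii) $a_{22}=0$, $a_{11}>0$, $\det A>0$ and $(a_{11}q_2)^{\alpha_2/\alpha_1}a_{11}q_1<\det A$; (iv) $a_{11},a_{22},\det A>0$ and one of the following holds: (iv)$_1$ $a_{11}q_2+a_{22}q_1>1$ and $a_{11}q_2\left((a_{11}+a_{22})q_2\right)^{\alpha_2/\alpha_1}+a_{22}(a_{11}+a_{22})q_2^2\le\det A$; (iv)$_2$ $a_{11}q_2+a_{22}q_1\le1$ and $a_{11}q_1+a_{22}q_2<\det A$; (v) $a_{11}<0$, $a_{22},\det A>0$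 and one of the following holds: (v)$_1$ $a_{11}q_2+a_{22}q_1>1$ and $(a_{22}q_1)^{\alpha_1/\alpha_2}a_{22}q_2\le\det A$; (v)$_2$ $a_{11}q_2+a_{22}q_1\le1$ and $a_{22}q_2\le\det A$. Then: (1) if $f$ is bounded, then for every $x^0\in\mathbb R^2$ the solution of $(\ast)$ is bounded on $[0,\infty)$; (2) if $\lim_{t\to\infty}f(t)=0$, then for every $x^0\in\mathbb R^2$ the solution of $(\ast)$ tends to $0$ as $t\to\infty$; (3) if $\|f(t)\|=O(t^{-\eta})$ as $t\to\infty$ for some $\eta>0$, then for every $x^0\in\mathbb R^2$ the solution $x$ of $(\ast)$ satisfies $\|x(t)\|=O(t^{-\mu})$ as $t\to\infty$, where $\mu=\min\{\alpha_1,\alpha_2,\eta\}$.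
   Context: On $\mathbb R^2$ use $\|x\|=\max\{|x_1|,|x_2|\}$. For $0<\kappa<1$ the Riemann–Liouville integral is $I^{\kappa}_{0^+}g(t)=\frac{1}{\Gamma(\kappa)}\int_0^t(t-s)^{\kappa-1}g(s)\,ds$, and the Caputo derivative of order $\kappa\in(0,1)$ is ${}^CD^{\kappa}_{0^+}g(t)=\frac{d}{dt}I^{1-\kappa}_{0^+}(g(t)-g(0))$, $t>0$; for $\kappa=1$ it is the usual derivative. For $x=(x_1,x_2)$, ${}^CD^{\alpha}_{0^+}x=({}^CD^{\alpha_1}_{0^+}x_1,{}^CD^{\alpha_2}_{0^+}x_2)$. A solution is a continuous function $x:[0,\infty)\to\mathbb R^2$ with $x(0)=x^0$ satisfying the differential equations for $t>0$; under the stated assumptions on $f$ it exists and is unique for every $x^0$. *)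

theory Defs
  imports "HOL-Analysis.Analysis" "HOL-Library.Landau_Symbols"
begin

text \<open>
  Functions on \<open>[0,\<infinity>)\<close> are total functions on the reals; all notions below depend
  only on their values at nonnegative arguments. The maximum norm on the plane is the
  library's \<^const>\<open>infnorm\<close>, see \<open>infnorm_2\<close>.
\<close>

definition RL_integral :: "real \<Rightarrow> (real \<Rightarrow> real) \<Rightarrow> real \<Rightarrow> real" where
  "RL_integral \<kappa> g t =
     1 / Gamma \<kappa> * (LINT s:{0..t}|lborel. (t - s) powr (\<kappa> - 1) * g s)"

text \<open>
  The derivative is given as a relation, so that the existence of the Caputo derivative is
  part of the assertion. It is meant for \<open>0 < \<kappa> \<le> 1\<close> and \<open>t > 0\<close>.
\<close>

definition has_caputo_derivative :: "real \<Rightarrow> (real \<Rightarrow> real) \<Rightarrow> real \<Rightarrow> real \<Rightarrow> bool" where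
  "has_caputo_derivative \<kappa> g D t \<longleftrightarrow>
     (if \<kappa> = 1 then (g has_real_derivative D) (at t)
      else (RL_integral (1 - \<kappa>) (\<lambda>s. g s - g 0) has_real_derivative D) (at t))"

definition has_caputo_derivative_vec ::
    "real ^ 'n \<Rightarrow> (real \<Rightarrow> real ^ 'n) \<Rightarrow> real ^ 'n \<Rightarrow> real \<Rightarrow> bool" where
  "has_caputo_derivative_vec \<alpha> x D t \<longleftrightarrow>
     (\<forall>i. has_caputo_derivative (\<alpha> $ i) (\<lambda>s. x s $ i) (D $ i) t)"

definition caputo_solution ::
    "real ^ 'n \<Rightarrow> real ^ 'n ^ 'n \<Rightarrow> (real \<Rightarrow> real ^ 'n) \<Rightarrow> real ^ 'n \<Rightarrow> (real \<Rightarrow> real ^ 'n) \<Rightarrow> bool" where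
  "caputo_solution \<alpha> A f x0 x \<longleftrightarrow>
     continuous_on {0..} x \<and> x 0 = x0 \<and>
     (\<forall>t>0. has_caputo_derivative_vec \<alpha> x (A *v x t + f t) t)"

definition exponentially_bounded :: "(real \<Rightarrow> real ^ 'n) \<Rightarrow> bool" where
  "exponentially_bounded f \<longleftrightarrow>
     (\<exists>M>0. \<exists>\<gamma>>0. \<forall>t\<ge>0. infnorm (f t) \<le> M * exp (\<gamma> * t))"

end

theory Submission
  imports Defs "HOL-Complex_Analysis.Cauchy_Integral_Theorem"
begin

text \<open>
  Write \<open>G = (diag (s powr \<alpha>1, s powr \<alpha>2) - A)\<^sup>-\<^sup>1\<close>. Each of the conditions (i)--(v) excludes zeros of the
  characteristic function in the closed right half-plane, hence by compactness in a sector
  \<open>\<bar>arg s\<bar> \<le> \<phi>\<close> with \<open>\<phi> > \<pi> / 2\<close>. Integrating \<open>exp (s t) * G s\<close> over the boundary of that sector gives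
  kernels \<open>K\<close> that are \<open>O(t powr (\<alpha>1 - 1))\<close> at \<open>0\<close> and \<open>O(t powr (- \<alpha>1 - 1))\<close> at infinity, and Cauchy's theorem
  identifies their Laplace transforms with \<open>G\<close>. Uniqueness of Laplace transforms then gives
  \<open>x = x0 + K * (f + A x0)\<close> for every solution. As the integral of \<open>K\<close> is \<open>G 0 = - A\<^sup>-\<^sup>1\<close>, the contribution of
  \<open>x0\<close> is \<open>O(t powr - \<alpha>1)\<close>, and all three claims follow by splitting the convolution integral at \<open>t / 2\<close>.
\<close>

section \<open>Laplace transforms and convolution\<close>

text \<open>Nothing is known beforehand about the growth of a solution, so no transform of it is
  available. The equation is therefore integrated and the unknowns are frozen at a time
  \<open>T\<close> beyond the time of interest. Frozen functions have transforms, and as a causal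
  convolution at times up to \<open>T\<close> does not look beyond \<open>T\<close>, nothing is lost
  there.

  Transforms are taken at positive real arguments only. \<open>G\<close> is real there, so the upper
  half of the sector suffices: the lower ray contributes a conjugate, and the kernel becomes an
  imaginary part. The price is that the evaluation point lies on the boundary of the region to which
  Cauchy's theorem is applied.

  The numbers \<open>q1\<close> and \<open>q2\<close> are the values at \<open>pi / 2\<close> of the
  ratios \<open>sin (\<alpha>1 * \<theta>) / sin ((\<alpha>1 + \<alpha>2) * \<theta>)\<close> and
  \<open>sin (\<alpha>2 * \<theta>) / sin ((\<alpha>1 + \<alpha>2) * \<theta>)\<close>. These arise
  when imaginary parts of the characteristic equation are taken at angle \<theta>. They increase
  with \<theta>, so the imaginary axis is the worst case.\<close>

lemma gamma_integral_scaled: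
  fixes a c :: real
  assumes "0 < a" "0 < c"
  shows "has_bochner_integral lborel (\<lambda>t. indicator {0<..} t * (t powr (a - 1) * exp (-(c * t)))) (Gamma a * c powr (- a))"
proof -
  have "(\<integral>\<^sup>+t. ennreal (indicator {0..} t * (t powr (a - 1) / exp t)) \<partial>lborel) = ennreal (Gamma a)"
    using Gamma_conv_nn_integral_real[OF assms(1)] by (simp add: mult.commute)
  moreover have "(\<integral>\<^sup>+t. ennreal (indicator {0..} t * (t powr (a - 1) / exp t)) \<partial>lborel)
     = (\<integral>\<^sup>+t. ennreal (indicator {0<..} t * (t powr (a - 1) * exp (- t))) \<partial>lborel)"
    by (intro nn_integral_cong) (auto simp: indicator_def exp_minus field_simps)
  ultimately have "has_bochner_integral lborel (\<lambda>t. indicator {0<..} t * (t powr (a - 1) * exp (- t))) (Gamma a)"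
    using assms by (intro has_bochner_integral_nn_integral) (auto simp: Gamma_real_pos less_imp_le)
  then have "has_bochner_integral lborel (\<lambda>t. indicator {0<..} (0 + c * t) * ((0 + c * t) powr (a - 1) * exp (- (0 + c * t)))) (Gamma a /\<^sub>R \<bar>c\<bar>)"
    using assms by (subst (asm) lborel_has_bochner_integral_real_affine_iff[where c=c and t=0]) auto
  then have "has_bochner_integral lborel (\<lambda>t. c powr (1 - a) * (indicator {0<..} (0 + c * t) * ((0 + c * t) powr (a - 1) * exp (- (0 + c * t))))) (c powr (1 - a) * (Gamma a /\<^sub>R \<bar>c\<bar>))"
    by (intro has_bochner_integral_mult_right) auto
  moreover have "c powr (1 - a) * (indicator {0<..} (0 + c * t) * ((0 + c * t) powr (a - 1) * exp (- (0 + c * t))))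
      = indicator {0<..} t * (t powr (a - 1) * exp (-(c * t)))" for t
    using assms by (auto simp: indicator_def zero_less_mult_iff powr_mult simp flip: powr_add)
  moreover have "c powr (1 - a) * (Gamma a /\<^sub>R \<bar>c\<bar>) = Gamma a * c powr (- a)"
    using assms by (simp add: powr_diff powr_minus field_simps)
  ultimately show ?thesis by (simp only:)
qed

text \<open>Integrating over the whole line lets Fubini and translation invariance apply directly.
  For functions vanishing at negative arguments the integrand lives on \<open>{0..t}\<close>, as
  \<open>conv_causal_eq\<close> records.\<close>

definition conv :: "(real \<Rightarrow> real) \<Rightarrow> (real \<Rightarrow> real) \<Rightarrow> real \<Rightarrow> real" where
  "conv f g t = (LINT s|lborel. f (t - s) * g s)"

lemma integrable_shift:
  fixes f :: "real \<Rightarrow> real"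
  assumes "integrable lborel f"
  shows "integrable lborel (\<lambda>t. f (t - s))" "(LINT t|lborel. f (t - s)) = (LINT t|lborel. f t)"
  using lborel_integrable_real_affine[OF assms, of 1 "-s"]
        lborel_integral_real_affine[of 1 f "-s"] by (simp_all add: algebra_simps)

lemma integral_conv:
  assumes f: "integrable lborel f" and g: "integrable lborel g"
  shows "has_bochner_integral lborel (conv f g) ((LINT t|lborel. f t) * (LINT t|lborel. g t))"
proof -
  have [measurable]: "f \<in> borel_measurable borel" "g \<in> borel_measurable borel"
    using f g by auto
  have int: "integrable (lborel \<Otimes>\<^sub>M lborel) (\<lambda>(s, t). f (t - s) * g s)"
  proof (rule lborel_pair.Fubini_integrable)
    have "(\<lambda>s. LINT t|lborel. norm (case (s, t) of (s, t) \<Rightarrow> f (t - s) * g s))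
      = (\<lambda>s. (LINT t|lborel. \<bar>f t\<bar>) * \<bar>g s\<bar>)"
      using integrable_shift(2)[of "\<lambda>t. \<bar>f t\<bar>"] f by (auto simp: abs_mult)
    then show "integrable lborel (\<lambda>s. LINT t|lborel. norm (case (s, t) of (s, t) \<Rightarrow> f (t - s) * g s))"
      using g by simp
    show "AE s in lborel. integrable lborel (\<lambda>t. case (s, t) of (s, t) \<Rightarrow> f (t - s) * g s)"
      using integrable_shift(1)[OF f] by simp
  qed measurable
  have "integrable lborel (conv f g)"
    using lborel_pair.integrable_snd[OF int] unfolding conv_def .
  moreover have "(LINT t|lborel. conv f g t) = (LINT s|lborel. LINT t|lborel. f (t - s) * g s)"
    using lborel_pair.Fubini_integral[OF int] unfolding conv_def by simp
  moreover have "\<dots> = (LINT t|lborel. f t) * (LINT t|lborel. g t)"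
    using integrable_shift(2)[OF f] by simp
  ultimately show ?thesis
    by (simp add: has_bochner_integral_iff)
qed

lemma conv_commute: "conv f g t = (LINT u|lborel. f u * g (t - u))"
  using lborel_integral_real_affine[of "-1" "\<lambda>s. f (t - s) * g s" t] unfolding conv_def by simp

text \<open>The weight is multiplicative along \<open>t = (t - s) + s\<close>. Facts on integrable
  or bounded functions thereby carry over to functions that become so only after exponential
  weighting.\<close>

lemma conv_exp: "exp (- (z * t)) * conv f g t = conv (\<lambda>t. exp (- (z * t)) * f t) (\<lambda>t. exp (- (z * t)) * g t) t"
proof -
  have "exp (- (z * t)) * conv f g t = (LINT s|lborel. exp (- (z * t)) * (f (t - s) * g s))"
    unfolding conv_def by simp
  also have "\<dots> = conv (\<lambda>t. exp (- (z * t)) * f t) (\<lambda>t. exp (- (z * t)) * g t) t"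
    unfolding conv_def
    by (intro Bochner_Integration.integral_cong refl) (simp add: algebra_simps flip: exp_add)
  finally show ?thesis .
qed

lemma conv_causal_eq:
  assumes "\<And>t. t < 0 \<Longrightarrow> f t = 0" "\<And>t. t < 0 \<Longrightarrow> g t = 0" "\<And>s. 0 \<le> s \<Longrightarrow> s \<le> t \<Longrightarrow> g s = h s"
  shows "conv f g t = (LINT s:{0..t}|lborel. f (t - s) * h s)"
  unfolding conv_def set_lebesgue_integral_def
proof (intro Bochner_Integration.integral_cong refl)
  fix s show "f (t - s) * g s = indicator {0..t} s *\<^sub>R (f (t - s) * h s)"
    using assms(1)[of "t - s"] assms(2)[of s] assms(3)[of s] by (auto simp: indicator_def)
qed

text \<open>Causal functions may jump at 0. In the integrand the jump sits at the single point
  \<open>u = t\<close>, a null set, so dominated convergence still applies.\<close>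

lemma conv_continuous:
  assumes f: "integrable lborel f" and B: "\<And>t. \<bar>g t\<bar> \<le> B"
    and g: "g \<in> borel_measurable borel" "\<And>t. t \<noteq> 0 \<Longrightarrow> isCont g t"
  shows "isCont (conv f g) t"
proof (subst continuous_at_sequentially, intro allI impI)
  fix X :: "nat \<Rightarrow> real" assume X: "X \<longlonglongrightarrow> t"
  have [measurable]: "f \<in> borel_measurable borel" "g \<in> borel_measurable borel"
    using f g by auto
  have "(\<lambda>n. LINT u|lborel. f u * g (X n - u)) \<longlonglongrightarrow> (LINT u|lborel. f u * g (t - u))"
  proof (rule integral_dominated_convergence[where w="\<lambda>u. \<bar>f u\<bar> * B"])
    show "AE u in lborel. (\<lambda>n. f u * g (X n - u)) \<longlonglongrightarrow> f u * g (t - u)"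
      using AE_lborel_singleton[of t]
    proof eventually_elim
      fix u assume "u \<noteq> t"
      then have "isCont g (t - u)" using g(2) by simp
      then show "(\<lambda>n. f u * g (X n - u)) \<longlonglongrightarrow> f u * g (t - u)"
        by (intro tendsto_mult tendsto_const isCont_tendsto_compose[of _ g] tendsto_diff X) auto
    qed
    show "AE u in lborel. norm (f u * g (X n - u)) \<le> \<bar>f u\<bar> * B" for n
      using B by (auto simp: abs_mult intro!: mult_left_mono)
  qed (use f in auto)
  then show "(conv f g \<circ> X) \<longlonglongrightarrow> conv f g t"
    by (simp add: conv_commute o_def)
qed

lemma conv_bound:
  assumes f: "integrable lborel f" and B: "\<And>t. \<bar>g t\<bar> \<le> B"
    and g: "g \<in> borel_measurable borel"
  shows "\<bar>conv f g t\<bar> \<le> (LINT u|lborel. \<bar>f u\<bar>) * B"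
proof -
  have [measurable]: "f \<in> borel_measurable borel" "g \<in> borel_measurable borel"
    using f g by auto
  have "\<bar>conv f g t\<bar> \<le> (LINT u|lborel. \<bar>f u * g (t - u)\<bar>)"
    unfolding conv_commute using integral_norm_bound[of lborel "\<lambda>u. f u * g (t - u)"] by simp
  also have "\<dots> \<le> (LINT u|lborel. \<bar>f u\<bar> * B)"
  proof (rule integral_mono)
    show "integrable lborel (\<lambda>u. \<bar>f u * g (t - u)\<bar>)"
      by (rule Bochner_Integration.integrable_bound[of _ "\<lambda>u. \<bar>f u\<bar> * B"])
         (use f B in \<open>auto simp: abs_mult intro!: mult_mono order_trans[OF B] abs_ge_self\<close>)
  qed (use f B in \<open>auto simp: abs_mult intro!: mult_left_mono\<close>)
  finally show ?thesis by simp
qed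

text \<open>Causality is part of the notion, so that \<open>conv\<close> becomes the one-sided
  convolution. Only real \<open>z > 0\<close> are tested, which is enough for uniqueness;
  \<open>F\<close> is unconstrained elsewhere.\<close>

definition has_laplace :: "(real \<Rightarrow> real) \<Rightarrow> (real \<Rightarrow> real) \<Rightarrow> bool" where
  "has_laplace f F \<longleftrightarrow> (\<forall>t<0. f t = 0) \<and>
     (\<forall>z>0. has_bochner_integral lborel (\<lambda>t. exp (- (z * t)) * f t) (F z))"

text \<open>Growth slower than every exponential, with a possible jump at 0. Such functions have
  transforms on all of \<open>z > 0\<close>, and convolution with a kernel that has a transform
  stays in the class (\<open>subexponential_conv\<close>).\<close>

definition subexponential :: "(real \<Rightarrow> real) \<Rightarrow> bool" where
  "subexponential u \<longleftrightarrow> (\<forall>t<0. u t = 0) \<and> continuous_on {0..} u \<and>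
     (\<forall>z>0. \<exists>B. \<forall>t. \<bar>exp (- (z * t)) * u t\<bar> \<le> B)"

lemma has_laplace_causal: "has_laplace f F \<Longrightarrow> t < 0 \<Longrightarrow> f t = 0"
  by (simp add: has_laplace_def)

lemma subexponential_causal: "subexponential f \<Longrightarrow> t < 0 \<Longrightarrow> f t = 0"
  by (simp add: subexponential_def)

lemma has_laplace_conv:
  assumes "has_laplace f F" "has_laplace g G"
  shows "has_laplace (conv f g) (\<lambda>z. F z * G z)"
  unfolding has_laplace_def
proof (intro conjI allI impI)
  fix t :: real assume "t < 0"
  then have "f (t - s) * g s = 0" for s
    using has_laplace_causal[OF assms(1), of "t - s"] has_laplace_causal[OF assms(2), of s] by force
  then have "(\<lambda>s. f (t - s) * g s) = (\<lambda>s. 0)" by blast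
  then show "conv f g t = 0" by (simp only: conv_def) simp
next
  fix z :: real assume "0 < z"
  then show "has_bochner_integral lborel (\<lambda>t. exp (- (z * t)) * conv f g t) (F z * G z)"
    unfolding conv_exp
    using assms integral_conv[of "\<lambda>t. exp (- (z * t)) * f t" "\<lambda>t. exp (- (z * t)) * g t"]
    unfolding has_laplace_def by (auto simp: has_bochner_integral_iff)
qed

lemma has_laplace_add:
  "has_laplace f F \<Longrightarrow> has_laplace g G \<Longrightarrow> has_laplace (\<lambda>t. f t + g t) (\<lambda>z. F z + G z)"
  unfolding has_laplace_def by (auto simp: distrib_left intro!: has_bochner_integral_add)

lemma has_laplace_cmult:
  assumes "has_laplace f F" shows "has_laplace (\<lambda>t. c * f t) (\<lambda>z. c * F z)"
  unfolding has_laplace_def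
proof (intro conjI allI impI)
  fix z :: real assume "0 < z"
  then have "has_bochner_integral lborel (\<lambda>t. c * (exp (- (z * t)) * f t)) (c * F z)"
    using assms by (intro has_bochner_integral_mult_right) (auto simp: has_laplace_def)
  then show "has_bochner_integral lborel (\<lambda>t. exp (- (z * t)) * (c * f t)) (c * F z)"
    by (simp add: mult.left_commute)
qed (use assms in \<open>simp add: has_laplace_def\<close>)

lemma subexponential_measurable:
  assumes "subexponential u" shows "u \<in> borel_measurable borel"
proof -
  have "u = (\<lambda>t. indicator {0..} t *\<^sub>R u t)"
    using subexponential_causal[OF assms] by (force simp: indicator_def)
  moreover have "(\<lambda>t. indicator {0..} t *\<^sub>R u t) \<in> borel_measurable borel"
    using assms by (intro borel_measurable_continuous_on_indicator) (auto simp: subexponential_def)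
  ultimately show ?thesis by simp
qed

lemma subexponential_isCont:
  assumes "subexponential u" "t \<noteq> 0" shows "isCont u t"
proof (cases "t < 0")
  case True
  have "\<forall>\<^sub>F s in nhds t. u s = 0"
    using eventually_nhds_in_open[of "{..<0}" t] True
    by (auto elim!: eventually_mono intro: subexponential_causal[OF assms(1)])
  then have "isCont u t \<longleftrightarrow> isCont (\<lambda>_. 0::real) t" by (rule isCont_cong)
  then show ?thesis by simp
next
  case False
  then show ?thesis using assms
    by (auto simp: subexponential_def intro: continuous_on_interior[of "{0..}"])
qed

lemma integrable_exp_tail:
  assumes "0 < c"
  shows "integrable lborel (\<lambda>t::real. indicator {0<..} t * exp (- (c * t)))"
proof -
  have eq: "(\<lambda>t. indicator {0<..} t * (t powr (1 - 1) * exp (- (c * t)))) = (\<lambda>t. indicator {0<..} t * exp (- (c * t)))"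
    by (intro ext) (auto simp: indicator_def)
  show ?thesis
    using integrable.intros[OF gamma_integral_scaled[OF zero_less_one assms]] unfolding eq .
qed

text \<open>Half of the exponent bounds \<open>u\<close>, the other half makes the bound
  integrable.\<close>

lemma subexponential_integrable:
  assumes u: "subexponential u" and z: "0 < z"
  shows "integrable lborel (\<lambda>t. exp (- (z * t)) * u t)"
proof -
  have [measurable]: "u \<in> borel_measurable borel" by (rule subexponential_measurable[OF u])
  obtain B where B: "\<And>t. \<bar>exp (- (z/2 * t)) * u t\<bar> \<le> B"
    using u z half_gt_zero unfolding subexponential_def by metis
  show ?thesis
  proof (rule Bochner_Integration.integrable_bound[of _ "\<lambda>t. B * (indicator {0<..} t * exp (- (z/2 * t)))"])
    show "integrable lborel (\<lambda>t. B * (indicator {0<..} t * exp (- (z/2 * t))))"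
      using integrable_exp_tail[of "z/2"] z by simp
    show "AE t in lborel. norm (exp (- (z * t)) * u t) \<le> norm (B * (indicator {0<..} t * exp (- (z/2 * t))))"
      using AE_lborel_singleton[of 0]
    proof eventually_elim
      fix t :: real assume "t \<noteq> 0"
      have "\<bar>exp (- (z * t)) * u t\<bar> = exp (- (z/2 * t)) * \<bar>exp (- (z/2 * t)) * u t\<bar>"
        by (simp add: abs_mult mult.assoc[symmetric] flip: exp_add)
      also have "\<dots> \<le> exp (- (z/2 * t)) * \<bar>B\<bar>"
        using B[of t] by (intro mult_left_mono) auto
      finally show "norm (exp (- (z * t)) * u t) \<le> norm (B * (indicator {0<..} t * exp (- (z/2 * t))))"
        using \<open>t \<noteq> 0\<close> subexponential_causal[OF u, of t] by (auto simp: indicator_def abs_mult mult.commute)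
    qed
  qed measurable
qed

lemma subexponential_has_laplace:
  assumes u: "subexponential u"
  shows "has_laplace u (\<lambda>z. LINT t|lborel. exp (- (z * t)) * u t)"
  using subexponential_integrable[OF u] subexponential_causal[OF u]
  by (auto simp: has_laplace_def has_bochner_integral_iff)

text \<open>After weighting, an integrable function is convolved with a bounded one; the result is
  bounded and continuous. For continuity the single weight \<open>z = 1\<close> suffices.\<close>

lemma subexponential_conv:
  assumes f: "has_laplace f F" and u: "subexponential u"
  shows "subexponential (conv f u)"
  unfolding subexponential_def
proof (intro conjI allI impI)
  show "conv f u t = 0" if "t < 0" for t
    using has_laplace_causal[OF has_laplace_conv[OF f subexponential_has_laplace[OF u]] that] .
  have int: "integrable lborel (\<lambda>t. exp (- (z * t)) * f t)" if "0 < z" for z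
    using f that by (auto simp: has_laplace_def has_bochner_integral_iff)
  have meas: "(\<lambda>t. exp (- (z * t)) * u t) \<in> borel_measurable borel" for z
    using subexponential_measurable[OF u] by measurable
  have bd: "\<exists>B. \<forall>t. \<bar>exp (- (z * t)) * u t\<bar> \<le> B" if "0 < z" for z
    using u that by (auto simp: subexponential_def)
  show "\<exists>B. \<forall>t. \<bar>exp (- (z * t)) * conv f u t\<bar> \<le> B" if "0 < z" for z
    using bd[OF that] conv_bound[OF int[OF that] _ meas[of z]] unfolding conv_exp by blast
  show "continuous_on {0..} (conv f u)"
  proof (intro continuous_at_imp_continuous_on ballI)
    fix t :: real
    obtain B where B: "\<And>t. \<bar>exp (- (1 * t)) * u t\<bar> \<le> B" using bd[of 1] by auto
    have "isCont (conv (\<lambda>t. exp (- (1 * t)) * f t) (\<lambda>t. exp (- (1 * t)) * u t)) t"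
      by (rule conv_continuous[OF int[of 1] B meas])
         (auto intro!: continuous_intros subexponential_isCont[OF u])
    then have "isCont (\<lambda>t. exp t * (exp (- (1 * t)) * conv f u t)) t"
      unfolding conv_exp by (intro continuous_intros)
    then show "isCont (conv f u) t" by (simp add: mult.assoc[symmetric] flip: exp_add)
  qed
qed

lemma subexponential_add:
  assumes "subexponential u" "subexponential v" shows "subexponential (\<lambda>t. u t + v t)"
  unfolding subexponential_def
proof (intro conjI allI impI)
  fix z :: real assume "0 < z"
  then obtain B C where "\<And>t. \<bar>exp (- (z * t)) * u t\<bar> \<le> B" "\<And>t. \<bar>exp (- (z * t)) * v t\<bar> \<le> C"
    using assms unfolding subexponential_def by meson
  then have "\<bar>exp (- (z * t)) * (u t + v t)\<bar> \<le> B + C" for t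
    unfolding distrib_left by (intro order_trans[OF abs_triangle_ineq] add_mono)
  then show "\<exists>B. \<forall>t. \<bar>exp (- (z * t)) * (u t + v t)\<bar> \<le> B" by blast
qed (use assms in \<open>auto simp: subexponential_def intro!: continuous_intros\<close>)

lemma subexponential_cmult:
  assumes "subexponential u" shows "subexponential (\<lambda>t. c * u t)"
  unfolding subexponential_def
proof (intro conjI allI impI)
  fix z :: real assume "0 < z"
  then obtain B where "\<And>t. \<bar>exp (- (z * t)) * u t\<bar> \<le> B"
    using assms unfolding subexponential_def by meson
  then have "\<bar>exp (- (z * t)) * (c * u t)\<bar> \<le> \<bar>c\<bar> * B" for t
    using mult_left_mono[of "\<bar>exp (- (z * t)) * u t\<bar>" B "\<bar>c\<bar>"] by (simp add: abs_mult mult.left_commute)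
  then show "\<exists>B. \<forall>t. \<bar>exp (- (z * t)) * (c * u t)\<bar> \<le> B" by blast
qed (use assms in \<open>auto simp: subexponential_def intro!: continuous_intros\<close>)

text \<open>With \<open>p = exp (- t)\<close> the hypothesis says that all moments of a continuous function on \<open>{0..1}\<close> vanish.\<close>

lemma laplace_zero_unique:
  assumes u: "subexponential u" and L: "has_laplace u (\<lambda>z. 0)" and t: "0 \<le> t"
  shows "u t = 0"
proof -
  obtain B where B: "\<And>t. \<bar>exp (- (1 * t)) * u t\<bar> \<le> B"
    using u unfolding subexponential_def by (metis zero_less_one)
  then have B: "\<bar>u t\<bar> \<le> B * exp t" for t
    using mult_left_mono[OF B[of t], of "exp t"] by (simp add: abs_mult mult.assoc[symmetric] mult.commute flip: exp_add)
  have [measurable]: "u \<in> borel_measurable borel" by (rule subexponential_measurable[OF u])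
  have int: "integrable lborel (\<lambda>t. exp (- (z * t)) * u t)"
    and zero: "(LINT t|lborel. exp (- (z * t)) * u t) = 0" if "0 < z" for z
    using L that by (auto simp: has_laplace_def has_bochner_integral_iff)
  \<comment> \<open>One factor \<open>p\<close> cancels the growth of \<open>u (- ln p)\<close>,
    which is at most \<open>B / p\<close>; the other makes \<open>w\<close> tend to 0 at
    \<open>p = 0\<close>, where the conditional supplies that value.\<close>
  define w where "w p = (if p \<le> 0 then 0 else p\<^sup>2 * u (- ln p))" for p :: real
  define W where "W t = w (exp (- t))" for t
  have W: "W t = exp (- (2 * t)) * u t" for t
    by (simp add: W_def w_def power2_eq_square flip: exp_add)
  have "continuous_on {0..1} w"
    unfolding continuous_on_eq_continuous_within
  proof
    fix p :: real assume p: "p \<in> {0..1}"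
    show "continuous (at p within {0..1}) w"
    proof (cases "p = 0")
      case True
      have "(w \<longlongrightarrow> 0) (at 0 within {0..1})"
      proof (rule Lim_null_comparison)
        show "\<forall>\<^sub>F p in at 0 within {0..1}. norm (w p) \<le> p * B"
          unfolding eventually_at_filter
        proof (intro always_eventually allI impI)
          fix p :: real assume "p \<noteq> 0" "p \<in> {0..1}"
          then have p: "0 < p" by auto
          have "\<bar>u (- ln p)\<bar> \<le> B / p" using B[of "- ln p"] p by (simp add: exp_minus divide_inverse)
          then have "p\<^sup>2 * \<bar>u (- ln p)\<bar> \<le> p\<^sup>2 * (B / p)" by (rule mult_left_mono) simp
          then show "norm (w p) \<le> p * B" using p by (simp add: w_def abs_mult power2_eq_square)
        qed
        show "((\<lambda>p. p * B) \<longlongrightarrow> 0) (at 0 within {0..1})" 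
          by (rule tendsto_eq_intros refl | simp)+
      qed
      then show ?thesis using True by (simp add: continuous_within w_def)
    next
      case False
      have "continuous_on {0<..1} (\<lambda>p. p\<^sup>2 * u (- ln p))"
        using u by (auto simp: subexponential_def intro!: continuous_intros continuous_on_compose2[of "{0..}" u])
      then have "continuous_on {0<..1} w"
        by (rule continuous_on_eq) (auto simp: w_def)
      then have "continuous (at p within {0<..1}) w"
        using p False by (simp add: continuous_on_eq_continuous_within)
      moreover have "at p within {0<..1} = at p within {0..1}"
        using p False by (intro at_within_nhd[of _ "{0<..}"]) auto
      ultimately show ?thesis by simp
    qed
  qed
  \<comment> \<open>The integral of the square of \<open>w\<close> over \<open>{0..1}\<close>, the
    factor \<open>exp (- t)\<close> coming from \<open>dp\<close>.\<close>
  define I where "I = (LINT t|lborel. exp (- t) * (W t)\<^sup>2)"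
  have intW: "integrable lborel (\<lambda>t. exp (- t) * \<bar>W t\<bar>)"
    using integrable_abs[OF int[of 3]] by (simp add: W abs_mult mult.assoc[symmetric] flip: exp_add)
  have causal: "t < 0 \<Longrightarrow> W t = 0" for t by (simp add: W subexponential_causal[OF u])
  have meas[measurable]: "W \<in> borel_measurable borel" unfolding W by measurable
  have WB: "\<bar>W t\<bar> \<le> B" for t
  proof (cases "t < 0")
    case True then show ?thesis using B[of t] causal[OF True]
      by (smt (verit) exp_gt_zero zero_le_mult_iff)
  next
    case False
    have "\<bar>W t\<bar> \<le> exp (- (2 * t)) * (B * exp t)" unfolding W using B[of t] by (simp add: abs_mult)
    also have "\<dots> = exp (- t) * B" by (simp add: mult.commute mult.assoc flip: exp_add)
    also have "\<dots> \<le> 1 * B"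
      using False B[of t] by (intro mult_right_mono) (auto simp: zero_le_mult_iff intro: order_trans[of _ "\<bar>u t\<bar>"] dest: order_trans[OF abs_ge_zero])
    finally show ?thesis by simp
  qed
  have intWW: "integrable lborel (\<lambda>t. exp (- t) * (W t)\<^sup>2)"
  proof (rule Bochner_Integration.integrable_bound[of _ "\<lambda>t. B * (exp (- t) * \<bar>W t\<bar>)"])
    show "AE t in lborel. norm (exp (- t) * (W t)\<^sup>2) \<le> norm (B * (exp (- t) * \<bar>W t\<bar>))"
    proof (intro AE_I2)
      fix t
      have "exp (- t) * \<bar>W t\<bar> * \<bar>W t\<bar> \<le> exp (- t) * \<bar>W t\<bar> * \<bar>B\<bar>"
        using WB[of t] by (intro mult_left_mono) auto
      then show "norm (exp (- t) * (W t)\<^sup>2) \<le> norm (B * (exp (- t) * \<bar>W t\<bar>))"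
        by (simp add: abs_mult power2_eq_square mult_ac)
    qed
  qed (use intW in auto)
  define J where "J = (LINT t|lborel. exp (- t) * \<bar>W t\<bar>)"
  have small: "I \<le> e * J" if "0 < e" for e :: real
  proof -
    \<comment> \<open>Against a polynomial in \<open>exp (- t)\<close>, the integral of
      \<open>exp (- t) * W t\<close> is a combination of transforms of \<open>u\<close> at
      \<open>3 + i\<close>, all zero. So \<open>I\<close> only sees the approximation error
      \<open>W - P\<close>.\<close>
    obtain P where "real_polynomial_function P" and P: "\<And>x. x \<in> {0..1} \<Longrightarrow> \<bar>w x - P x\<bar> < e"
      using Stone_Weierstrass_real_polynomial_function[OF compact_Icc \<open>continuous_on {0..1} w\<close> \<open>0 < e\<close>] by blast
    then obtain a n where P_sum: "P = (\<lambda>x. \<Sum>i\<le>n. a i * x ^ i)"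
      using real_polynomial_function_iff_sum by auto
    have eq: "exp (- t) * W t * P (exp (- t)) = (\<Sum>i\<le>n. a i * (exp (- ((3 + real i) * t)) * u t))" for t
    proof -
      have "exp (- t) * exp (- (2 * t)) * exp (- t) ^ i = exp (- ((3 + real i) * t))" for i
        unfolding exp_of_nat_mult[symmetric] exp_add[symmetric] by (simp add: algebra_simps)
      then have "exp (- t) * (exp (- (2 * t)) * u t) * (a i * exp (- t) ^ i)
          = a i * (exp (- ((3 + real i) * t)) * u t)" for i
        by (metis (no_types, lifting) mult.assoc mult.commute)
      then show ?thesis unfolding P_sum W sum_distrib_left by (intro sum.cong refl)
    qed
    have intP: "integrable lborel (\<lambda>t. exp (- t) * W t * P (exp (- t)))"
      unfolding eq by (intro Bochner_Integration.integrable_sum Bochner_Integration.integrable_mult_right int) auto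
    have "(LINT t|lborel. exp (- t) * W t * P (exp (- t))) = (\<Sum>i\<le>n. LINT t|lborel. a i * (exp (- ((3 + real i) * t)) * u t))"
      unfolding eq by (intro Bochner_Integration.integral_sum Bochner_Integration.integrable_mult_right int) auto
    also have "\<dots> = 0" by (simp add: zero)
    finally have "I = (LINT t|lborel. exp (- t) * (W t)\<^sup>2 - exp (- t) * W t * P (exp (- t)))"
      using intWW intP by (simp add: I_def)
    also have "\<dots> \<le> (LINT t|lborel. e * (exp (- t) * \<bar>W t\<bar>))"
    proof (rule integral_mono)
      fix t :: real
      show "exp (- t) * (W t)\<^sup>2 - exp (- t) * W t * P (exp (- t)) \<le> e * (exp (- t) * \<bar>W t\<bar>)"
      proof (cases "t < 0")
        case False
        then have "\<bar>W t - P (exp (- t))\<bar> \<le> e" using P[of "exp (- t)"] by (simp add: W_def)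
        then have "\<bar>exp (- t) * W t\<bar> * \<bar>W t - P (exp (- t))\<bar> \<le> \<bar>exp (- t) * W t\<bar> * e" by (intro mult_left_mono) auto
        moreover have "exp (- t) * (W t)\<^sup>2 - exp (- t) * W t * P (exp (- t)) \<le> \<bar>exp (- t) * W t\<bar> * \<bar>W t - P (exp (- t))\<bar>"
          unfolding abs_mult[symmetric] by (intro order_trans[OF _ abs_ge_self]) (simp add: algebra_simps power2_eq_square)
        ultimately show ?thesis by (simp add: abs_mult mult_ac)
      qed (simp add: causal)
    qed (use intWW intP intW in auto)
    finally show ?thesis by (simp add: J_def)
  qed
  have "((\<lambda>e. e * J) \<longlongrightarrow> 0 * J) (at_right 0)" by (intro tendsto_intros)
  then have "I \<le> 0 * J"
    by (rule tendsto_lowerbound) (auto simp: eventually_at_filter intro!: always_eventually small)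
  then have "I = 0" unfolding I_def
    by (simp add: order_antisym_conv)
  \<comment> \<open>Passing from a vanishing integral to vanishing values requires a nondegenerate
    interval, also for \<open>t = 0\<close>.\<close>
  define T where "T = t + 1"
  have cont: "continuous_on {0..T} (\<lambda>t. exp (- t) * (W t)\<^sup>2)"
    using u unfolding W subexponential_def by (auto intro!: continuous_intros intro: continuous_on_subset)
  have "integral {0..T} (\<lambda>t. exp (- t) * (W t)\<^sup>2) = (LINT t:{0..T}|lborel. exp (- t) * (W t)\<^sup>2)"
    using borel_integrable_atLeastAtMost'[OF cont]
    by (intro set_borel_integral_eq_integral(2)[symmetric]) (auto simp: set_integrable_def)
  also have "\<dots> \<le> I" unfolding I_def set_lebesgue_integral_def
    using intWW by (intro integral_mono integrable_mult_indicator) (auto simp: indicator_def)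
  finally have "integral {0..T} (\<lambda>t. exp (- t) * (W t)\<^sup>2) = 0"
    using \<open>I = 0\<close> by (intro order_antisym integral_nonneg integrable_continuous_real[OF cont]) auto
  then have "\<forall>s\<in>{0..T}. exp (- s) * (W s)\<^sup>2 = 0"
    using integral_eq_0_iff[OF cont] t by (simp add: T_def)
  then have "W t = 0" using t by (auto simp: T_def)
  then show ?thesis by (simp add: W)
qed

lemma laplace_unique:
  assumes "subexponential u" "subexponential v" "has_laplace u U" "has_laplace v V"
    and "\<And>z. 0 < z \<Longrightarrow> U z = V z"
  shows "u t = v t"
proof (cases "t < 0")
  case False
  have "subexponential (\<lambda>t. u t + (-1) * v t)"
    by (intro subexponential_add subexponential_cmult assms)
  moreover have "has_laplace (\<lambda>t. u t + (-1) * v t) (\<lambda>z. U z + (-1) * V z)"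
    by (intro has_laplace_add has_laplace_cmult assms)
  then have "has_laplace (\<lambda>t. u t + (-1) * v t) (\<lambda>z. 0)"
    using assms(5) by (auto simp: has_laplace_def)
  ultimately show ?thesis using laplace_zero_unique[of "\<lambda>t. u t + (-1) * v t" t] False by simp
qed (use assms in \<open>simp add: subexponential_causal\<close>)

section \<open>Riemann-Liouville kernels\<close>

definition RL_kernel :: "real \<Rightarrow> real \<Rightarrow> real" where
  "RL_kernel a t = indicator {0<..} t * (t powr (a - 1) / Gamma a)"

lemma RL_kernel_laplace:
  assumes "0 < a" shows "has_laplace (RL_kernel a) (\<lambda>z. z powr (- a))"
  unfolding has_laplace_def
proof (intro conjI allI impI)
  fix z :: real assume "0 < z"
  then have "has_bochner_integral lborel (\<lambda>t. (1 / Gamma a) * (indicator {0<..} t * (t powr (a - 1) * exp (- (z * t)))))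
     ((1 / Gamma a) * (Gamma a * z powr (- a)))"
    using assms by (intro has_bochner_integral_mult_right gamma_integral_scaled)
  then show "has_bochner_integral lborel (\<lambda>t. exp (- (z * t)) * RL_kernel a t) (z powr - a)"
    using Gamma_real_pos[OF assms] by (simp add: RL_kernel_def mult_ac)
qed (simp add: RL_kernel_def)

lemma conv_RL_kernel:
  assumes "\<And>t. t < 0 \<Longrightarrow> g t = 0" "\<And>s. 0 \<le> s \<Longrightarrow> s \<le> t \<Longrightarrow> g s = h s"
  shows "conv (RL_kernel a) g t = RL_integral a h t"
proof -
  have "conv (RL_kernel a) g t = (LINT s:{0..t}|lborel. RL_kernel a (t - s) * h s)"
    by (rule conv_causal_eq) (use assms in \<open>auto simp: RL_kernel_def\<close>)
  also have "\<dots> = (LINT s:{0..t}|lborel. 1 / Gamma a * ((t - s) powr (a - 1) * h s))"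
    unfolding set_lebesgue_integral_def
    by (intro Bochner_Integration.integral_cong) (auto simp: indicator_def RL_kernel_def)
  finally show ?thesis by (simp add: RL_integral_def)
qed

lemma has_laplace_cong:
  assumes "has_laplace f F" "\<And>z. 0 < z \<Longrightarrow> F z = G z" shows "has_laplace f G"
  using assms by (simp add: has_laplace_def)

lemma has_laplace_measurable:
  assumes "has_laplace f F" shows "f \<in> borel_measurable borel"
proof -
  have "has_bochner_integral lborel (\<lambda>t. exp (- (1 * t)) * f t) (F 1)"
    using assms zero_less_one unfolding has_laplace_def by blast
  then have [measurable]: "(\<lambda>t. exp (- (1 * t)) * f t) \<in> borel_measurable borel"
    using borel_measurable_has_bochner_integral by fastforce
  have "(\<lambda>t. exp (1 * t) * (exp (- (1 * t)) * f t)) \<in> borel_measurable borel" by measurable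
  moreover have "exp (1 * t) * (exp (- (1 * t)) * f t) = f t" for t :: real
    by (simp add: mult.assoc[symmetric] flip: exp_add)
  ultimately show ?thesis by (simp only:)
qed

lemma conv_local:
  assumes "\<And>t. t < 0 \<Longrightarrow> f t = 0" "\<And>t. t < 0 \<Longrightarrow> g t = 0" "\<And>t. t < 0 \<Longrightarrow> h t = 0"
    and "\<And>s. 0 \<le> s \<Longrightarrow> s \<le> t \<Longrightarrow> g s = h s"
  shows "conv f g t = conv f h t"
  using conv_causal_eq[of f g t h] conv_causal_eq[of f h t h] assms by simp

text \<open>Splitting the integral would require integrability of each integrand at the given
  \<open>t\<close>; comparing transforms avoids this.\<close>

lemma conv_add_right:
  assumes f: "has_laplace f F" and u: "subexponential u" and v: "subexponential v"
  shows "conv f (\<lambda>t. u t + v t) t = conv f u t + conv f v t"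
proof -
  note lu = subexponential_has_laplace[OF u] and lv = subexponential_has_laplace[OF v]
  show ?thesis
    by (rule laplace_unique[OF _ _ has_laplace_conv[OF f has_laplace_add[OF lu lv]]
          has_laplace_add[OF has_laplace_conv[OF f lu] has_laplace_conv[OF f lv]]])
       (auto simp: distrib_left intro!: subexponential_add subexponential_conv[OF f] u v)
qed

lemma conv_cmult_right: "conv f (\<lambda>t. c * u t) t = c * conv f u t"
  unfolding conv_def by (simp add: mult.left_commute[of _ c])

section \<open>Caputo derivatives and primitives\<close>

text \<open>No growth bound on a solution is available. Freezing it at \<open>T\<close> makes it
  bounded, hence \<open>subexponential\<close>, and leaves it unchanged on
  \<open>{0..T}\<close>.\<close>

definition stop :: "real \<Rightarrow> (real \<Rightarrow> real) \<Rightarrow> real \<Rightarrow> real" where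
  "stop T u t = (if t < 0 then 0 else u (min t T))"

lemma subexponential_stop:
  assumes u: "continuous_on {0..} u" and T: "0 \<le> T"
  shows "subexponential (stop T u)"
  unfolding subexponential_def
proof (intro conjI allI impI)
  have "continuous_on {0..} (\<lambda>t. u (min t T))"
    by (rule continuous_on_compose2[OF u]) (use T in \<open>auto intro!: continuous_intros\<close>)
  then show "continuous_on {0..} (stop T u)"
    by (rule continuous_on_eq) (simp add: stop_def)
  have "bounded (u ` {0..T})"
    by (intro compact_imp_bounded compact_continuous_image continuous_on_subset[OF u]) auto
  then obtain B where "\<forall>x\<in>u ` {0..T}. norm x \<le> B" unfolding bounded_iff by blast
  then have B: "\<bar>u s\<bar> \<le> B" if "s \<in> {0..T}" for s using that by auto
  have B0: "0 \<le> B" using B[of 0] T by auto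
  fix z :: real assume "0 < z"
  have "\<bar>exp (- (z * t)) * stop T u t\<bar> \<le> B" for t
  proof (cases "t < 0")
    case False
    have "\<bar>exp (- (z * t)) * stop T u t\<bar> = exp (- (z * t)) * \<bar>u (min t T)\<bar>"
      using False by (simp add: stop_def abs_mult)
    also have "\<dots> \<le> 1 * B" using False \<open>0 < z\<close> T by (intro mult_mono B) auto
    finally show ?thesis by simp
  qed (simp add: stop_def B0)
  then show "\<exists>B. \<forall>t. \<bar>exp (- (z * t)) * stop T u t\<bar> \<le> B" by blast
qed (simp add: stop_def)

abbreviation integ :: "(real \<Rightarrow> real) \<Rightarrow> real \<Rightarrow> real" where
  "integ \<equiv> conv (RL_kernel 1)"

lemma integ_eq_integral:
  assumes "continuous_on {0..t} h" "\<And>t. t < 0 \<Longrightarrow> g t = 0" "\<And>s. 0 \<le> s \<Longrightarrow> s \<le> t \<Longrightarrow> g s = h s"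
  shows "integ g t = integral {0..t} h"
proof -
  have "integ g t = RL_integral 1 h t" by (rule conv_RL_kernel) (use assms in auto)
  also have "\<dots> = (LINT s:{0..t}|lborel. (t - s) powr (1 - 1) * h s)" by (simp add: RL_integral_def)
  \<comment> \<open>At \<open>s = t\<close> the kernel takes the value \<open>0 powr 0 = 0\<close>,
    so the integrands agree only almost everywhere.\<close>
  also have "\<dots> = (LINT s:{0..t}|lborel. h s)"
    unfolding set_lebesgue_integral_def
  proof (rule integral_cong_AE)
    have [measurable]: "(\<lambda>s. indicator {0..t} s *\<^sub>R h s) \<in> borel_measurable borel"
      by (rule borel_measurable_continuous_on_indicator) (use assms in auto)
    show "(\<lambda>s. indicator {0..t} s *\<^sub>R h s) \<in> borel_measurable lborel" by measurable
    have "(\<lambda>s. (t - s) powr (1 - 1) * (indicator {0..t} s *\<^sub>R h s)) \<in> borel_measurable lborel" by measurable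
    then show "(\<lambda>s. indicator {0..t} s *\<^sub>R ((t - s) powr (1 - 1) * h s)) \<in> borel_measurable lborel"
      unfolding real_scaleR_def by (simp only: mult.left_commute)
    show "AE s in lborel. indicator {0..t} s *\<^sub>R ((t - s) powr (1 - 1) * h s) = indicator {0..t} s *\<^sub>R h s"
      using AE_lborel_singleton[of t] by eventually_elim auto
  qed
  also have "\<dots> = integral {0..t} h"
    by (intro set_borel_integral_eq_integral(2) borel_integrable_atLeastAtMost' assms)
  finally show ?thesis .
qed

text \<open>Both primitives have two-sided derivatives at \<open>t\<close>; the margin
  \<open>t < T\<close> ensures that they agree in a neighbourhood of it.\<close>

lemma integ_inject:
  assumes u: "continuous_on {0..} u" "\<And>t. t < 0 \<Longrightarrow> u t = 0" and v: "continuous_on {0..} v" "\<And>t. t < 0 \<Longrightarrow> v t = 0"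
    and eq: "\<And>t. 0 \<le> t \<Longrightarrow> t \<le> T \<Longrightarrow> integ u t = integ v t" and t: "0 < t" "t < T"
  shows "u t = v t"
proof -
  have D: "(integ w has_real_derivative w t) (at t)" if w: "continuous_on {0..} w" "\<And>t. t < 0 \<Longrightarrow> w t = 0" for w
  proof -
    have "((\<lambda>x. integral {0..x} w) has_real_derivative w t) (at t within {0..T})"
      using t by (intro integral_has_real_derivative continuous_on_subset[OF w(1)]) auto
    then have "((\<lambda>x. integral {0..x} w) has_real_derivative w t) (at t)"
      using t by (simp add: at_within_Icc_at)
    then show ?thesis
      by (rule has_field_derivative_transform_within_open[of _ _ _ "{0<..<T}"])
         (use t in \<open>auto intro!: integ_eq_integral[symmetric] w continuous_on_subset[OF w(1)]\<close>)
  qed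
  have "(integ v has_real_derivative u t) (at t)"
    by (rule has_field_derivative_transform_within_open[OF D[OF u], of "{0<..<T}"]) (use t eq in auto)
  then show ?thesis using D[OF v] by (rule DERIV_unique)
qed

text \<open>The operator that \<^const>\<open>has_caputo_derivative\<close> differentiates, applied to \<open>y\<close> with \<open>y 0 = 0\<close>.\<close>

definition caputo_primitive :: "real \<Rightarrow> (real \<Rightarrow> real) \<Rightarrow> real \<Rightarrow> real" where
  "caputo_primitive \<kappa> y = (if \<kappa> = 1 then y else RL_integral (1 - \<kappa>) y)"

text \<open>\<open>caputo_primitive\<close> of a stopped function, in a form to which the
  convolution theorem applies. Order one is separate because \<open>RL_integral 0\<close> is not the
  identity (\<open>Gamma 0 = 0\<close>).\<close>

definition stopped_primitive :: "real \<Rightarrow> real \<Rightarrow> (real \<Rightarrow> real) \<Rightarrow> real \<Rightarrow> real" where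
  "stopped_primitive \<kappa> T y = (if \<kappa> = 1 then stop T y else conv (RL_kernel (1 - \<kappa>)) (stop T y))"

lemma stopped_primitive_eq:
  assumes "0 \<le> t" "t \<le> T"
  shows "stopped_primitive \<kappa> T y t = caputo_primitive \<kappa> y t"
  using assms conv_RL_kernel[of "stop T y" t y "1 - \<kappa>"]
  by (auto simp: stopped_primitive_def caputo_primitive_def stop_def)

lemma subexponential_stopped_primitive:
  assumes "0 < \<kappa>" "\<kappa> \<le> 1" "continuous_on {0..} y" "0 \<le> T"
  shows "subexponential (stopped_primitive \<kappa> T y)"
  using assms subexponential_conv[OF RL_kernel_laplace subexponential_stop, of "1 - \<kappa>" y T] subexponential_stop
  by (auto simp: stopped_primitive_def)

lemma stopped_primitive_laplace:
  assumes "0 < \<kappa>" "\<kappa> \<le> 1" "has_laplace (stop T y) Y"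
  shows "has_laplace (stopped_primitive \<kappa> T y) (\<lambda>z. z powr (\<kappa> - 1) * Y z)"
proof (cases "\<kappa> = 1")
  case True
  then show ?thesis using assms has_laplace_cong[OF assms(3)] by (simp add: stopped_primitive_def)
next
  case False
  then show ?thesis using has_laplace_conv[OF RL_kernel_laplace assms(3), of "1 - \<kappa>"] assms
    by (simp add: stopped_primitive_def)
qed

text \<open>Here the differential equation becomes an integral equation. The derivative is given for
  \<open>t > 0\<close> only; continuity up to 0, read off from the convolution form, is what the
  fundamental theorem needs in addition.\<close>

lemma stopped_primitive_integ:
  assumes \<kappa>: "0 < \<kappa>" "\<kappa> \<le> 1" and y: "continuous_on {0..} y" "y 0 = 0" and w: "continuous_on {0..} w"
    and deriv: "\<And>t. 0 < t \<Longrightarrow> (caputo_primitive \<kappa> y has_real_derivative w t) (at t)"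
    and t: "0 \<le> t" "t \<le> T"
  shows "stopped_primitive \<kappa> T y t = integ (stop T w) t"
proof -
  have sub: "subexponential (stopped_primitive \<kappa> T y)"
    using subexponential_stopped_primitive[OF \<kappa> y(1)] t by simp
  have "continuous_on {0..t} (stopped_primitive \<kappa> T y)"
    using sub by (auto simp: subexponential_def intro: continuous_on_subset)
  then have "continuous_on {0..t} (caputo_primitive \<kappa> y)"
    by (rule continuous_on_eq) (use t stopped_primitive_eq in auto)
  then have "(w has_integral (caputo_primitive \<kappa> y t - caputo_primitive \<kappa> y 0)) {0..t}"
    using deriv t by (intro fundamental_theorem_of_calculus_interior)
      (auto simp: has_real_derivative_iff_has_vector_derivative)
  moreover have "caputo_primitive \<kappa> y 0 = 0"
  proof -
    have "(LINT s:{0..0}|lborel. (0 - s) powr (1 - \<kappa> - 1) * y s) = 0"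
      unfolding set_lebesgue_integral_def
      by (rule integral_eq_zero_AE, use AE_lborel_singleton[of 0] in eventually_elim) (simp add: indicator_def)
    then show ?thesis using y(2) by (simp add: caputo_primitive_def RL_integral_def)
  qed
  ultimately have "caputo_primitive \<kappa> y t = integral {0..t} w" by (simp add: integral_unique)
  also have "\<dots> = integ (stop T w) t"
    by (rule integ_eq_integral[symmetric]) (use w t in \<open>auto simp: stop_def intro: continuous_on_subset\<close>)
  finally show ?thesis using stopped_primitive_eq[OF t] by simp
qed

section \<open>Decaying kernels\<close>

lemma powr_tail_integral:
  fixes a b :: real
  assumes "0 < a" "0 < b"
  shows "has_bochner_integral lborel (\<lambda>t. indicator {b..} t * t powr (- a - 1)) (b powr (- a) / a)"
proof (rule has_bochner_integral_nn_integral)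
  have "((\<lambda>t. t powr (- a - 1)) has_integral - (b powr (- a - 1 + 1)) / (- a - 1 + 1)) {b..}"
    using assms by (intro has_integral_powr_to_inf) auto
  then have "((\<lambda>t. t powr (- a - 1)) has_integral b powr (- a) / a) {b..}" by simp
  then have "(\<integral>\<^sup>+t. ennreal (t powr (- a - 1)) * indicator {b..} t \<partial>lborel) = ennreal (b powr (- a) / a)"
    by (intro nn_integral_has_integral_lebesgue') auto
  then show "(\<integral>\<^sup>+t. ennreal (indicator {b..} t * t powr (- a - 1)) \<partial>lborel) = ennreal (b powr (- a) / a)"
    by (simp add: ennreal_mult' mult.commute ennreal_indicator)
qed (use assms in auto)

text \<open>Both bounds are stated for all \<open>t > 0\<close>, but the first is the useful one
  near 0 and the second at infinity; together they make \<open>K\<close> integrable.\<close>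

locale decaying_kernel =
  fixes K F :: "real \<Rightarrow> real" and a C :: real
  assumes laplace: "has_laplace K F" and a: "0 < a" "a < 1"
    and bd_0: "\<And>t. 0 < t \<Longrightarrow> \<bar>K t\<bar> \<le> C * t powr (a - 1)"
    and bd_inf: "\<And>t. 0 < t \<Longrightarrow> \<bar>K t\<bar> \<le> C * t powr (- a - 1)"
begin

lemma C_nonneg: "0 \<le> C"
  using bd_0[of 1] abs_ge_zero[of "K 1"] by (simp del: abs_ge_zero)

lemma kernel_measurable[measurable]: "K \<in> borel_measurable borel"
  by (rule has_laplace_measurable[OF laplace])

lemma kernel_integrable: "integrable lborel K"
proof (rule Bochner_Integration.integrable_bound)
  \<comment> \<open>The factor \<open>exp 1\<close> compensates \<open>exp (- t)\<close> for
    \<open>t < 1\<close>; the Gamma integral serves as an integrable majorant of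
    \<open>t powr (a - 1)\<close> there.\<close>
  let ?g = "\<lambda>t. C * exp 1 * (indicator {0<..} t * (t powr (a - 1) * exp (- (1 * t)))) + C * (indicator {1..} t * t powr (- a - 1))"
  show "integrable lborel ?g"
    by (intro Bochner_Integration.integrable_add Bochner_Integration.integrable_mult_right
        integrable.intros[OF gamma_integral_scaled] integrable.intros[OF powr_tail_integral]) (use a in auto)
  show "AE t in lborel. norm (K t) \<le> norm (?g t)"
    using AE_lborel_singleton[of 0]
  proof eventually_elim
    fix t :: real assume "t \<noteq> 0"
    have "\<bar>K t\<bar> \<le> ?g t"
    proof -
      consider "t < 0" | "0 < t" "t < 1" | "1 \<le> t" using \<open>t \<noteq> 0\<close> by linarith
      then show ?thesis
      proof cases
        case 1 then show ?thesis using has_laplace_causal[OF laplace 1] by simp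
      next
        case 2
        have "\<bar>K t\<bar> \<le> C * t powr (a - 1) * 1" using bd_0[OF 2(1)] by simp
        also have "\<dots> \<le> C * t powr (a - 1) * (exp 1 * exp (- t))"
          using 2 C_nonneg unfolding exp_add[symmetric] by (intro mult_left_mono) auto
        finally show ?thesis using 2 by (simp add: mult_ac)
      next
        case 3
        have "0 \<le> C * exp 1 * (t powr (a - 1) * exp (- t))" using C_nonneg by simp
        then show ?thesis using bd_inf[of t] 3 by simp
      qed
    qed
    then show "norm (K t) \<le> norm (?g t)" by simp
  qed
qed simp

text \<open>Dominated convergence as the transform variable tends to 0. This is how the total mass
  of a kernel is read off from its transform.\<close>

lemma integral_eq_limit:
  assumes "(F \<longlongrightarrow> L) (at_right 0)"
  shows "(LINT t|lborel. K t) = L"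
proof -
  let ?z = "\<lambda>n. 1 / real (Suc n)"
  have z: "?z \<longlonglongrightarrow> 0" using LIMSEQ_inverse_real_of_nat by (simp add: inverse_eq_divide)
  have "(\<lambda>n. LINT t|lborel. exp (- (?z n * t)) * K t) \<longlonglongrightarrow> (LINT t|lborel. K t)"
  proof (rule integral_dominated_convergence[where w="\<lambda>t. \<bar>K t\<bar>"])
    show "AE t in lborel. (\<lambda>n. exp (- (?z n * t)) * K t) \<longlonglongrightarrow> K t"
    proof (intro AE_I2)
      fix t show "(\<lambda>n. exp (- (?z n * t)) * K t) \<longlonglongrightarrow> K t"
        using tendsto_mult[OF tendsto_exp[OF tendsto_minus[OF tendsto_mult[OF z tendsto_const[of t]]]] tendsto_const[of "K t"]] by simp
    qed
    show "AE t in lborel. norm (exp (- (?z n * t)) * K t) \<le> \<bar>K t\<bar>" for n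
    proof (intro AE_I2)
      fix t
      show "norm (exp (- (?z n * t)) * K t) \<le> \<bar>K t\<bar>"
        by (cases "t < 0") (auto simp: abs_mult has_laplace_causal[OF laplace] intro!: mult_left_le_one_le)
    qed
  qed (use kernel_integrable in auto)
  moreover have "(LINT t|lborel. exp (- (?z n * t)) * K t) = F (?z n)" for n
    by (rule has_bochner_integral_integral_eq[OF laplace[unfolded has_laplace_def, THEN conjunct2, rule_format]]) simp
  moreover have "(\<lambda>n. F (?z n)) \<longlonglongrightarrow> L"
    by (rule filterlim_compose[OF assms]) (auto simp: filterlim_at z simp del: of_nat_Suc intro!: always_eventually)
  ultimately show ?thesis using LIMSEQ_unique by auto
qed

text \<open>In \<open>K u * h (t - u)\<close> with \<open>u < t / 2\<close> the argument of
  \<open>h\<close> exceeds \<open>t / 2\<close>, where \<open>h\<close> is at most \<open>e\<close>;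
  for \<open>u \<ge> t / 2\<close> the tail of \<open>K\<close> is small.\<close>

lemma conv_estimate:
  assumes h: "h \<in> borel_measurable borel" "\<And>t. t < 0 \<Longrightarrow> h t = 0" "\<And>t. \<bar>h t\<bar> \<le> B"
    and t: "0 < t" and e: "0 \<le> e" "\<And>s. t / 2 \<le> s \<Longrightarrow> \<bar>h s\<bar> \<le> e"
  shows "\<bar>conv K h t\<bar> \<le> e * (LINT u|lborel. \<bar>K u\<bar>) + B * C / a * (t / 2) powr (- a)"
proof -
  have [measurable]: "h \<in> borel_measurable borel" by (rule h(1))
  have B: "0 \<le> B" using h(3)[of 0] by simp
  note tail = powr_tail_integral[OF a(1), of "t / 2"]
  have le: "\<bar>K u * h (t - u)\<bar> \<le> e * \<bar>K u\<bar> + B * C * (indicator {t / 2..} u * u powr (- a - 1))" for u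
  proof (cases "t / 2 \<le> u")
    case True
    then have "\<bar>K u\<bar> * \<bar>h (t - u)\<bar> \<le> (C * u powr (- a - 1)) * B"
      using bd_inf[of u] t C_nonneg by (intro mult_mono h(3)) auto
    moreover have "0 \<le> e * \<bar>K u\<bar>" using e by simp
    ultimately show ?thesis using True by (simp add: abs_mult mult_ac)
  next
    case False
    then have "\<bar>K u\<bar> * \<bar>h (t - u)\<bar> \<le> \<bar>K u\<bar> * e" by (intro mult_left_mono e) auto
    then show ?thesis using False by (simp add: abs_mult mult_ac)
  qed
  have int: "integrable lborel (\<lambda>u. e * \<bar>K u\<bar> + B * C * (indicator {t / 2..} u * u powr (- a - 1)))"
    using kernel_integrable integrable.intros[OF tail] t by auto
  have "\<bar>conv K h t\<bar> \<le> (LINT u|lborel. \<bar>K u * h (t - u)\<bar>)"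
    unfolding conv_commute using integral_norm_bound[of lborel "\<lambda>u. K u * h (t - u)"] by simp
  also have "\<dots> \<le> (LINT u|lborel. e * \<bar>K u\<bar> + B * C * (indicator {t / 2..} u * u powr (- a - 1)))"
  proof (rule integral_mono[OF _ int le])
    show "integrable lborel (\<lambda>u. \<bar>K u * h (t - u)\<bar>)"
      by (rule Bochner_Integration.integrable_bound[OF int]) (auto intro!: AE_I2 order_trans[OF le])
  qed
  also have "\<dots> = e * (LINT u|lborel. \<bar>K u\<bar>) + B * C * ((t / 2) powr (- a) / a)"
    using kernel_integrable integrable.intros[OF tail] has_bochner_integral_integral_eq[OF tail] t by simp
  finally show ?thesis by simp
qed

text \<open>The difference is, up to sign, the integral of \<open>K\<close> beyond
  \<open>t\<close>.\<close>

lemma conv_one_estimate: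
  assumes t: "0 < t"
  shows "\<bar>conv K (\<lambda>t. if t < 0 then 0 else 1) t - (LINT u|lborel. K u)\<bar> \<le> C / a * t powr (- a)"
proof -
  note tail = powr_tail_integral[OF a(1) t]
  let ?one = "\<lambda>t :: real. if t < 0 then 0 else 1 :: real"
  have i1: "integrable lborel (\<lambda>u. K u * ?one (t - u))"
    by (rule Bochner_Integration.integrable_bound[OF kernel_integrable]) auto
  have "conv K ?one t - (LINT u|lborel. K u) = (LINT u|lborel. K u * ?one (t - u) - K u)"
    unfolding conv_commute using i1 kernel_integrable by simp
  also have "\<bar>\<dots>\<bar> \<le> (LINT u|lborel. \<bar>K u * ?one (t - u) - K u\<bar>)"
    using integral_norm_bound[of lborel "\<lambda>u. K u * ?one (t - u) - K u"] by simp
  also have "\<dots> \<le> (LINT u|lborel. C * (indicator {t..} u * u powr (- a - 1)))"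
  proof (rule integral_mono)
    show "\<bar>K u * ?one (t - u) - K u\<bar> \<le> C * (indicator {t..} u * u powr (- a - 1))" for u
      using bd_inf[of u] t C_nonneg by (auto simp: indicator_def)
  qed (use i1 kernel_integrable integrable.intros[OF tail] in auto)
  also have "\<dots> = C / a * t powr (- a)"
    using has_bochner_integral_integral_eq[OF tail] by simp
  finally show ?thesis .
qed

end

section \<open>Laplace inversion along a ray\<close>

lemma integral_exp_complex:
  assumes w: "0 < Re w"
  shows "has_bochner_integral lborel (\<lambda>t. indicator {0<..} t *\<^sub>R exp (- (w * of_real t))) (1 / w)"
proof -
  have int: "integrable lborel (\<lambda>t. indicator {0<..} t *\<^sub>R exp (- (w * of_real t)))"
    by (rule Bochner_Integration.integrable_bound[OF integrable_exp_tail[OF w]]) (auto simp: indicator_def)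
  have trunc: "(LINT t|lborel. indicator {..y} t *\<^sub>R (indicator {0<..} t *\<^sub>R exp (- (w * of_real t))))
      = (1 - exp (- (w * of_real y))) / w" if "0 \<le> y" for y
  proof -
    have "(LINT t|lborel. indicator {..y} t *\<^sub>R (indicator {0<..} t *\<^sub>R exp (- (w * of_real t))))
      = (LINT t:{0..y}|lborel. exp (- (w * of_real t)))"
      unfolding set_lebesgue_integral_def
    proof (rule integral_cong_AE)
      show "AE t in lborel. indicator {..y} t *\<^sub>R (indicator {0<..} t *\<^sub>R exp (- (w * of_real t)))
          = indicator {0..y} t *\<^sub>R exp (- (w * of_real t))"
        using AE_lborel_singleton[of 0] by eventually_elim (auto simp: indicator_def)
    qed measurable
    also have "\<dots> = integral {0..y} (\<lambda>t. exp (- (w * of_real t)))"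
      by (intro set_borel_integral_eq_integral(2) borel_integrable_atLeastAtMost') (intro continuous_intros)
    also have "\<dots> = - exp (- (w * of_real y)) / w - (- exp (- (w * of_real 0)) / w)"
    proof (intro integral_unique fundamental_theorem_of_calculus that)
      fix t assume "t \<in> {0..y}"
      have "((\<lambda>t. - exp (- (w * t)) / w) has_field_derivative exp (- (w * of_real t))) (at (of_real t))"
        using w by (auto intro!: derivative_eq_intros)
      from has_vector_derivative_real_field[OF this]
      show "((\<lambda>t. - exp (- (w * of_real t)) / w) has_vector_derivative exp (- (w * of_real t))) (at t within {0..y})"
        by (simp add: has_vector_derivative_at_within)
    qed
    finally show ?thesis using w by (auto simp: diff_divide_distrib)
  qed
  have "((\<lambda>y. exp (- (w * of_real y))) \<longlongrightarrow> 0) at_top"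
  proof (rule tendsto_norm_zero_cancel)
    have "filterlim (\<lambda>y. Re w * y) at_top at_top"
      by (rule filterlim_tendsto_pos_mult_at_top[OF tendsto_const w filterlim_ident])
    then show "((\<lambda>y. norm (exp (- (w * of_real y)))) \<longlongrightarrow> 0) at_top"
      by (auto intro!: filterlim_compose[OF exp_at_bot] simp: filterlim_uminus_at_bot)
  qed
  then have "((\<lambda>y. (1 - exp (- (w * of_real y))) / w) \<longlongrightarrow> (1 - 0) / w) at_top"
    using w by (intro tendsto_intros) auto
  moreover have "\<forall>\<^sub>F y in at_top. (1 - exp (- (w * of_real y))) / w =
      (LINT t|lborel. indicator {..y} t *\<^sub>R (indicator {0<..} t *\<^sub>R exp (- (w * of_real t))))"
    using eventually_ge_at_top[of "0::real"] by eventually_elim (rule trunc[symmetric])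
  ultimately have "((\<lambda>y. LINT t|lborel. indicator {..y} t *\<^sub>R (indicator {0<..} t *\<^sub>R exp (- (w * of_real t)))) \<longlongrightarrow> (1 - 0) / w) at_top"
    by (rule Lim_transform_eventually)
  then have "(LINT t|lborel. indicator {0<..} t *\<^sub>R exp (- (w * of_real t))) = 1 / w"
    using tendsto_unique[OF _ _ tendsto_integral_at_top[OF _ int]] by simp
  then show ?thesis using int by (simp add: has_bochner_integral_iff)
qed

lemma lint_truncated:
  fixes F :: "real \<Rightarrow> complex"
  assumes "continuous_on {0..y} F"
  shows "(LINT t|lborel. indicator {..y} t *\<^sub>R (indicator {0<..} t *\<^sub>R F t)) = integral {0..y} F"
proof -
  have "(LINT t|lborel. indicator {..y} t *\<^sub>R (indicator {0<..} t *\<^sub>R F t)) = (LINT t:{0<..y}|lborel. F t)"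
    unfolding set_lebesgue_integral_def
    by (intro Bochner_Integration.integral_cong) (auto simp: indicator_def)
  also have "\<dots> = integral {0<..y} F"
    by (intro set_borel_integral_eq_integral(2) set_integrable_subset[OF borel_integrable_atLeastAtMost'[OF assms]]) auto
  also have "\<dots> = integral {0..y} F"
    by (rule integral_subset_negligible) (auto intro: negligible_subset[of "{0}"])
  finally show ?thesis .
qed

text \<open>For \<open>0 < \<phi> < pi\<close> these are the points with argument between 0 and
  \<phi>, together with the vertex 0. As an intersection of two half-planes the set is visibly
  convex and closed, which a description by \<open>Arg\<close> would hide.\<close>

definition sector :: "real \<Rightarrow> complex set" where
  "sector \<phi> = {s. 0 \<le> Im s \<and> Im (s * cis (- \<phi>)) \<le> 0}"

lemma convex_sector: "convex (sector \<phi>)"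
proof -
  have "sector \<phi> = {s. \<i> \<bullet> s \<ge> 0} \<inter> {s. Complex (- sin \<phi>) (cos \<phi>) \<bullet> s \<le> 0}"
    by (auto simp: sector_def inner_complex_def algebra_simps)
  then show ?thesis by (simp only:) (intro convex_Int convex_halfspace_ge convex_halfspace_le)
qed

lemma sector_polar:
  assumes "s \<in> sector \<phi>" "s \<noteq> 0" "0 < \<phi>" "\<phi> < pi"
  shows "0 \<le> Arg s" "Arg s \<le> \<phi>"
proof -
  have s: "s = rcis (cmod s) (Arg s)" by (simp add: rcis_cmod_Arg)
  have "0 \<le> cmod s * sin (Arg s)" using assms(1) by (subst (asm) s) (simp add: sector_def del: rcis_cmod_Arg)
  then have "0 \<le> sin (Arg s)" using assms(2) by (simp add: zero_le_mult_iff)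
  then show 0: "0 \<le> Arg s"
    using sin_gt_zero[of "- Arg s"] Arg_bounded[of s] by (force simp: not_le[symmetric])
  have eq: "s * cis (- \<phi>) = rcis (cmod s) (Arg s - \<phi>)"
    by (subst s) (simp add: rcis_def cis_mult)
  have "Im (s * cis (- \<phi>)) \<le> 0" using assms(1) unfolding sector_def by blast
  then have "cmod s * sin (Arg s - \<phi>) \<le> 0" unfolding eq by simp
  then have "sin (Arg s - \<phi>) \<le> 0" using assms(2) by (simp add: mult_le_0_iff)
  then show "Arg s \<le> \<phi>"
    using sin_gt_zero[of "Arg s - \<phi>"] Arg_bounded[of s] assms by force
qed

lemma rcis_in_sector:
  assumes "0 \<le> r" "0 \<le> \<theta>" "\<theta> \<le> \<phi>" "\<phi> < pi"
  shows "rcis r \<theta> \<in> sector \<phi>"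
proof -
  have eq: "rcis r \<theta> * cis (- \<phi>) = rcis r (\<theta> - \<phi>)" by (simp add: rcis_def cis_mult)
  moreover have "0 \<le> r * sin \<theta>" using assms by (intro mult_nonneg_nonneg sin_ge_zero) auto
  moreover have "0 \<le> r * sin (\<phi> - \<theta>)" using assms by (intro mult_nonneg_nonneg sin_ge_zero) auto
  ultimately show ?thesis using sin_minus[of "\<phi> - \<theta>"] unfolding sector_def mem_Collect_eq eq by simp
qed

text \<open>Decay of \<open>G\<close> at infinity governs the kernel at small times; the rate of
  approach to \<open>c\<close> at the vertex governs it at large times. The value \<open>G 0\<close>
  makes \<open>G\<close> continuous on the whole sector, and reality on the positive axis encodes
  the conjugation symmetry.\<close>

locale sectorial =
  fixes G :: "complex \<Rightarrow> complex" and \<phi> a C c :: real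
  assumes phi: "pi / 2 < \<phi>" "\<phi> < pi" and a: "0 < a" "a < 1"
    and diff: "\<And>s. s \<in> sector \<phi> \<Longrightarrow> s \<noteq> 0 \<Longrightarrow> G field_differentiable (at s)"
    and bd_inf: "\<And>s. s \<in> sector \<phi> \<Longrightarrow> s \<noteq> 0 \<Longrightarrow> norm (G s) \<le> C * cmod s powr (- a)"
    and bd_0: "\<And>s. s \<in> sector \<phi> \<Longrightarrow> s \<noteq> 0 \<Longrightarrow> norm (G s - of_real c) \<le> C * cmod s powr a"
    and G0: "G 0 = of_real c"
    and G_real: "\<And>z. 0 < z \<Longrightarrow> Im (G (of_real z)) = 0"
begin

abbreviation "e \<equiv> cis \<phi>"

text \<open>The inversion integral over the two rays of angles \<phi> and -\<phi>. If
  \<open>I\<close> is the integral over the upper ray, the lower one contributes minus its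
  conjugate, and \<open>(I - cnj I) / (2 * pi * \<i>)\<close> equals
  \<open>Im I / pi\<close>.\<close>

definition kernel :: "real \<Rightarrow> real" where
  "kernel t = indicator {0<..} t *
     (Im (LINT r|lborel. indicator {0<..} r *\<^sub>R (e * exp (of_real (r * t) * e) * G (of_real r * e))) / pi)"

lemma C_nonneg: "0 \<le> C"
  using bd_inf[of 1] rcis_in_sector[of 1 0 \<phi>] phi pi_gt_zero norm_ge_zero[of "G 1"]
  by (simp add: cis_zero del: norm_ge_zero)

lemma cos_neg: "0 < - cos \<phi>"
  using phi cos_monotone_0_pi[of "pi / 2" \<phi>] by simp

lemma sin_pos: "0 < sin \<phi>"
  using phi by (intro sin_gt_zero) auto

lemma ray_in_sector: "0 \<le> r \<Longrightarrow> of_real r * e \<in> sector \<phi>"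
  using rcis_in_sector[of r \<phi> \<phi>] phi by (simp add: rcis_def)

lemma of_real_in_sector: "0 \<le> r \<Longrightarrow> of_real r \<in> sector \<phi>"
  using rcis_in_sector[of r 0 \<phi>] phi by (simp add: rcis_def)

lemma continuous_on_sector: "continuous_on (sector \<phi>) G"
  unfolding continuous_on_eq_continuous_within
proof
  fix s assume s: "s \<in> sector \<phi>"
  show "continuous (at s within sector \<phi>) G"
  proof (cases "s = 0")
    case True
    have "((\<lambda>s. G s - of_real c) \<longlongrightarrow> 0) (at 0 within sector \<phi>)"
    proof (rule Lim_null_comparison)
      show "\<forall>\<^sub>F s in at 0 within sector \<phi>. norm (G s - of_real c) \<le> C * cmod s powr a"
        by (auto simp: eventually_at_filter bd_0)
      have "((\<lambda>s. C * cmod s powr a) \<longlongrightarrow> C * cmod 0 powr a) (at 0 within sector \<phi>)"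
        using a by (intro tendsto_intros tendsto_powr') auto
      then show "((\<lambda>s. C * cmod s powr a) \<longlongrightarrow> 0) (at 0 within sector \<phi>)" by simp
    qed
    then show ?thesis using True by (simp add: continuous_within G0 LIM_zero_iff)
  next
    case False
    then show ?thesis using diff[OF s]
      by (simp add: continuous_at_imp_continuous_at_within field_differentiable_imp_continuous_at)
  qed
qed

lemma continuous_on_ray: "continuous_on {0..} (\<lambda>r. G (of_real r * e))"
  by (rule continuous_on_compose2[OF continuous_on_sector]) (auto intro!: continuous_intros ray_in_sector)

lemma ray_measurable: "(\<lambda>r. indicator {0<..} r *\<^sub>R G (of_real r * e)) \<in> borel_measurable borel"
  by (rule borel_measurable_continuous_on_indicator)
     (auto intro: continuous_on_subset[OF continuous_on_ray])

lemma norm_exp_ray: "norm (exp (of_real (r * t) * e)) = exp (- (- cos \<phi> * t * r))"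
  by (simp add: algebra_simps)

lemma norm_G_ray: "0 < r \<Longrightarrow> norm (G (of_real r * e)) \<le> C * r powr (- a)"
  using bd_inf[OF ray_in_sector[of r]] by (simp add: norm_mult)

lemma norm_G_ray_0: "0 < r \<Longrightarrow> norm (G (of_real r * e) - of_real c) \<le> C * r powr a"
  using bd_0[OF ray_in_sector[of r]] by (simp add: norm_mult)

text \<open>On the ray the exponential has modulus \<open>exp (cos \<phi> * t * r)\<close> with
  \<open>cos \<phi> < 0\<close>, which leaves a Gamma integral. Its scaling in \<open>t\<close>
  turns \<open>b = - a\<close> into the kernel bound near 0 and \<open>b = a\<close> into the one at
  infinity.\<close>

lemma ray_integral_bound:
  fixes g :: "real \<Rightarrow> complex"
  assumes t: "0 < t" and b: "-1 < b"
    and g: "\<And>r. 0 < r \<Longrightarrow> norm (g r) \<le> C * r powr b"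
    and meas: "(\<lambda>r. indicator {0<..} r *\<^sub>R g r) \<in> borel_measurable borel"
  shows "integrable lborel (\<lambda>r. indicator {0<..} r *\<^sub>R (e * exp (of_real (r * t) * e) * g r))"
    and "(LINT r|lborel. norm (indicator {0<..} r *\<^sub>R (e * exp (of_real (r * t) * e) * g r)))
       \<le> C * Gamma (b + 1) * (- cos \<phi>) powr (- b - 1) * t powr (- b - 1)"
proof -
  have G: "has_bochner_integral lborel (\<lambda>r. C * (indicator {0<..} r * (r powr (b + 1 - 1) * exp (-(- cos \<phi> * t * r)))))
     (C * (Gamma (b + 1) * (- cos \<phi> * t) powr (- (b + 1))))"
    using t b cos_neg by (intro has_bochner_integral_mult_right gamma_integral_scaled mult_pos_pos) auto
  have eq: "(\<lambda>r. indicator {0<..} r *\<^sub>R (e * exp (of_real (r * t) * e) * g r))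
     = (\<lambda>r. e * exp (of_real (r * t) * e) * (indicator {0<..} r *\<^sub>R g r))"
    by (auto simp: indicator_def)
  have m: "(\<lambda>r. indicator {0<..} r *\<^sub>R (e * exp (of_real (r * t) * e) * g r)) \<in> borel_measurable borel"
    unfolding eq using meas by measurable
  have le: "norm (indicator {0<..} r *\<^sub>R (e * exp (of_real (r * t) * e) * g r))
     \<le> C * (indicator {0<..} r * (r powr (b + 1 - 1) * exp (-(- cos \<phi> * t * r))))" for r
  proof (cases "0 < r")
    case True
    then have "norm (g r) * exp (-(- cos \<phi> * t * r)) \<le> C * r powr b * exp (-(- cos \<phi> * t * r))"
      using g by (intro mult_right_mono) auto
    then show ?thesis using True by (simp add: norm_mult norm_exp_ray mult_ac)
  qed simp
  show int: "integrable lborel (\<lambda>r. indicator {0<..} r *\<^sub>R (e * exp (of_real (r * t) * e) * g r))"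
  proof (rule Bochner_Integration.integrable_bound[OF integrable.intros[OF G]])
    show "AE r in lborel. norm (indicator {0<..} r *\<^sub>R (e * exp (of_real (r * t) * e) * g r))
        \<le> norm (C * (indicator {0<..} r * (r powr (b + 1 - 1) * exp (-(- cos \<phi> * t * r)))))"
      unfolding real_norm_def by (intro AE_I2 order_trans[OF le] abs_ge_self)
  qed (use m in simp)
  have "(LINT r|lborel. norm (indicator {0<..} r *\<^sub>R (e * exp (of_real (r * t) * e) * g r)))
     \<le> C * (Gamma (b + 1) * (- cos \<phi> * t) powr (- (b + 1)))"
    by (rule integral_mono[OF integrable_norm[OF int] integrable.intros[OF G] le,
          unfolded has_bochner_integral_integral_eq[OF G]])
  also have "\<dots> = C * Gamma (b + 1) * (- cos \<phi>) powr (- b - 1) * t powr (- b - 1)"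
    using cos_neg t by (subst powr_mult) auto
  finally show "(LINT r|lborel. norm (indicator {0<..} r *\<^sub>R (e * exp (of_real (r * t) * e) * g r)))
       \<le> C * Gamma (b + 1) * (- cos \<phi>) powr (- b - 1) * t powr (- b - 1)" .
qed

lemma Im_le_integral_norm: "\<bar>Im (LINT r|lborel. F r)\<bar> \<le> (LINT r|lborel. norm (F r))"
  using abs_Im_le_cmod[of "LINT r|lborel. F r"] integral_norm_bound[of lborel F] by linarith

lemma kernel_bound_0:
  assumes "0 < t"
  shows "\<bar>kernel t\<bar> \<le> C * Gamma (1 - a) * (- cos \<phi>) powr (a - 1) / pi * t powr (a - 1)"
proof -
  have "\<bar>kernel t\<bar> = \<bar>Im (LINT r|lborel. indicator {0<..} r *\<^sub>R (e * exp (of_real (r * t) * e) * G (of_real r * e)))\<bar> / pi"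
    using assms by (simp add: kernel_def)
  also have "\<dots> \<le> (C * Gamma (- a + 1) * (- cos \<phi>) powr (- (- a) - 1) * t powr (- (- a) - 1)) / pi"
    by (intro divide_right_mono order_trans[OF Im_le_integral_norm] ray_integral_bound(2))
       (use assms a norm_G_ray ray_measurable in auto)
  finally show ?thesis by simp
qed

text \<open>Replacing \<open>G\<close> by the real constant \<open>c\<close> contributes \<open>- c / t\<close> to the contour integral, which is real.\<close>

lemma kernel_bound_inf:
  assumes "0 < t"
  shows "\<bar>kernel t\<bar> \<le> C * Gamma (1 + a) * (- cos \<phi>) powr (- a - 1) / pi * t powr (- a - 1)"
proof -
  let ?F = "\<lambda>r. indicator {0<..} r *\<^sub>R (e * exp (of_real (r * t) * e) * G (of_real r * e))"
  let ?D = "\<lambda>r. indicator {0<..} r *\<^sub>R (e * exp (of_real (r * t) * e) * (G (of_real r * e) - of_real c))"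
  have m: "(\<lambda>r. indicator {0<..} r *\<^sub>R (G (of_real r * e) - of_real c)) \<in> borel_measurable borel"
    by (rule borel_measurable_continuous_on_indicator)
       (auto intro!: continuous_intros continuous_on_subset[OF continuous_on_ray])
  have D: "integrable lborel ?D"
    by (rule ray_integral_bound(1)[OF assms _ norm_G_ray_0 m]) (use a in auto)
  have "0 < Re (- (of_real t * e))" using cos_neg assms by (simp add: mult_pos_neg)
  from has_bochner_integral_mult_right[OF integral_exp_complex[OF this], of "of_real c * e"]
  have E: "has_bochner_integral lborel (\<lambda>r. of_real c * e * (indicator {0<..} r *\<^sub>R exp (of_real (r * t) * e)))
      (of_real (- c / t))"
    using assms by (simp add: mult_ac)
  have "?F = (\<lambda>r. ?D r + of_real c * e * (indicator {0<..} r *\<^sub>R exp (of_real (r * t) * e)))"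
    by (auto simp: indicator_def algebra_simps)
  then have "(LINT r|lborel. ?F r) = (LINT r|lborel. ?D r) + of_real (- c / t)"
    using D E by (simp add: has_bochner_integral_iff)
  then have "\<bar>kernel t\<bar> = \<bar>Im (LINT r|lborel. ?D r)\<bar> / pi"
    using assms unfolding kernel_def by simp
  also have "\<dots> \<le> (C * Gamma (a + 1) * (- cos \<phi>) powr (- a - 1) * t powr (- a - 1)) / pi"
    by (intro divide_right_mono order_trans[OF Im_le_integral_norm] ray_integral_bound(2)[OF assms _ norm_G_ray_0 m])
       (use a in auto)
  finally show ?thesis by (simp add: add.commute)
qed

text \<open>Integrating \<open>exp (- (z * t))\<close> times the exponential on the ray over
  \<open>t > 0\<close> gives \<open>1 / (z - r * e)\<close>. Absolute integrability comes from the
  bound of order \<open>t powr (a - 1)\<close> on the integral over \<open>r\<close>.\<close>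

lemma kernel_fubini:
  assumes z: "0 < z"
  shows "has_bochner_integral lborel (\<lambda>t. exp (- (z * t)) * kernel t)
      (Im (LINT r|lborel. indicator {0<..} r *\<^sub>R (e * G (of_real r * e) / (of_real z - of_real r * e))) / pi)"
    and "integrable lborel (\<lambda>r. indicator {0<..} r *\<^sub>R (e * G (of_real r * e) / (of_real z - of_real r * e)))"
proof -
  let ?F = "\<lambda>t r. indicator {0<..} r *\<^sub>R (e * exp (of_real (r * t) * e) * G (of_real r * e))"
  define f where "f t r = (indicator {0<..} t * exp (- (z * t))) *\<^sub>R ?F t r" for t r :: real
  have f_eq: "f t r = (indicator {0<..} t * exp (- (z * t))) *\<^sub>R
      (e * exp (of_real (r * t) * e) * (indicator {0<..} r *\<^sub>R G (of_real r * e)))" for t r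
    by (auto simp: f_def indicator_def)
  have [measurable]: "(\<lambda>r. indicator {0<..} r *\<^sub>R G (of_real r * e)) \<in> borel_measurable borel"
    by (rule ray_measurable)
  have meas[measurable]: "(\<lambda>(t, r). f t r) \<in> borel_measurable (lborel \<Otimes>\<^sub>M lborel)"
    unfolding f_eq by measurable
  define B where "B = C * Gamma (- a + 1) * (- cos \<phi>) powr (- (- a) - 1)"
  have inner: "integrable lborel (?F t)" "(LINT r|lborel. norm (?F t r)) \<le> B * t powr (- (- a) - 1)" if "0 < t" for t
    unfolding B_def using ray_integral_bound[OF that _ norm_G_ray ray_measurable] a by auto
  have gam: "integrable lborel (\<lambda>t. B * (indicator {0<..} t * (t powr (a - 1) * exp (- (z * t)))))"
    using gamma_integral_scaled[of a z] a z by (auto simp: has_bochner_integral_iff)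
  have int: "integrable (lborel \<Otimes>\<^sub>M lborel) (\<lambda>(t, r). f t r)"
  proof (rule lborel_pair.Fubini_integrable)
    show "integrable lborel (\<lambda>t. LINT r|lborel. norm (case (t, r) of (t, r) \<Rightarrow> f t r))"
    proof (rule Bochner_Integration.integrable_bound[OF gam])
      show "(\<lambda>t. LINT r|lborel. norm (case (t, r) of (t, r) \<Rightarrow> f t r)) \<in> borel_measurable lborel"
        by measurable
      show "AE t in lborel. norm (LINT r|lborel. norm (case (t, r) of (t, r) \<Rightarrow> f t r))
          \<le> norm (B * (indicator {0<..} t * (t powr (a - 1) * exp (- (z * t)))))"
      proof (intro AE_I2)
        fix t :: real
        show "norm (LINT r|lborel. norm (case (t, r) of (t, r) \<Rightarrow> f t r))
          \<le> norm (B * (indicator {0<..} t * (t powr (a - 1) * exp (- (z * t)))))"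
        proof (cases "0 < t")
          case True
          have "(LINT r|lborel. norm (f t r)) = exp (- (z * t)) * (LINT r|lborel. norm (?F t r))"
            using True unfolding f_def norm_scaleR by simp
          also have "\<dots> \<le> exp (- (z * t)) * (B * t powr (- (- a) - 1))"
            using inner(2)[OF True] by (intro mult_left_mono) auto
          finally show ?thesis using True by (auto simp: mult_ac)
        qed (simp add: f_def)
      qed
    qed
    show "AE t in lborel. integrable lborel (\<lambda>r. case (t, r) of (t, r) \<Rightarrow> f t r)"
    proof (intro AE_I2)
      fix t :: real show "integrable lborel (\<lambda>r. case (t, r) of (t, r) \<Rightarrow> f t r)"
        using inner(1)[of t] unfolding f_def prod.case
        by (cases "0 < t") (intro integrable_scaleR_right, auto)
    qed
  qed (rule meas)
  have t_int: "(LINT t|lborel. f t r) = indicator {0<..} r *\<^sub>R (e * G (of_real r * e) / (of_real z - of_real r * e))" for r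
  proof (cases "0 < r")
    case True
    have "0 < Re (of_real z - of_real r * e)" using z True cos_neg by (simp add: mult_pos_neg order.strict_trans[of _ 0])
    note E = integral_exp_complex[OF this]
    have "f t r = e * G (of_real r * e) * (indicator {0<..} t *\<^sub>R exp (- ((of_real z - of_real r * e) * of_real t)))" for t
    proof -
      have "of_real (exp (- (z * t))) * exp (of_real (r * t) * e) = exp (- ((of_real z - of_real r * e) * of_real t))"
        unfolding exp_of_real[symmetric] exp_add[symmetric] by (simp add: algebra_simps)
      then show ?thesis using True
        by (auto simp: f_def indicator_def scaleR_conv_of_real mult_ac)
    qed
    then have "(\<lambda>t. f t r) = (\<lambda>t. e * G (of_real r * e) * (indicator {0<..} t *\<^sub>R exp (- ((of_real z - of_real r * e) * of_real t))))"
      by (rule ext)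
    then show ?thesis
      using has_bochner_integral_integral_eq[OF has_bochner_integral_mult_right[OF E, of "e * G (of_real r * e)"]] True
      by (simp only:) simp
  qed (simp add: f_def)
  show "integrable lborel (\<lambda>r. indicator {0<..} r *\<^sub>R (e * G (of_real r * e) / (of_real z - of_real r * e)))"
    using lborel_pair.integrable_snd[OF int] by (simp add: t_int)
  have I1: "integrable lborel (\<lambda>t. LINT r|lborel. f t r)"
    using lborel_pair.integrable_fst'[OF int] by simp
  have I2: "(LINT t|lborel. LINT r|lborel. f t r) = (LINT r|lborel. indicator {0<..} r *\<^sub>R (e * G (of_real r * e) / (of_real z - of_real r * e)))"
    using lborel_pair.Fubini_integral[OF int] by (simp add: t_int)
  have "has_bochner_integral lborel (\<lambda>t. LINT r|lborel. f t r) (LINT r|lborel. indicator {0<..} r *\<^sub>R (e * G (of_real r * e) / (of_real z - of_real r * e)))"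
    using I1 I2 by (simp add: has_bochner_integral_iff)
  from has_bochner_integral_divide[OF has_bochner_integral_Im[OF this], of pi]
  have "has_bochner_integral lborel (\<lambda>t. Im (LINT r|lborel. f t r) / pi)
     (Im (LINT r|lborel. indicator {0<..} r *\<^sub>R (e * G (of_real r * e) / (of_real z - of_real r * e))) / pi)" by simp
  moreover have "Im (LINT r|lborel. f t r) / pi = exp (- (z * t)) * kernel t" for t
  proof -
    have "(LINT r|lborel. f t r) = (indicator {0<..} t * exp (- (z * t))) *\<^sub>R (LINT r|lborel. ?F t r)"
      unfolding f_def by (rule integral_scaleR_right)
    then show ?thesis by (simp add: kernel_def)
  qed
  ultimately show "has_bochner_integral lborel (\<lambda>t. exp (- (z * t)) * kernel t)
      (Im (LINT r|lborel. indicator {0<..} r *\<^sub>R (e * G (of_real r * e) / (of_real z - of_real r * e))) / pi)"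
    by simp
qed

end

text \<open>The derivative of \<open>P\<close> is taken only within \<open>S\<close>, because the
  rays in question run along the boundary of the sector.\<close>

lemma has_integral_along_ray:
  fixes P f :: "complex \<Rightarrow> complex"
  assumes P: "\<And>s. s \<in> S \<Longrightarrow> (P has_field_derivative f s) (at s within S)"
    and ray: "\<And>r. 0 \<le> r \<Longrightarrow> of_real r * w \<in> S" and R: "0 \<le> R"
  shows "((\<lambda>r. w * f (of_real r * w)) has_integral P (of_real R * w) - P 0) {0..R}"
proof -
  have "((\<lambda>r. P (of_real r * w)) has_vector_derivative w * f (of_real r * w)) (at r within {0..R})"
    if "r \<in> {0..R}" for r
  proof -
    have "((\<lambda>r. of_real r * w) has_vector_derivative w) (at r within {0..R})"
      by (auto intro!: derivative_eq_intros)
    moreover have "(P has_field_derivative f (of_real r * w)) (at (of_real r * w) within (\<lambda>r. of_real r * w) ` {0..R})"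
      by (rule DERIV_subset[OF P]) (use that ray in auto)
    ultimately show ?thesis
      using field_vector_diff_chain_within[of "\<lambda>r. of_real r * w" w r "{0..R}" P] by (simp add: o_def)
  qed
  then have "((\<lambda>r. w * f (of_real r * w)) has_integral P (of_real R * w) - P (of_real 0 * w)) {0..R}"
    by (intro fundamental_theorem_of_calculus R) auto
  then show ?thesis by simp
qed

section \<open>Cauchy's theorem in the closed sector\<close>

context sectorial
begin

lemma minus_one_notin_sector: "- 1 \<notin> sector \<phi>"
  using sector_polar(2)[of "-1" \<phi>] phi pi_gt_zero Arg_of_real[of "-1"] by force

lemma real_eq_ray: "0 \<le> r \<Longrightarrow> of_real r * e = of_real z \<Longrightarrow> r = 0"
  using sin_pos by (auto simp: complex_eq_iff)

text \<open>The pole of \<open>1 / (z - s)\<close> lies on the boundary of the sector. Subtracting the comparison function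
  \<open>G z * (z + 1) / (s + 1)\<close> removes it, and the integral of the comparison function over the ray is elementary.\<close>

definition regular_part :: "real \<Rightarrow> complex \<Rightarrow> complex" where
  "regular_part z s = G s - G (of_real z) * (of_real z + 1) / (s + 1)"

text \<open>For \<open>z > 0\<close> the numerator vanishes at \<open>z\<close>, so the singularity
  is removable; the minus sign of the filled-in value comes from the denominator
  \<open>z - s\<close>.\<close>

definition quotient :: "real \<Rightarrow> complex \<Rightarrow> complex" where
  "quotient z s = (if s = of_real z then - deriv (regular_part z) (of_real z) else regular_part z s / (of_real z - s))"

lemma regular_part_differentiable:
  assumes "s \<in> sector \<phi>" "s \<noteq> 0"
  shows "regular_part z field_differentiable (at s)"
proof -
  have "s + 1 \<noteq> 0" using assms minus_one_notin_sector by (metis add_eq_0_iff add.commute)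
  then show ?thesis
    unfolding regular_part_def using diff[OF assms]
    by (intro derivative_intros) auto
qed

lemma regular_part_z: "0 < z \<Longrightarrow> regular_part z (of_real z) = 0"
proof -
  assume "0 < z"
  then have "complex_of_real z + 1 \<noteq> 0"
    by (metis add_pos_pos of_real_1 of_real_add of_real_eq_0_iff order_less_irrefl zero_less_one)
  then show ?thesis by (simp add: regular_part_def)
qed

lemma quotient_differentiable:
  assumes "s \<in> sector \<phi>" "s \<noteq> 0" "s \<noteq> of_real z"
  shows "quotient z field_differentiable (at s)"
proof (rule field_differentiable_transform_within[where S=UNIV and d="dist (of_real z) s"])
  show "(\<lambda>s. regular_part z s / (of_real z - s)) field_differentiable (at s)"
    using assms by (intro derivative_intros regular_part_differentiable) auto
qed (use assms in \<open>auto simp: quotient_def dist_commute\<close>)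

lemma continuous_on_quotient:
  assumes z: "0 < z"
  shows "continuous_on (sector \<phi>) (quotient z)"
  unfolding continuous_on_eq_continuous_within
proof
  fix s assume s: "s \<in> sector \<phi>"
  have "s + 1 \<noteq> 0" if "s \<in> sector \<phi>" for s using that minus_one_notin_sector by (metis add_eq_0_iff add.commute)
  then have N: "continuous_on (sector \<phi>) (regular_part z)"
    unfolding regular_part_def by (intro continuous_intros continuous_on_sector) auto
  show "continuous (at s within sector \<phi>) (quotient z)"
  proof (cases "s = of_real z")
    case False
    then have "((\<lambda>s. regular_part z s / (of_real z - s)) \<longlongrightarrow> regular_part z s / (of_real z - s)) (at s within sector \<phi>)"
      using N s by (intro tendsto_intros) (auto simp: continuous_on_def)
    moreover have "\<forall>\<^sub>F x in at s within sector \<phi>. regular_part z x / (of_real z - x) = quotient z x"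
      using eventually_neq_at_within[of "of_real z"] by eventually_elim (simp add: quotient_def)
    ultimately have "(quotient z \<longlongrightarrow> regular_part z s / (of_real z - s)) (at s within sector \<phi>)"
      by (rule Lim_transform_eventually)
    then show ?thesis using False by (simp add: continuous_within quotient_def)
  next
    case True
    have "(regular_part z has_field_derivative deriv (regular_part z) (of_real z)) (at (of_real z))"
      using regular_part_differentiable[of "of_real z" z] of_real_in_sector[of z] z
      by (simp add: DERIV_deriv_iff_field_differentiable)
    then have "((\<lambda>x. - ((regular_part z x - regular_part z (of_real z)) / (x - of_real z))) \<longlongrightarrow> - deriv (regular_part z) (of_real z)) (at (of_real z))"
      unfolding has_field_derivative_iff by (rule tendsto_minus)
    moreover have "\<forall>\<^sub>F x in at (of_real z). - ((regular_part z x - regular_part z (of_real z)) / (x - of_real z)) = quotient z x"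
      by (auto simp: eventually_at_filter quotient_def regular_part_z[OF z] divide_simps intro!: always_eventually)
         (simp add: algebra_simps)
    ultimately have "(quotient z \<longlongrightarrow> - deriv (regular_part z) (of_real z)) (at (of_real z))"
      by (rule Lim_transform_eventually)
    then have "(quotient z \<longlongrightarrow> - deriv (regular_part z) (of_real z)) (at (of_real z) within sector \<phi>)"
      by (rule tendsto_within_subset) simp
    then show ?thesis using True by (simp add: continuous_within quotient_def)
  qed
qed

text \<open>Beyond \<open>2 * (z + 1)\<close> both \<open>s + 1\<close> and \<open>z - s\<close>
  have modulus at least \<open>cmod s / 2\<close>. The resulting power \<open>- a - 1\<close> beats
  the length of a chord across the sector, which grows only linearly.\<close>

lemma quotient_bound:
  assumes z: "0 < z" and s: "s \<in> sector \<phi>" "2 * (z + 1) \<le> cmod s"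
  shows "norm (quotient z s) \<le> 2 * (C + 2 * norm (G (of_real z)) * (z + 1)) * cmod s powr (- a - 1)"
proof -
  have s0: "s \<noteq> 0" "1 < cmod s" "s \<noteq> of_real z" using s z by auto
  have 1: "cmod s / 2 \<le> cmod (s + 1)" using s z norm_diff_ineq[of s 1] by simp
  have 2: "cmod s / 2 \<le> cmod (of_real z - s)" using s z norm_triangle_ineq2[of s "of_real z"] by (simp add: norm_minus_commute)
  have "cmod s powr (- 1) \<le> cmod s powr (- a)" using a s0 by (intro powr_mono) auto
  then have inv: "1 / cmod s \<le> cmod s powr (- a)" using s0 by (simp add: powr_minus_divide)
  have "norm (G (of_real z) * (of_real z + 1) / (s + 1)) = norm (G (of_real z)) * (z + 1) / cmod (s + 1)"
    using z by (simp add: norm_mult norm_divide)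
  also have "\<dots> \<le> norm (G (of_real z)) * (z + 1) / (cmod s / 2)"
    using 1 s0 z by (intro divide_left_mono mult_nonneg_nonneg mult_pos_pos) auto
  also have "\<dots> = 2 * norm (G (of_real z)) * (z + 1) * (1 / cmod s)" by simp
  also have "\<dots> \<le> 2 * norm (G (of_real z)) * (z + 1) * cmod s powr (- a)"
    using inv z by (intro mult_left_mono) auto
  finally have "norm (regular_part z s) \<le> (C + 2 * norm (G (of_real z)) * (z + 1)) * cmod s powr (- a)"
    unfolding regular_part_def using bd_inf[OF s(1) s0(1)]
    by (intro order_trans[OF norm_triangle_ineq4]) (simp add: distrib_right)
  then have "norm (regular_part z s) / cmod (of_real z - s) \<le> (C + 2 * norm (G (of_real z)) * (z + 1)) * cmod s powr (- a) / (cmod s / 2)"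
    using 2 s0 C_nonneg z by (intro frac_le) auto
  also have "\<dots> = 2 * (C + 2 * norm (G (of_real z)) * (z + 1)) * cmod s powr (- a - 1)"
    using s0 by (simp add: powr_diff)
  finally show ?thesis using s0 by (simp add: quotient_def norm_divide)
qed

text \<open>All points of the chord have the same component \<open>R * cos (\<phi> / 2)\<close>
  along the bisector of the sector.\<close>

lemma chord_norm:
  assumes "0 \<le> R" "s \<in> closed_segment (of_real R) (of_real R * e)"
  shows "R * cos (\<phi> / 2) \<le> cmod s"
proof -
  obtain u where s: "s = (1 - u) *\<^sub>R of_real R + u *\<^sub>R (of_real R * e)" "0 \<le> u" "u \<le> 1"
    using assms(2) by (auto simp: closed_segment_def)
  have half: "Re (cis \<phi> * cis (- (\<phi> / 2))) = cos (\<phi> / 2)" by (simp only: cis_mult) (simp add: field_simps)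
  have "Re (s * cis (- (\<phi> / 2))) = (1 - u) * R * cos (\<phi> / 2) + u * R * Re (cis \<phi> * cis (- (\<phi> / 2)))"
    unfolding s(1) by (simp add: algebra_simps)
  also have "\<dots> = (1 - u) * R * cos (\<phi> / 2) + u * R * cos (\<phi> / 2)" unfolding half ..
  also have "\<dots> = R * cos (\<phi> / 2)" by (simp add: algebra_simps)
  finally show ?thesis using complex_Re_le_cmod[of "s * cis (- (\<phi> / 2))"] by (simp add: norm_mult)
qed

text \<open>Partial fractions give \<open>1 / (s + 1) + 1 / (z - s)\<close>, with principal
  logarithms as primitives. On the ray both arguments avoid the cut: they are 1 and \<open>z\<close>
  at the vertex and nonreal afterwards.\<close>

lemma comparison_integral:
  assumes z: "0 < z" and R: "0 \<le> R"
  shows "((\<lambda>r. e * ((of_real z + 1) / ((of_real r * e + 1) * (of_real z - of_real r * e)))) has_integral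
     (Ln (of_real R * e + 1) - Ln (of_real z - of_real R * e)) - (Ln 1 - Ln (of_real z))) {0..R}"
proof -
  have "((\<lambda>r. Ln (of_real r * e + 1) - Ln (of_real z - of_real r * e)) has_vector_derivative
     e * ((of_real z + 1) / ((of_real r * e + 1) * (of_real z - of_real r * e)))) (at r within {0..R})"
    if r: "r \<in> {0..R}" for r
  proof -
    have nz: "of_real r * e + 1 \<notin> \<real>\<^sub>\<le>\<^sub>0" "of_real z - of_real r * e \<notin> \<real>\<^sub>\<le>\<^sub>0"
      using r sin_pos z by (cases "r = 0"; auto simp: complex_nonpos_Reals_iff)+
    then have nz0: "of_real r * e + 1 \<noteq> 0" "of_real z - of_real r * e \<noteq> 0" by auto
    have "((\<lambda>s. Ln (s * e + 1) - Ln (of_real z - s * e)) has_field_derivative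
       e / (of_real r * e + 1) + e / (of_real z - of_real r * e)) (at (of_real r))"
      using nz nz0 by (auto intro!: derivative_eq_intros simp: divide_inverse)
    moreover have "e / (of_real r * e + 1) + e / (of_real z - of_real r * e)
       = e * ((of_real z + 1) / ((of_real r * e + 1) * (of_real z - of_real r * e)))"
      using nz0 by (simp add: add_frac_eq algebra_simps)
    ultimately have "((\<lambda>s. Ln (s * e + 1) - Ln (of_real z - s * e)) has_field_derivative
       e * ((of_real z + 1) / ((of_real r * e + 1) * (of_real z - of_real r * e)))) (at (of_real r))" by simp
    from has_vector_derivative_real_field[OF this]
    show ?thesis by (rule has_vector_derivative_at_within)
  qed
  then have "((\<lambda>r. e * ((of_real z + 1) / ((of_real r * e + 1) * (of_real z - of_real r * e)))) has_integral
     (Ln (of_real R * e + 1) - Ln (of_real z - of_real R * e)) - (Ln (of_real 0 * e + 1) - Ln (of_real z - of_real 0 * e))) {0..R}"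
    by (intro fundamental_theorem_of_calculus R) auto
  then show ?thesis by simp
qed

text \<open>Dividing by \<open>R\<close> leaves arguments that tend to \<open>Arg e = \<phi>\<close>
  and \<open>Arg (- e) = \<phi> - pi\<close>. Their difference \<open>pi\<close> plays the part of
  the residue at \<open>z\<close>.\<close>

lemma comparison_limit:
  "((\<lambda>R. Im (Ln (of_real R * e + 1) - Ln (of_real z - of_real R * e))) \<longlongrightarrow> pi) at_top"
proof -
  have zero: "((\<lambda>R. complex_of_real (k / R)) \<longlongrightarrow> of_real 0) at_top" for k
    by (intro tendsto_of_real tendsto_divide_0[OF tendsto_const] filterlim_at_top_imp_at_infinity filterlim_ident)
  have nz: "e \<notin> \<real>\<^sub>\<le>\<^sub>0" "- e \<notin> \<real>\<^sub>\<le>\<^sub>0" using sin_pos by (auto simp: complex_nonpos_Reals_iff)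
  have 1: "((\<lambda>R. Arg (e + of_real (1 / R))) \<longlongrightarrow> Arg e) at_top"
    by (rule isCont_tendsto_compose[OF continuous_at_Arg[OF nz(1)]]) (use tendsto_add[OF tendsto_const zero[of 1]] in simp)
  have 2: "((\<lambda>R. Arg (of_real (z / R) - e)) \<longlongrightarrow> Arg (- e)) at_top"
    by (rule isCont_tendsto_compose[OF continuous_at_Arg[OF nz(2)]]) (use tendsto_diff[OF zero[of z] tendsto_const[of e]] in simp)
  have minus: "- e = cis (\<phi> - pi)" by (simp add: complex_eq_iff cos_diff sin_diff)
  have "Arg (- e) = \<phi> - pi" unfolding minus using phi pi_gt_zero by (intro Arg_cis) auto
  moreover have "Arg e = \<phi>" using phi pi_gt_zero by (intro Arg_cis) auto
  ultimately have "((\<lambda>R. Arg (e + of_real (1 / R)) - Arg (of_real (z / R) - e)) \<longlongrightarrow> \<phi> - (\<phi> - pi)) at_top"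
    using tendsto_diff[OF 1 2] by simp
  then have lim: "((\<lambda>R. Arg (e + of_real (1 / R)) - Arg (of_real (z / R) - e)) \<longlongrightarrow> pi) at_top" by simp
  have "\<forall>\<^sub>F R in at_top. Arg (e + of_real (1 / R)) - Arg (of_real (z / R) - e)
     = Im (Ln (of_real R * e + 1) - Ln (of_real z - of_real R * e))"
    using eventually_gt_at_top[of "max 0 z"]
  proof eventually_elim
    case (elim R)
    have "Im (R * e) \<noteq> 0" using sin_pos elim by simp
    then have nz0: "of_real R * e + 1 \<noteq> 0" "of_real z - of_real R * e \<noteq> 0"
      by (auto simp: complex_eq_iff)
    have "of_real R * e + 1 = of_real R * (e + of_real (1 / R))" "of_real z - of_real R * e = of_real R * (of_real (z / R) - e)"
      using elim by (simp_all add: algebra_simps)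
    then show ?case
      using nz0 elim Arg_times_of_real[of R "e + of_real (1 / R)"] Arg_times_of_real[of R "of_real (z / R) - e"]
      by (simp add: Arg_def)
  qed
  from Lim_transform_eventually[OF lim this] show ?thesis .
qed

text \<open>The contour is the triangle with vertices 0, \<open>R\<close> and \<open>R * e\<close>.
  On its real side \<open>quotient z\<close> is real and the far side vanishes in the limit, so the
  imaginary part on the ray comes from the comparison function alone.\<close>

lemma cauchy_ray:
  assumes z: "0 < z"
  shows "Im (LINT r|lborel. indicator {0<..} r *\<^sub>R (e * G (of_real r * e) / (of_real z - of_real r * e))) = pi * Re (G (of_real z))"
proof -
  define g where "g = Re (G (of_real z))"
  have g: "G (of_real z) = of_real g" using G_real[OF z] by (simp add: g_def complex_eq_iff)
  \<comment> \<open>At 0 and \<open>z\<close> only continuity is known; for a primitive on a convex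
    set finitely many such points are harmless.\<close>
  obtain P where P: "\<And>s. s \<in> sector \<phi> \<Longrightarrow> (P has_field_derivative quotient z s) (at s within sector \<phi>)"
    using holomorphic_convex_primitive[OF convex_sector, of "{0, of_real z}" \<phi> "quotient z"]
      continuous_on_quotient[OF z] quotient_differentiable interior_subset[of "sector \<phi>"]
    by (metis (no_types, lifting) Diff_iff finite.intros insertI1 insertI2 subsetD)
  have real_int: "Im (P (of_real R)) = Im (P 0)" if R: "0 \<le> R" for R
  proof -
    have "((\<lambda>r. quotient z (of_real r)) has_integral P (of_real R) - P 0) {0..R}"
      using has_integral_along_ray[OF P, of 1 R] of_real_in_sector R by simp
    from has_integral_linear[OF this bounded_linear_Im]
    have "((\<lambda>r. Im (quotient z (of_real r))) has_integral Im (P (of_real R) - P 0)) {0..R}" by (simp add: o_def)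
    moreover have "((\<lambda>r. Im (quotient z (of_real r))) has_integral 0) {0..R}"
    \<comment> \<open>The value at \<open>z\<close> is a derivative that has not been shown to be
      real; a single point does not affect the integral.\<close>
    proof (rule has_integral_spike_finite[of "{z}"])
      fix r assume r: "r \<in> {0..R} - {z}"
      have "Im (G (of_real r)) = 0" using G_real[of r] r G0 by (cases "r = 0") auto
      then obtain h where "G (of_real r) = of_real h" by (metis complex_is_Real_iff Reals_cases)
      then have "quotient z (of_real r) = of_real ((h - g * (z + 1) / (r + 1)) / (z - r))"
        using r unfolding quotient_def regular_part_def g by simp
      then show "Im (quotient z (of_real r)) = 0" by simp
    qed (auto simp: has_integral_0)
    ultimately have "Im (P (of_real R) - P 0) = 0" by (rule has_integral_unique)
    then show ?thesis by simp
  qed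
  define K where "K = 2 * (C + 2 * norm (G (of_real z)) * (z + 1))"
  have K0: "0 \<le> K" using C_nonneg z by (simp add: K_def)
  define d where "d = cos (\<phi> / 2)"
  have d: "0 < d" unfolding d_def using phi by (intro cos_gt_zero) auto
  have chord: "norm (P (of_real R * e) - P (of_real R)) \<le> 2 * K * d powr (- a - 1) * R powr (- a)"
    if R: "2 * (z + 1) / d \<le> R" for R
  proof -
    have R0: "0 < R" using R z d by (smt (verit) divide_pos_pos)
    have Rd: "2 * (z + 1) \<le> R * d" using R d by (simp add: divide_le_eq)
    let ?S = "closed_segment (complex_of_real R) (of_real R * e)"
    have sub: "?S \<subseteq> sector \<phi>"
      using R0 by (intro closed_segment_subset convex_sector of_real_in_sector ray_in_sector) auto
    have "norm (P (of_real R * e) - P (of_real R)) \<le> (K * (R * d) powr (- a - 1)) * norm (of_real R * e - of_real R)"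
    proof (rule field_differentiable_bound[of ?S P "quotient z"])
      fix s assume s: "s \<in> ?S"
      show "(P has_field_derivative quotient z s) (at s within ?S)"
        using DERIV_subset[OF P sub] s sub by blast
      have "R * d \<le> cmod s" using chord_norm[OF _ s] R0 by (simp add: d_def)
      then have "K * cmod s powr (- a - 1) \<le> K * (R * d) powr (- a - 1)"
        using K0 R0 d a by (intro mult_left_mono powr_mono2') auto
      then show "norm (quotient z s) \<le> K * (R * d) powr (- a - 1)"
        using quotient_bound[OF z, of s] s sub Rd \<open>R * d \<le> cmod s\<close> unfolding K_def by force
    qed auto
    also have "\<dots> \<le> (K * (R * d) powr (- a - 1)) * (2 * R)"
      using K0 R0 norm_triangle_ineq4[of "of_real R * e" "of_real R"] by (intro mult_left_mono) (auto simp: norm_mult)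
    also have "\<dots> = 2 * K * d powr (- a - 1) * R powr (- a)"
      using R0 d by (simp add: powr_mult powr_diff[of R])
    finally show ?thesis .
  qed
  have chord0: "((\<lambda>R. Im (P (of_real R * e) - P (of_real R))) \<longlongrightarrow> 0) at_top"
  proof (rule Lim_null_comparison)
    show "\<forall>\<^sub>F R in at_top. norm (Im (P (of_real R * e) - P (of_real R))) \<le> 2 * K * d powr (- a - 1) * R powr (- a)"
      using eventually_ge_at_top[of "2 * (z + 1) / d"]
      by eventually_elim (metis abs_Im_le_cmod chord order_trans real_norm_def)
    show "((\<lambda>R. 2 * K * d powr (- a - 1) * R powr (- a)) \<longlongrightarrow> 0) at_top"
      using tendsto_mult_right_zero[OF tendsto_neg_powr[OF _ filterlim_ident, of "- a"]] a by simp
  qed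
  let ?F = "\<lambda>r. e * G (of_real r * e) / (of_real z - of_real r * e)"
  have contF: "continuous_on {0..R} ?F" for R
    using real_eq_ray[of _ z] z by (intro continuous_intros continuous_on_subset[OF continuous_on_ray]) force+
  have ray_value: "Im (integral {0..R} ?F) = Im (P (of_real R * e) - P (of_real R))
      + g * Im (Ln (of_real R * e + 1) - Ln (of_real z - of_real R * e))" if R: "0 \<le> R" for R
  proof -
    have "((\<lambda>r. e * quotient z (of_real r * e)) has_integral P (of_real R * e) - P 0) {0..R}"
      using has_integral_along_ray[OF P ray_in_sector R] by simp
    from has_integral_add[OF this has_integral_mult_right[OF comparison_integral[OF z R], of "of_real g"]]
    have "((\<lambda>r. e * quotient z (of_real r * e)
        + of_real g * (e * ((of_real z + 1) / ((of_real r * e + 1) * (of_real z - of_real r * e)))))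
       has_integral P (of_real R * e) - P 0 +
        of_real g * ((Ln (of_real R * e + 1) - Ln (of_real z - of_real R * e)) - (Ln 1 - Ln (of_real z)))) {0..R}" .
    moreover have "e * quotient z (of_real r * e)
        + of_real g * (e * ((of_real z + 1) / ((of_real r * e + 1) * (of_real z - of_real r * e)))) = ?F r"
      if "r \<in> {0..R}" for r
    proof -
      have ne: "of_real z - of_real r * e \<noteq> 0" using real_eq_ray[of r z] that z by auto
      show ?thesis using ne unfolding quotient_def regular_part_def g
        by (auto simp: diff_divide_distrib right_diff_distrib)
    qed
    ultimately have "(?F has_integral P (of_real R * e) - P 0 +
        of_real g * ((Ln (of_real R * e + 1) - Ln (of_real z - of_real R * e)) - (Ln 1 - Ln (of_real z)))) {0..R}"
      by (rule has_integral_eq[rotated])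
    then have "integral {0..R} ?F = P (of_real R * e) - P 0 +
        of_real g * ((Ln (of_real R * e + 1) - Ln (of_real z - of_real R * e)) - (Ln 1 - Ln (of_real z)))"
      by (rule integral_unique)
    then show ?thesis using real_int[OF R] z by (simp add: Ln_of_real)
  qed
  have "((\<lambda>R. Im (P (of_real R * e) - P (of_real R)) + g * Im (Ln (of_real R * e + 1) - Ln (of_real z - of_real R * e)))
      \<longlongrightarrow> 0 + g * pi) at_top"
    by (intro tendsto_add chord0 tendsto_mult tendsto_const comparison_limit)
  moreover have "\<forall>\<^sub>F R in at_top. Im (P (of_real R * e) - P (of_real R)) + g * Im (Ln (of_real R * e + 1) - Ln (of_real z - of_real R * e))
     = Im (LINT r|lborel. indicator {..R} r *\<^sub>R (indicator {0<..} r *\<^sub>R ?F r))"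
    using eventually_ge_at_top[of "0::real"]
    by eventually_elim (simp only: lint_truncated[OF contF] ray_value)
  ultimately have "((\<lambda>R. Im (LINT r|lborel. indicator {..R} r *\<^sub>R (indicator {0<..} r *\<^sub>R ?F r))) \<longlongrightarrow> 0 + g * pi) at_top"
    by (rule Lim_transform_eventually)
  moreover have "((\<lambda>R. Im (LINT r|lborel. indicator {..R} r *\<^sub>R (indicator {0<..} r *\<^sub>R ?F r)))
      \<longlongrightarrow> Im (LINT r|lborel. indicator {0<..} r *\<^sub>R ?F r)) at_top"
    by (intro tendsto_Im tendsto_integral_at_top kernel_fubini(2) z) simp
  ultimately have "0 + g * pi = Im (LINT r|lborel. indicator {0<..} r *\<^sub>R ?F r)"
    by (rule tendsto_unique[OF trivial_limit_at_top_linorder])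
  then show ?thesis by (simp add: g_def mult.commute)
qed

lemma kernel_laplace: "has_laplace kernel (\<lambda>z. Re (G (of_real z)))"
  unfolding has_laplace_def
  using kernel_fubini(1) cauchy_ray by (auto simp: kernel_def)

end

section \<open>Zeros of the characteristic function\<close>

text \<open>\<open>sin u / u\<close> decreases up to \<open>pi\<close>, here in a form without
  division. It compares the limits at angle 0 of the ratios in \<open>sin_ratio_mono\<close> with
  their values at \<open>pi / 2\<close>.\<close>

lemma sin_mult_le:
  fixes a b x :: real
  assumes "0 < a" "a < b" "0 \<le> x" "b * x \<le> pi"
  shows "a * sin (b * x) \<le> b * sin (a * x)"
proof -
  let ?f = "\<lambda>x. b * sin (a * x) - a * sin (b * x)"
  have "?f 0 \<le> ?f x"
  proof (rule DERIV_nonneg_imp_nondecreasing[OF assms(3)])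
    fix y assume y: "0 \<le> y" "y \<le> x"
    have "b * y \<le> b * x" "a * y \<le> b * y" using y assms by (auto intro!: mult_left_mono mult_right_mono)
    then have "b * y \<le> pi" using assms by linarith
    then have "cos (b * y) \<le> cos (a * y)"
      using y assms \<open>a * y \<le> b * y\<close> by (intro cos_monotone_0_pi_le) auto
    then have "0 \<le> (a * b) * (cos (a * y) - cos (b * y))" using assms by (intro mult_nonneg_nonneg) auto
    moreover have "(?f has_real_derivative (a * b) * (cos (a * y) - cos (b * y))) (at y)"
      by (auto intro!: derivative_eq_intros simp: algebra_simps)
    ultimately show "\<exists>z. (?f has_real_derivative z) (at y) \<and> 0 \<le> z" by blast
  qed
  then show ?thesis by simp
qed

text \<open>The numerator of the derivative vanishes at 0, and its own derivative is
  \<open>(b\<^sup>2 - a\<^sup>2) * sin (a * u) * sin (b * u)\<close>, which is nonnegative on the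
  range.\<close>

lemma sin_ratio_mono:
  fixes a b x y :: real
  assumes ab: "0 < a" "a < b" and xy: "0 < x" "x \<le> y" "b * y < pi"
  shows "sin (a * x) / sin (b * x) \<le> sin (a * y) / sin (b * y)"
proof (rule DERIV_nonneg_imp_nondecreasing[OF xy(2)])
  have range: "0 < a * u" "a * u < pi" "0 < b * u" "b * u < pi" if "0 < u" "u \<le> y" for u
  proof -
    have "b * u \<le> b * y" "a * u < b * u" using that ab by auto
    then show "a * u < pi" "b * u < pi" using xy by linarith+
    show "0 < a * u" "0 < b * u" using that ab by auto
  qed
  fix t assume t: "x \<le> t" "t \<le> y"
  then have t0: "0 < t" using xy by simp
  let ?N = "\<lambda>u. a * cos (a * u) * sin (b * u) - b * sin (a * u) * cos (b * u)"
  have "?N 0 \<le> ?N t"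
  proof (rule DERIV_nonneg_imp_nondecreasing[where f="?N" and a=0 and b=t])
    fix u assume u: "0 \<le> u" "u \<le> t"
    have D: "(?N has_real_derivative (b - a) * (b + a) * (sin (a * u) * sin (b * u))) (at u)"
      by (auto intro!: derivative_eq_intros simp: algebra_simps)
    have "0 \<le> sin (a * u) \<and> 0 \<le> sin (b * u)"
      using range[of u] u t by (cases "u = 0") (auto intro: sin_ge_zero)
    then have "0 \<le> (b - a) * (b + a) * (sin (a * u) * sin (b * u))" using ab by (intro mult_nonneg_nonneg) auto
    then show "\<exists>z. (?N has_real_derivative z) (at u) \<and> 0 \<le> z" using D by blast
  qed (use t0 in simp)
  then have N: "0 \<le> ?N t" by simp
  have s: "sin (b * t) \<noteq> 0" using range[OF t0 t(2)] sin_gt_zero[of "b * t"] by simp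
  have "((\<lambda>u. sin (a * u) / sin (b * u)) has_real_derivative ?N t / (sin (b * t))\<^sup>2) (at t)"
    using s by (auto intro!: derivative_eq_intros simp: power2_eq_square algebra_simps)
  then show "\<exists>z. ((\<lambda>u. sin (a * u) / sin (b * u)) has_real_derivative z) (at t) \<and> 0 \<le> z"
    using N by (intro exI[of _ "?N t / (sin (b * t))\<^sup>2"]) simp
qed

text \<open>The off-diagonal entries of the matrix enter the characteristic equation only through
  the determinant \<open>d\<close>.\<close>

locale spectral =
  fixes \<alpha>1 \<alpha>2 q1 q2 a11 a22 d :: real
  assumes alpha: "0 < \<alpha>1" "\<alpha>1 < \<alpha>2" "\<alpha>2 \<le> 1"
    and q1: "q1 = sin (\<alpha>1 * pi / 2) / sin ((\<alpha>1 + \<alpha>2) * pi / 2)"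
    and q2: "q2 = sin (\<alpha>2 * pi / 2) / sin ((\<alpha>1 + \<alpha>2) * pi / 2)"
    and cond: "(a11 \<le> 0 \<and> a22 \<le> 0 \<and> d > 0)
       \<or> (a11 = 0 \<and> a22 > 0 \<and> d > 0 \<and> (a22 * q1) powr (\<alpha>1 / \<alpha>2) * a22 * q2 < d)
       \<or> (a22 = 0 \<and> a11 > 0 \<and> d > 0 \<and> (a11 * q2) powr (\<alpha>2 / \<alpha>1) * a11 * q1 < d)
       \<or> (a11 > 0 \<and> a22 > 0 \<and> d > 0 \<and>
          ((a11 * q2 + a22 * q1 > 1 \<and>
            a11 * q2 * ((a11 + a22) * q2) powr (\<alpha>2 / \<alpha>1) + a22 * (a11 + a22) * q2\<^sup>2 \<le> d)
           \<or> (a11 * q2 + a22 * q1 \<le> 1 \<and> a11 * q1 + a22 * q2 < d)))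
       \<or> (a11 < 0 \<and> a22 > 0 \<and> d > 0 \<and>
          ((a11 * q2 + a22 * q1 > 1 \<and> (a22 * q1) powr (\<alpha>1 / \<alpha>2) * a22 * q2 \<le> d)
           \<or> (a11 * q2 + a22 * q1 \<le> 1 \<and> a22 * q2 \<le> d)))"
begin

lemma d_pos: "0 < d" using cond by blast

lemma angles: "0 < \<alpha>1 * pi / 2" "\<alpha>1 * pi / 2 < \<alpha>2 * pi / 2" "\<alpha>2 * pi / 2 \<le> pi / 2"
    "0 < (\<alpha>1 + \<alpha>2) * pi / 2" "(\<alpha>1 + \<alpha>2) * pi / 2 < pi"
proof -
  have "(\<alpha>1 + \<alpha>2) * pi < 2 * pi" using alpha by (intro mult_strict_right_mono) auto
  then show "(\<alpha>1 + \<alpha>2) * pi / 2 < pi" by linarith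
  have "\<alpha>2 * pi \<le> 1 * pi" using alpha by (intro mult_right_mono) auto
  then show "\<alpha>2 * pi / 2 \<le> pi / 2" by linarith
  show "0 < \<alpha>1 * pi / 2" "\<alpha>1 * pi / 2 < \<alpha>2 * pi / 2" "0 < (\<alpha>1 + \<alpha>2) * pi / 2" using alpha by simp_all
qed

lemma S_pos: "0 < sin ((\<alpha>1 + \<alpha>2) * pi / 2)"
  using angles by (intro sin_gt_zero) auto

lemma q_pos: "0 < q1" "q1 < q2"
proof -
  have "0 < sin (\<alpha>1 * pi / 2)" using angles by (intro sin_gt_zero) auto
  then show "0 < q1" using S_pos by (simp add: q1)
  have "sin (\<alpha>1 * pi / 2) < sin (\<alpha>2 * pi / 2)" using angles pi_gt_zero by (intro sin_monotone_2pi; linarith)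
  then show "q1 < q2" using S_pos unfolding q1 q2 by (intro divide_strict_right_mono)
qed

lemma no_common_solution:
  assumes p: "0 < p1" "p1 \<le> q1" "0 < p2" "p2 \<le> q2" "q2 * p1 \<le> p2 * q1" and r: "0 < r"
    and eq: "r powr (\<alpha>1 + \<alpha>2) = a11 * p2 * r powr \<alpha>2 + a22 * p1 * r powr \<alpha>1"
    and le: "d \<le> a11 * p1 * r powr \<alpha>2 + a22 * p2 * r powr \<alpha>1"
  shows False
proof -
  define X Y where "X = r powr \<alpha>1" and "Y = r powr \<alpha>2"
  have XY: "0 < X" "0 < Y" using r by (auto simp: X_def Y_def)
  have YX: "Y = X powr (\<alpha>2 / \<alpha>1)" "X = Y powr (\<alpha>1 / \<alpha>2)"
    using alpha r by (auto simp: X_def Y_def powr_powr)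
  have eq: "X * Y = a11 * p2 * Y + a22 * p1 * X" using eq by (simp add: X_def Y_def powr_add)
  have le: "d \<le> a11 * p1 * Y + a22 * p2 * X" using le by (simp add: X_def Y_def)
  have XY1: "X \<le> Y" if "1 \<le> X"
  proof -
    have "1 \<le> r"
    proof (rule ccontr)
      assume "\<not> 1 \<le> r"
      then have "r powr \<alpha>1 < 1 powr \<alpha>1" using alpha r by (intro powr_less_mono2) auto
      then show False using that by (simp add: X_def)
    qed
    then show ?thesis unfolding X_def Y_def using alpha by (intro powr_mono) auto
  qed
  have Y1: "Y \<le> 1" if "X \<le> 1" using that XY alpha unfolding YX(1) by (intro powr_le1) auto
  have Y1': "1 < Y" if "1 < X" using XY1 that by simp
  note q = q_pos
  consider (1) "a11 \<le> 0" "a22 \<le> 0"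
    | (2) "a11 = 0" "a22 > 0" "(a22 * q1) powr (\<alpha>1 / \<alpha>2) * a22 * q2 < d"
    | (3) "a22 = 0" "a11 > 0" "(a11 * q2) powr (\<alpha>2 / \<alpha>1) * a11 * q1 < d"
    | (4) "a11 > 0" "a22 > 0" "a11 * q2 + a22 * q1 > 1"
          "a11 * q2 * ((a11 + a22) * q2) powr (\<alpha>2 / \<alpha>1) + a22 * (a11 + a22) * q2\<^sup>2 \<le> d"
    | (5) "a11 > 0" "a22 > 0" "a11 * q2 + a22 * q1 \<le> 1" "a11 * q1 + a22 * q2 < d"
    | (6) "a11 < 0" "a22 > 0" "(a22 * q1) powr (\<alpha>1 / \<alpha>2) * a22 * q2 \<le> d"
    | (7) "a11 < 0" "a22 > 0" "a11 * q2 + a22 * q1 \<le> 1" "a22 * q2 \<le> d"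
    using cond by argo
  then show False
  proof cases
    case 1
    then have "a11 * (p2 * Y) \<le> 0" "a22 * (p1 * X) \<le> 0" using p XY by (simp_all add: mult_nonpos_nonneg)
    moreover have "0 < X * Y" using XY by simp
    ultimately show False using eq by (simp add: mult.assoc)
  next
    case 2
    then have "Y = a22 * p1" using eq XY by simp
    then have "Y \<le> a22 * q1" using 2 p by simp
    then have "X \<le> (a22 * q1) powr (\<alpha>1 / \<alpha>2)" unfolding YX(2) using XY alpha by (intro powr_mono2) auto
    then have "a22 * p2 * X \<le> a22 * q2 * (a22 * q1) powr (\<alpha>1 / \<alpha>2)" using 2 p q XY by (intro mult_mono) auto
    moreover have "a11 * p1 * Y = 0" using 2 by simp
    moreover have "a22 * q2 * (a22 * q1) powr (\<alpha>1 / \<alpha>2) = (a22 * q1) powr (\<alpha>1 / \<alpha>2) * a22 * q2" by simp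
    ultimately show False using le 2(3) by linarith
  next
    case 3
    then have "X = a11 * p2" using eq XY by simp
    then have "X \<le> a11 * q2" using 3 p by simp
    then have "Y \<le> (a11 * q2) powr (\<alpha>2 / \<alpha>1)" unfolding YX(1) using XY alpha by (intro powr_mono2) auto
    then have "a11 * p1 * Y \<le> a11 * q1 * (a11 * q2) powr (\<alpha>2 / \<alpha>1)" using 3 p q XY by (intro mult_mono) auto
    moreover have "a22 * p2 * X = 0" using 3 by simp
    moreover have "a11 * q1 * (a11 * q2) powr (\<alpha>2 / \<alpha>1) = (a11 * q2) powr (\<alpha>2 / \<alpha>1) * a11 * q1" by simp
    ultimately show False using le 3(3) by linarith
  next
    case 4
    define B where "B = (a11 + a22) * q2"
    have "a22 * q1 < a22 * q2" using 4 q by simp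
    then have B: "a11 * q2 + a22 * q1 < B" by (simp add: B_def algebra_simps)
    \<comment> \<open>If \<open>X \<le> 1\<close>, the case assumption gives \<open>1 < B\<close>.
      Otherwise \<open>X \<le> Y\<close>, and dividing the equation by \<open>Y\<close> gives
      \<open>X \<le> a11 * q2 + a22 * q1\<close>.\<close>
    have "X < B"
    proof (cases "X \<le> 1")
      case False
      then have "X \<le> Y" using XY1 by simp
      have "a11 * p2 * Y \<le> a11 * q2 * Y" using 4 p XY by simp
      moreover have "a22 * p1 * X \<le> a22 * q1 * Y" using 4 p XY \<open>X \<le> Y\<close> q by (intro mult_mono) auto
      ultimately have "X * Y \<le> (a11 * q2 + a22 * q1) * Y" using eq by (simp add: distrib_right)
      then show ?thesis using XY B by simp
    qed (use 4 B in linarith)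
    then have YB: "Y \<le> B powr (\<alpha>2 / \<alpha>1)" unfolding YX(1) using XY alpha by (intro powr_mono2) auto
    \<comment> \<open>The condition allows equality with \<open>d\<close>; strictness comes from
      \<open>p1 \<le> q1 < q2\<close>.\<close>
    have "a11 * p1 * Y < a11 * q2 * B powr (\<alpha>2 / \<alpha>1)"
      using 4 p q XY YB by (intro mult_less_le_imp_less mult_strict_left_mono) auto
    moreover have "a22 * p2 * X \<le> a22 * q2 * B" using 4 p q XY \<open>X < B\<close> by (intro mult_mono) auto
    moreover have "a22 * q2 * B = a22 * (a11 + a22) * q2\<^sup>2" by (simp add: B_def power2_eq_square)
    ultimately show False using le 4(4) unfolding B_def by linarith
  next
    case 5
    have "X \<le> 1"
    proof (rule ccontr)
      assume "\<not> X \<le> 1"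
      then have "1 < X" "X \<le> Y" using XY1 by auto
      have "a11 * p2 * Y \<le> a11 * q2 * Y" using 5 p XY by simp
      moreover have "a22 * p1 * X \<le> a22 * q1 * Y" using 5 p XY \<open>X \<le> Y\<close> q by (intro mult_mono) auto
      ultimately have "X * Y \<le> (a11 * q2 + a22 * q1) * Y" using eq by (simp add: distrib_right)
      then show False using XY 5 \<open>1 < X\<close> by simp
    qed
    then have "a11 * p1 * Y \<le> a11 * q1 * 1" "a22 * p2 * X \<le> a22 * q2 * 1"
      using 5 p q XY Y1 by (intro mult_mono; auto)+
    then show False using le 5(4) by linarith
  next
    case 6
    have "a11 * (p2 * Y) < 0" using 6 p XY by (simp add: mult_neg_pos)
    then have "X * Y < X * (a22 * p1)" using eq by (simp add: mult_ac)
    then have "Y < a22 * p1" using XY by simp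
    also have "\<dots> \<le> a22 * q1" using 6 p by simp
    finally have "X \<le> (a22 * q1) powr (\<alpha>1 / \<alpha>2)" unfolding YX(2) using XY alpha by (intro powr_mono2) auto
    then have "a22 * p2 * X \<le> a22 * q2 * (a22 * q1) powr (\<alpha>1 / \<alpha>2)" using 6 p q XY by (intro mult_mono) auto
    \<comment> \<open>Again equality with \<open>d\<close> is allowed; the negative term makes the
      estimate strict.\<close>
    moreover have "a11 * p1 * Y < 0" using 6 p XY by (simp add: mult_neg_pos)
    moreover have "a22 * q2 * (a22 * q1) powr (\<alpha>1 / \<alpha>2) = (a22 * q1) powr (\<alpha>1 / \<alpha>2) * a22 * q2" by simp
    ultimately show False using le 6(3) by linarith
  next
    case 7
    have neg: "a11 * p1 * Y < 0" using 7 p XY by (simp add: mult_neg_pos)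
    show False
    proof (cases "X \<le> 1")
      case True
      then have "a22 * p2 * X \<le> a22 * q2 * 1" using 7 p q XY by (intro mult_mono) auto
      then show False using le 7(4) neg by linarith
    next
      case False
      then have X: "1 < X" "X \<le> Y" "1 < Y" using XY1 Y1' by auto
      define b where "b = - a11"
      have b: "0 < b" using 7 by (simp add: b_def)
      \<comment> \<open>Multiplying this by \<open>q1\<close> and estimating termwise, with
        \<open>1 < Y\<close>, \<open>X \<le> Y\<close> and \<open>q2 * p1 \<le> p2 * q1\<close>,
        yields \<open>1 + b * q2 < a22 * q1\<close>, against
        \<open>a11 * q2 + a22 * q1 \<le> 1\<close>.\<close>
      have e1: "a22 * p1 * X = X * Y + b * p2 * Y" using eq by (simp add: b_def)
      have "p1 * X \<le> q1 * X" using p XY by simp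
      moreover have "q1 * X * 1 < q1 * X * Y" using q X XY by (intro mult_strict_left_mono mult_pos_pos) auto
      moreover have "b * (q2 * p1) * X \<le> b * (p2 * q1) * Y"
        by (rule mult_mono[OF mult_left_mono]) (use p q X XY b in auto)
      ultimately have "p1 * X + b * (q2 * p1) * X < q1 * X * Y + b * (p2 * q1) * Y" by linarith
      also have "\<dots> = q1 * (a22 * p1 * X)" unfolding e1 by (simp add: algebra_simps)
      finally have "p1 * X * (1 + b * q2) < p1 * X * (a22 * q1)" by (simp add: algebra_simps)
      then have "1 + b * q2 < a22 * q1" using p XY by (subst (asm) mult_less_cancel_left_pos) auto
      then show False using 7 by (simp add: b_def)
    qed
  qed
qed

text \<open>The characteristic function with modulus and angle as separate variables. This avoids
  the branch cut and gives a function continuous on \<open>{0..} \<times> UNIV\<close>, as the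
  compactness argument needs.\<close>

definition Qpolar :: "real \<Rightarrow> real \<Rightarrow> complex" where
  "Qpolar r \<theta> = rcis (r powr (\<alpha>1 + \<alpha>2)) ((\<alpha>1 + \<alpha>2) * \<theta>) - of_real a11 * rcis (r powr \<alpha>2) (\<alpha>2 * \<theta>)
     - of_real a22 * rcis (r powr \<alpha>1) (\<alpha>1 * \<theta>) + of_real d"

text \<open>Taking the imaginary part eliminates \<open>d\<close>; rotating by
  \<open>- ((\<alpha>1 + \<alpha>2) * \<theta>)\<close> first eliminates the leading power instead.
  Division by \<open>sin ((\<alpha>1 + \<alpha>2) * \<theta>)\<close> yields the two relations of
  \<open>no_common_solution\<close>, and monotonicity of the sine ratios bounds them by their values
  at \<open>pi / 2\<close>.\<close>

lemma Qpolar_pos_angle: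
  assumes r: "0 < r" and \<theta>: "0 < \<theta>" "\<theta> \<le> pi / 2"
  shows "Qpolar r \<theta> \<noteq> 0"
proof
  assume Q: "Qpolar r \<theta> = 0"
  let ?S = "sin ((\<alpha>1 + \<alpha>2) * \<theta>)"
  define p1 p2 where "p1 = sin (\<alpha>1 * \<theta>) / ?S" and "p2 = sin (\<alpha>2 * \<theta>) / ?S"
  have mono: "c * \<theta> \<le> c * (pi / 2)" if "0 < c" for c using \<theta> that by simp
  have ang: "0 < \<alpha>1 * \<theta>" "\<alpha>1 * \<theta> < pi" "0 < \<alpha>2 * \<theta>" "\<alpha>2 * \<theta> < pi" "0 < (\<alpha>1 + \<alpha>2) * \<theta>" "(\<alpha>1 + \<alpha>2) * \<theta> < pi"
  proof -
    have "\<alpha>1 * \<theta> \<le> \<alpha>1 * pi / 2" "\<alpha>2 * \<theta> \<le> \<alpha>2 * pi / 2" "(\<alpha>1 + \<alpha>2) * \<theta> \<le> (\<alpha>1 + \<alpha>2) * pi / 2"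
      using mono[of \<alpha>1] mono[of \<alpha>2] mono[of "\<alpha>1 + \<alpha>2"] alpha by simp_all
    then show "\<alpha>1 * \<theta> < pi" "\<alpha>2 * \<theta> < pi" "(\<alpha>1 + \<alpha>2) * \<theta> < pi"
      using angles pi_gt_zero by linarith+
  qed (use alpha \<theta> in auto)
  have pos: "0 < sin (\<alpha>1 * \<theta>)" "0 < sin (\<alpha>2 * \<theta>)" "0 < ?S" using ang by (auto intro: sin_gt_zero)
  have "r powr (\<alpha>1 + \<alpha>2) * ?S = a11 * (r powr \<alpha>2 * sin (\<alpha>2 * \<theta>)) + a22 * (r powr \<alpha>1 * sin (\<alpha>1 * \<theta>))"
    using arg_cong[OF Q, of Im] by (simp add: Qpolar_def)
  then have eq: "r powr (\<alpha>1 + \<alpha>2) = a11 * p2 * r powr \<alpha>2 + a22 * p1 * r powr \<alpha>1"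
    using pos by (simp add: p1_def p2_def field_simps)
  have "Im (Qpolar r \<theta> * cis (- ((\<alpha>1 + \<alpha>2) * \<theta>))) = 0" using Q by simp
  moreover have "Qpolar r \<theta> * cis (- ((\<alpha>1 + \<alpha>2) * \<theta>)) = of_real (r powr (\<alpha>1 + \<alpha>2))
     - of_real (a11 * r powr \<alpha>2) * cis (- (\<alpha>1 * \<theta>)) - of_real (a22 * r powr \<alpha>1) * cis (- (\<alpha>2 * \<theta>))
     + of_real d * cis (- ((\<alpha>1 + \<alpha>2) * \<theta>))"
    by (simp add: Qpolar_def rcis_def left_diff_distrib distrib_right mult.assoc cis_mult)
  ultimately have "d * ?S = a11 * r powr \<alpha>2 * sin (\<alpha>1 * \<theta>) + a22 * r powr \<alpha>1 * sin (\<alpha>2 * \<theta>)" by simp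
  then have le: "d \<le> a11 * p1 * r powr \<alpha>2 + a22 * p2 * r powr \<alpha>1"
    using pos by (simp add: p1_def p2_def field_simps)
  have half: "c * (pi / 2) = c * pi / 2" for c :: real by simp
  have "p1 \<le> q1" "p2 \<le> q2"
    unfolding p1_def p2_def q1 q2 half[symmetric] using alpha \<theta> angles by (intro sin_ratio_mono; simp)+
  moreover have "sin (\<alpha>1 * \<theta>) / sin (\<alpha>2 * \<theta>) \<le> sin (\<alpha>1 * pi / 2) / sin (\<alpha>2 * pi / 2)"
    using sin_ratio_mono[of \<alpha>1 \<alpha>2 \<theta> "pi / 2"] alpha \<theta> angles pi_gt_zero by simp
  then have "p1 / p2 \<le> q1 / q2" using S_pos pos by (simp add: p1_def p2_def q1 q2)
  moreover have "0 < p1" "0 < p2" using pos by (simp_all add: p1_def p2_def)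
  ultimately show False using no_common_solution[OF _ _ _ _ _ r eq le] q_pos
    by (simp add: frac_le_eq divide_le_eq le_divide_eq mult_ac)
qed

text \<open>On the positive axis only one real equation is available; the second one is supplied by passing to a
  maximiser of \<open>\<rho>\<close>, where the derivative vanishes.\<close>

lemma Qpolar_zero_angle:
  assumes r: "0 < r"
  shows "Qpolar r 0 \<noteq> 0"
proof
  assume Q: "Qpolar r 0 = 0"
  define \<rho> where "\<rho> x = a11 * x powr \<alpha>2 + a22 * x powr \<alpha>1 - x powr (\<alpha>1 + \<alpha>2)" for x :: real
  have \<rho>r: "\<rho> r = d" using arg_cong[OF Q, of Re] by (simp add: Qpolar_def \<rho>_def)
  define M where "M = \<bar>a11\<bar> + \<bar>a22\<bar> + 1"
  \<comment> \<open>At \<open>R\<close> the leading power dominates, so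
    \<open>\<rho> R \<le> 0\<close>. As also \<open>\<rho> 0 = 0 < d\<close>, the maximum over
    \<open>{0..R}\<close> is attained in the interior.\<close>
  define R where "R = max r (M powr (1 / \<alpha>1))"
  have M: "1 \<le> M" by (simp add: M_def)
  have R1: "1 \<le> R" "r \<le> R" using ge_one_powr_ge_zero[of M "1 / \<alpha>1"] M alpha by (auto simp: R_def)
  have "\<rho> R \<le> 0"
  proof -
    have "(M powr (1 / \<alpha>1)) powr \<alpha>1 \<le> R powr \<alpha>1" using alpha by (intro powr_mono2) (auto simp: R_def)
    then have MR: "M \<le> R powr \<alpha>1" using alpha M by (simp add: powr_powr)
    have "R powr \<alpha>1 \<le> R powr \<alpha>2" using R1 alpha by (intro powr_mono) auto
    then have "a11 * R powr \<alpha>2 + a22 * R powr \<alpha>1 \<le> \<bar>a11\<bar> * R powr \<alpha>2 + \<bar>a22\<bar> * R powr \<alpha>2"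
      by (intro add_mono mult_mono) auto
    also have "\<dots> \<le> M * R powr \<alpha>2" by (simp add: M_def algebra_simps)
    also have "\<dots> \<le> R powr (\<alpha>1 + \<alpha>2)" unfolding powr_add using MR by (intro mult_right_mono) auto
    finally show ?thesis by (simp add: \<rho>_def)
  qed
  have "continuous_on {0..R} \<rho>" unfolding \<rho>_def using alpha
    by (intro continuous_on_diff continuous_on_add continuous_on_mult continuous_on_const continuous_on_powr' continuous_on_id) auto
  then obtain m where m: "m \<in> {0..R}" "\<And>x. x \<in> {0..R} \<Longrightarrow> \<rho> x \<le> \<rho> m"
    using continuous_attains_sup[of "{0..R}" \<rho>] R1 by auto
  have dm: "d \<le> \<rho> m" using m(2)[of r] \<rho>r r R1 by simp
  have "m \<noteq> 0" using dm d_pos alpha by (auto simp: \<rho>_def)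
  moreover have "m \<noteq> R" using dm d_pos \<open>\<rho> R \<le> 0\<close> by auto
  ultimately have m0: "0 < m" "m < R" using m(1) by auto
  have deriv: "(\<rho> has_real_derivative a11 * (\<alpha>2 * m powr (\<alpha>2 - 1)) + a22 * (\<alpha>1 * m powr (\<alpha>1 - 1)) - (\<alpha>1 + \<alpha>2) * m powr (\<alpha>1 + \<alpha>2 - 1)) (at m)"
    unfolding \<rho>_def[abs_def] using m0 by (auto intro!: derivative_eq_intros simp: powr_diff mult_ac)
  have max: "\<forall>y. \<bar>m - y\<bar> < min m (R - m) \<longrightarrow> \<rho> y \<le> \<rho> m" 
  proof (intro allI impI)
    fix y assume "\<bar>m - y\<bar> < min m (R - m)"
    then have "0 \<le> y" "y \<le> R" by linarith+
    then show "\<rho> y \<le> \<rho> m" using m(2) by simp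
  qed
  have "a11 * (\<alpha>2 * m powr (\<alpha>2 - 1)) + a22 * (\<alpha>1 * m powr (\<alpha>1 - 1)) - (\<alpha>1 + \<alpha>2) * m powr (\<alpha>1 + \<alpha>2 - 1) = 0"
    by (rule DERIV_local_max[OF deriv _ max]) (use m0 in simp)
  then have "(a11 * \<alpha>2 * m powr \<alpha>2 + a22 * \<alpha>1 * m powr \<alpha>1 - (\<alpha>1 + \<alpha>2) * m powr (\<alpha>1 + \<alpha>2)) / m = 0"
    using m0 by (simp add: powr_diff diff_divide_distrib add_divide_distrib mult.assoc)
  then have crit: "(\<alpha>1 + \<alpha>2) * m powr (\<alpha>1 + \<alpha>2) = a11 * \<alpha>2 * m powr \<alpha>2 + a22 * \<alpha>1 * m powr \<alpha>1"
    using m0 by simp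
  \<comment> \<open>The limits of the two sine ratios as the angle tends to 0. They add up to 1, so
    inserting the critical-point equation into \<open>\<rho> m\<close> yields the second
    relation.\<close>
  define p1 p2 where "p1 = \<alpha>1 / (\<alpha>1 + \<alpha>2)" and "p2 = \<alpha>2 / (\<alpha>1 + \<alpha>2)"
  have eq: "m powr (\<alpha>1 + \<alpha>2) = a11 * p2 * m powr \<alpha>2 + a22 * p1 * m powr \<alpha>1"
  proof -
    have "m powr (\<alpha>1 + \<alpha>2) = (a11 * \<alpha>2 * m powr \<alpha>2 + a22 * \<alpha>1 * m powr \<alpha>1) / (\<alpha>1 + \<alpha>2)"
      unfolding crit[symmetric] using alpha by simp
    then show ?thesis by (simp add: p1_def p2_def add_divide_distrib)
  qed
  have p12: "p1 = 1 - p2" using alpha by (simp add: p1_def p2_def field_simps)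
  have le: "d \<le> a11 * p1 * m powr \<alpha>2 + a22 * p2 * m powr \<alpha>1"
    using dm eq unfolding \<rho>_def p12 by (simp add: algebra_simps)
  have half: "c * (pi / 2) = c * pi / 2" for c :: real by simp
  have "\<alpha>1 * sin ((\<alpha>1 + \<alpha>2) * pi / 2) \<le> (\<alpha>1 + \<alpha>2) * sin (\<alpha>1 * pi / 2)"
       "\<alpha>2 * sin ((\<alpha>1 + \<alpha>2) * pi / 2) \<le> (\<alpha>1 + \<alpha>2) * sin (\<alpha>2 * pi / 2)"
       "\<alpha>1 * sin (\<alpha>2 * pi / 2) \<le> \<alpha>2 * sin (\<alpha>1 * pi / 2)"
    unfolding half[symmetric] using alpha angles pi_gt_zero by (intro sin_mult_le; simp)+
  note sines = this
  have den: "0 < (\<alpha>1 + \<alpha>2) * sin ((\<alpha>1 + \<alpha>2) * pi / 2)" using S_pos alpha by simp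
  have "p1 \<le> q1" "p2 \<le> q2"
    using sines S_pos alpha by (simp_all add: p1_def p2_def q1 q2 divide_le_eq le_divide_eq mult.commute)
  moreover have eqs: "q2 * p1 = \<alpha>1 * sin (\<alpha>2 * pi / 2) / ((\<alpha>1 + \<alpha>2) * sin ((\<alpha>1 + \<alpha>2) * pi / 2))"
    "p2 * q1 = \<alpha>2 * sin (\<alpha>1 * pi / 2) / ((\<alpha>1 + \<alpha>2) * sin ((\<alpha>1 + \<alpha>2) * pi / 2))"
    by (simp_all add: p1_def p2_def q1 q2 mult.commute)
  have "q2 * p1 \<le> p2 * q1" unfolding eqs by (rule divide_right_mono[OF sines(3) less_imp_le[OF den]])
  ultimately show False
    using no_common_solution[OF _ _ _ _ _ m0(1) eq le] alpha by (simp add: p1_def p2_def)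
qed

lemma Qpolar_nonzero:
  assumes "0 \<le> r" "0 \<le> \<theta>" "\<theta> \<le> pi / 2"
  shows "Qpolar r \<theta> \<noteq> 0"
proof (cases "r = 0")
  case True then show ?thesis using d_pos alpha by (simp add: Qpolar_def)
next
  case False
  then show ?thesis using Qpolar_zero_angle[of r] Qpolar_pos_angle[of r \<theta>] assms by (cases "\<theta> = 0") auto
qed

lemma Qpolar_continuous: "continuous_on ({0..} \<times> UNIV) (\<lambda>(r, \<theta>). Qpolar r \<theta>)"
proof -
  have p: "continuous_on ({0..} \<times> UNIV) (\<lambda>x :: real \<times> real. complex_of_real (fst x powr b))" if "0 < b" for b
    by (intro continuous_on_of_real continuous_on_powr' continuous_intros) (use that in auto)
  show ?thesis
    unfolding Qpolar_def rcis_def case_prod_unfold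
    by (intro continuous_on_add continuous_on_diff continuous_on_mult continuous_on_const p
        continuous_on_cis continuous_on_snd continuous_on_id) (use alpha in auto)
qed

lemma Qpolar_large:
  assumes r: "1 \<le> r" "2 * (\<bar>a11\<bar> + \<bar>a22\<bar> + d) \<le> r powr \<alpha>1"
  shows "r powr (\<alpha>1 + \<alpha>2) / 2 \<le> norm (Qpolar r \<theta>)"
proof -
  have X: "1 \<le> r powr \<alpha>1" "r powr \<alpha>1 \<le> r powr \<alpha>2" "1 \<le> r powr \<alpha>2"
    using r alpha by (auto intro: powr_mono ge_one_powr_ge_zero)
  define E where "E = of_real a11 * rcis (r powr \<alpha>2) (\<alpha>2 * \<theta>) + of_real a22 * rcis (r powr \<alpha>1) (\<alpha>1 * \<theta>) - of_real d"
  have "norm E \<le> \<bar>a11\<bar> * r powr \<alpha>2 + \<bar>a22\<bar> * r powr \<alpha>1 + d"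
    unfolding E_def using d_pos
    by (intro order_trans[OF norm_triangle_ineq4] order_trans[OF add_right_mono[OF norm_triangle_ineq]]) (simp add: norm_mult)
  also have "\<dots> \<le> \<bar>a11\<bar> * r powr \<alpha>2 + \<bar>a22\<bar> * r powr \<alpha>2 + d * r powr \<alpha>2"
    using X d_pos by (intro add_mono mult_left_mono) auto
  also have "\<dots> = (\<bar>a11\<bar> + \<bar>a22\<bar> + d) * r powr \<alpha>2" by (simp add: distrib_right)
  also have "\<dots> \<le> (r powr \<alpha>1 / 2) * r powr \<alpha>2" using r by (intro mult_right_mono) auto
  finally have "norm E \<le> r powr (\<alpha>1 + \<alpha>2) / 2" by (simp add: powr_add)
  moreover have "Qpolar r \<theta> = rcis (r powr (\<alpha>1 + \<alpha>2)) ((\<alpha>1 + \<alpha>2) * \<theta>) - E"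
    by (simp add: Qpolar_def E_def)
  moreover have "norm (rcis (r powr (\<alpha>1 + \<alpha>2)) ((\<alpha>1 + \<alpha>2) * \<theta>)) = r powr (\<alpha>1 + \<alpha>2)" by simp
  ultimately show ?thesis
    using norm_triangle_ineq2[of "rcis (r powr (\<alpha>1 + \<alpha>2)) ((\<alpha>1 + \<alpha>2) * \<theta>)" E] by simp
qed

text \<open>The zeros of modulus at most \<open>R\<close> with angle in \<open>{0..pi}\<close> form
  a compact set whose angles all exceed \<open>pi / 2\<close>; \<phi> is put below the least of
  them. For \<open>R \<le> r\<close> the leading power dominates. The constant bound is used near
  the vertex, the other one at infinity.\<close>

lemma Qpolar_lower_bound:
  obtains \<phi> \<kappa> where "pi / 2 < \<phi>" "\<phi> < pi" "0 < \<kappa>"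
    "\<And>r \<theta>. 0 \<le> r \<Longrightarrow> 0 \<le> \<theta> \<Longrightarrow> \<theta> \<le> \<phi> \<Longrightarrow> \<kappa> \<le> norm (Qpolar r \<theta>)"
    "\<And>r \<theta>. 0 \<le> r \<Longrightarrow> 0 \<le> \<theta> \<Longrightarrow> \<theta> \<le> \<phi> \<Longrightarrow> \<kappa> * r powr (\<alpha>1 + \<alpha>2) \<le> norm (Qpolar r \<theta>)"
proof -
  define M where "M = \<bar>a11\<bar> + \<bar>a22\<bar> + d"
  define R where "R = max 1 ((2 * M) powr (1 / \<alpha>1))"
  have M: "0 < M" using d_pos by (simp add: M_def)
  have large: "r powr (\<alpha>1 + \<alpha>2) / 2 \<le> norm (Qpolar r \<theta>)" if "R \<le> r" for r \<theta>
  proof (rule Qpolar_large)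
    show "1 \<le> r" using that by (simp add: R_def)
    have "((2 * M) powr (1 / \<alpha>1)) powr \<alpha>1 \<le> r powr \<alpha>1" using alpha that by (intro powr_mono2) (auto simp: R_def)
    then show "2 * (\<bar>a11\<bar> + \<bar>a22\<bar> + d) \<le> r powr \<alpha>1" using alpha M by (simp add: powr_powr M_def)
  qed
  let ?Z = "{x \<in> {0..R} \<times> {0..pi}. (case x of (r, \<theta>) \<Rightarrow> Qpolar r \<theta>) = 0}"
  have cont: "continuous_on ({0..R} \<times> T) (\<lambda>(r, \<theta>). Qpolar r \<theta>)" for T
    by (rule continuous_on_subset[OF Qpolar_continuous]) auto
  have "closed ?Z"
    by (intro continuous_closed_preimage_constant cont closed_Times) auto
  moreover have "bounded ?Z" by (rule bounded_subset[of "{0..R} \<times> {0..pi}"]) (auto intro: bounded_Times)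
  ultimately have "compact (snd ` ?Z)"
    by (intro compact_continuous_image continuous_intros) (simp add: compact_eq_bounded_closed)
  obtain \<phi> where \<phi>: "pi / 2 < \<phi>" "\<phi> < pi" "\<And>\<theta>. \<theta> \<in> snd ` ?Z \<Longrightarrow> \<phi> < \<theta>"
  proof (cases "snd ` ?Z = {}")
    case True
    \<comment> \<open>There are no zeros here; any angle strictly between \<open>pi / 2\<close> and
      \<open>pi\<close> would do.\<close>
    show thesis by (rule that[of "3 * pi / 4"]) (use True in auto)
  next
    case False
    then obtain \<theta>0 where \<theta>0: "\<theta>0 \<in> snd ` ?Z" "\<And>\<theta>. \<theta> \<in> snd ` ?Z \<Longrightarrow> \<theta>0 \<le> \<theta>"
      using compact_attains_inf[OF \<open>compact (snd ` ?Z)\<close>] by blast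
    have "pi / 2 < \<theta>0"
    proof (rule ccontr)
      assume "\<not> pi / 2 < \<theta>0"
      then show False using \<theta>0(1) Qpolar_nonzero[of _ \<theta>0] by force
    qed
    moreover have "\<theta>0 \<le> pi" using \<theta>0(1) by auto
    ultimately show thesis
      by (intro that[of "(pi / 2 + \<theta>0) / 2"]) (use \<theta>0(2) in force)+
  qed
  have nonzero: "Qpolar r \<theta> \<noteq> 0" if "0 \<le> r" "r \<le> R" "0 \<le> \<theta>" "\<theta> \<le> \<phi>" for r \<theta>
  proof
    assume "Qpolar r \<theta> = 0"
    then have "(r, \<theta>) \<in> ?Z" using that \<phi> by auto
    then have "\<theta> \<in> snd ` ?Z" by force
    then show False using \<phi>(3) that by force
  qed
  have "continuous_on ({0..R} \<times> {0..\<phi>}) (\<lambda>x. norm (case x of (r, \<theta>) \<Rightarrow> Qpolar r \<theta>))"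
    by (intro continuous_intros cont)
  moreover have "compact ({0..R} \<times> {0..\<phi>})" by (intro compact_Times) auto
  moreover have "(0, 0) \<in> {0..R} \<times> {0..\<phi>}" using \<phi> pi_gt_zero by (auto simp: R_def)
  ultimately obtain x where x: "x \<in> {0..R} \<times> {0..\<phi>}"
    "\<And>y. y \<in> {0..R} \<times> {0..\<phi>} \<Longrightarrow> norm (case x of (r, \<theta>) \<Rightarrow> Qpolar r \<theta>) \<le> norm (case y of (r, \<theta>) \<Rightarrow> Qpolar r \<theta>)"
    using continuous_attains_inf[of "{0..R} \<times> {0..\<phi>}" "\<lambda>x. norm (case x of (r, \<theta>) \<Rightarrow> Qpolar r \<theta>)"] by blast
  define m where "m = norm (case x of (r, \<theta>) \<Rightarrow> Qpolar r \<theta>)"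
  have m: "0 < m" using x(1) nonzero by (auto simp: m_def)
  have small: "m \<le> norm (Qpolar r \<theta>)" if "0 \<le> r" "r \<le> R" "0 \<le> \<theta>" "\<theta> \<le> \<phi>" for r \<theta>
    using x(2)[of "(r, \<theta>)"] that by (simp add: m_def)
  have R1: "1 \<le> R" by (simp add: R_def)
  \<comment> \<open>The value \<open>1 / 2\<close> comes from \<open>large\<close>; dividing
    \<open>m\<close> by the largest value of the power on \<open>{0..R}\<close> lets one constant
    serve both bounds.\<close>
  define \<kappa> where "\<kappa> = min (1 / 2) (m / R powr (\<alpha>1 + \<alpha>2))"
  have \<kappa>0: "0 < \<kappa>" using m R1 by (simp add: \<kappa>_def)
  have RR: "1 \<le> R powr (\<alpha>1 + \<alpha>2)" using R1 alpha by (intro ge_one_powr_ge_zero) auto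
  have \<kappa>m: "\<kappa> * R powr (\<alpha>1 + \<alpha>2) \<le> m"
  proof -
    have "\<kappa> \<le> m / R powr (\<alpha>1 + \<alpha>2)" by (simp add: \<kappa>_def)
    moreover have "0 < R powr (\<alpha>1 + \<alpha>2)" using RR by linarith
    ultimately show ?thesis by (simp only: pos_le_divide_eq)
  qed
  have main: "\<kappa> * max 1 (r powr (\<alpha>1 + \<alpha>2)) \<le> norm (Qpolar r \<theta>)" if "0 \<le> r" "0 \<le> \<theta>" "\<theta> \<le> \<phi>" for r \<theta>
  proof (cases "r \<le> R")
    case True
    have "max 1 (r powr (\<alpha>1 + \<alpha>2)) \<le> R powr (\<alpha>1 + \<alpha>2)" using RR True that alpha by (auto intro: powr_mono2)
    then have "\<kappa> * max 1 (r powr (\<alpha>1 + \<alpha>2)) \<le> \<kappa> * R powr (\<alpha>1 + \<alpha>2)" using \<kappa>0 by (intro mult_left_mono) auto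
    then show ?thesis using small[OF that(1) True that(2,3)] \<kappa>m by linarith
  next
    case False
    then have "1 \<le> r powr (\<alpha>1 + \<alpha>2)" using R1 alpha by (intro ge_one_powr_ge_zero) auto
    moreover have "\<kappa> \<le> 1 / 2" unfolding \<kappa>_def by (rule min.cobounded1)
    ultimately have "\<kappa> * max 1 (r powr (\<alpha>1 + \<alpha>2)) \<le> (1 / 2) * r powr (\<alpha>1 + \<alpha>2)"
      by (intro mult_mono) auto
    then show ?thesis using large[of r \<theta>] False by simp
  qed
  show thesis
  proof (rule that[OF \<phi>(1,2) \<kappa>0])
    fix r \<theta> :: real assume *: "0 \<le> r" "0 \<le> \<theta>" "\<theta> \<le> \<phi>"
    have "\<kappa> * 1 \<le> \<kappa> * max 1 (r powr (\<alpha>1 + \<alpha>2))" "\<kappa> * r powr (\<alpha>1 + \<alpha>2) \<le> \<kappa> * max 1 (r powr (\<alpha>1 + \<alpha>2))"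
      using \<kappa>0 by (intro mult_left_mono; simp)+
    then show "\<kappa> \<le> norm (Qpolar r \<theta>)" "\<kappa> * r powr (\<alpha>1 + \<alpha>2) \<le> norm (Qpolar r \<theta>)"
      using main[OF *] by linarith+
  qed
qed

end

section \<open>Resolvent kernels\<close>

lemma powr_of_real_polar:
  assumes "s \<noteq> 0" shows "s powr complex_of_real b = rcis (cmod s powr b) (b * Arg s)"
  using assms by (intro complex_eqI) (simp_all add: powr_def Re_exp Im_exp Arg_def)

lemma norm_powr_of_real:
  assumes "s \<noteq> 0" shows "norm (s powr complex_of_real b) = cmod s powr b"
  using assms by (simp add: powr_of_real_polar)

lemma sector_not_nonpos:
  assumes "s \<in> sector \<phi>" "s \<noteq> 0" "0 < \<phi>" "\<phi> < pi"
  shows "s \<notin> \<real>\<^sub>\<le>\<^sub>0"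
proof
  assume "s \<in> \<real>\<^sub>\<le>\<^sub>0"
  then obtain x where "s = of_real x" "x \<le> 0" by (auto simp: nonpos_Reals_def)
  then have "Arg s = pi" using assms(2) by simp
  then show False using sector_polar(2)[OF assms] assms by simp
qed

context spectral
begin

text \<open>With \<open>d = det A\<close> this is the determinant of
  \<open>diag (s powr \<alpha>1, s powr \<alpha>2) - A\<close>.\<close>

definition charfun :: "complex \<Rightarrow> complex" where
  "charfun s = s powr of_real (\<alpha>1 + \<alpha>2) - of_real a11 * s powr of_real \<alpha>2 - of_real a22 * s powr of_real \<alpha>1 + of_real d"

definition charfun_real :: "real \<Rightarrow> real" where
  "charfun_real z = z powr (\<alpha>1 + \<alpha>2) - a11 * z powr \<alpha>2 - a22 * z powr \<alpha>1 + d"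

lemma charfun_polar: "s \<noteq> 0 \<Longrightarrow> charfun s = Qpolar (cmod s) (Arg s)"
  unfolding charfun_def Qpolar_def by (simp add: powr_of_real_polar del: of_real_add)

lemma charfun_of_real: "0 < z \<Longrightarrow> charfun (of_real z) = of_real (charfun_real z)"
  by (simp add: charfun_def charfun_real_def flip: powr_of_real)

lemma charfun_real_nonzero: "0 < z \<Longrightarrow> charfun_real z \<noteq> 0"
  using charfun_of_real[of z] charfun_polar[of "of_real z"] Qpolar_nonzero[of z 0] by auto

text \<open>The numerators cover all entries of the adjugate of
  \<open>diag (s powr \<alpha>1, s powr \<alpha>2) - A\<close>. The largest at infinity,
  \<open>s powr \<alpha>2\<close>, leaves decay of order \<alpha>1 after division; at the vertex
  \<open>s powr \<alpha>1\<close> is the most slowly vanishing term. Hence one exponent for both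
  ends.\<close>

lemma kernel_exists:
  fixes n0 n1 n2 :: real
  shows "\<exists>K C. decaying_kernel K (\<lambda>z. (n0 + n1 * z powr \<alpha>1 + n2 * z powr \<alpha>2) / charfun_real z) \<alpha>1 C"
proof -
  obtain \<phi> \<kappa> where \<phi>: "pi / 2 < \<phi>" "\<phi> < pi" and \<kappa>: "0 < \<kappa>"
    and Q1: "\<And>r \<theta>. 0 \<le> r \<Longrightarrow> 0 \<le> \<theta> \<Longrightarrow> \<theta> \<le> \<phi> \<Longrightarrow> \<kappa> \<le> norm (Qpolar r \<theta>)"
    and Q2: "\<And>r \<theta>. 0 \<le> r \<Longrightarrow> 0 \<le> \<theta> \<Longrightarrow> \<theta> \<le> \<phi> \<Longrightarrow> \<kappa> * r powr (\<alpha>1 + \<alpha>2) \<le> norm (Qpolar r \<theta>)"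
    using Qpolar_lower_bound by blast
  have \<phi>0: "0 < \<phi>" using \<phi> pi_gt_zero by linarith
  define N :: "complex \<Rightarrow> complex" where "N s = of_real n0 + of_real n1 * s powr of_real \<alpha>1 + of_real n2 * s powr of_real \<alpha>2" for s
  define G where "G s = N s / charfun s" for s
  define c where "c = n0 / d"
  define n where "n = \<bar>n0\<bar> + \<bar>n1\<bar> + \<bar>n2\<bar>"
  define m where "m = n + \<bar>c\<bar> * (1 + \<bar>a11\<bar> + \<bar>a22\<bar>)"
  \<comment> \<open>\<open>3 * n / \<kappa>\<close> bounds
    \<open>norm (G s) * cmod s powr \<alpha>1\<close> on the sector away from 0;
    \<open>m / \<kappa>\<close> bounds the deviation from \<open>c\<close> relative to
    \<open>cmod s powr \<alpha>1\<close> when \<open>cmod s \<le> 1\<close>;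
    \<open>\<bar>c\<bar>\<close> enters for larger \<open>s\<close>.\<close>
  define C where "C = 3 * n / \<kappa> + \<bar>c\<bar> + m / \<kappa>"
  have nm: "0 \<le> n" "0 \<le> m" by (auto simp: n_def m_def)
  have charfun_bounds: "\<kappa> \<le> norm (charfun s)" "\<kappa> * cmod s powr \<alpha>1 * cmod s powr \<alpha>2 \<le> norm (charfun s)"
    if "s \<in> sector \<phi>" "s \<noteq> 0" for s
    using Q1[of "cmod s" "Arg s"] Q2[of "cmod s" "Arg s"] sector_polar[OF that \<phi>0 \<phi>(2)] charfun_polar[OF that(2)]
    by (simp_all add: powr_add mult.assoc)
  have N_le: "norm (N s) \<le> n * (1 + cmod s powr \<alpha>1 + cmod s powr \<alpha>2)" if "s \<noteq> 0" for s
  proof -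
    have "norm (N s) \<le> \<bar>n0\<bar> + \<bar>n1\<bar> * cmod s powr \<alpha>1 + \<bar>n2\<bar> * cmod s powr \<alpha>2"
      unfolding N_def by (intro order_trans[OF norm_triangle_ineq] add_mono)
        (use that in \<open>simp_all add: norm_mult norm_powr_of_real\<close>)
    also have "\<dots> \<le> n * 1 + n * cmod s powr \<alpha>1 + n * cmod s powr \<alpha>2"
      unfolding n_def by (intro add_mono mult_right_mono) auto
    finally show ?thesis by (simp add: algebra_simps)
  qed
  have small: "cmod s powr \<alpha>1 \<le> 1 \<and> cmod s powr \<alpha>2 \<le> cmod s powr \<alpha>1" if "cmod s \<le> 1" for s
    using that alpha by (auto intro: powr_le1 powr_mono')
  have large: "1 \<le> cmod s powr \<alpha>1 \<and> cmod s powr \<alpha>1 \<le> cmod s powr \<alpha>2" if "1 < cmod s" for s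
    using that alpha by (auto intro: ge_one_powr_ge_zero powr_mono)
  have G_X: "norm (G s) * cmod s powr \<alpha>1 \<le> 3 * n / \<kappa>" if s: "s \<in> sector \<phi>" "s \<noteq> 0" for s
  proof -
    let ?X = "cmod s powr \<alpha>1" and ?Y = "cmod s powr \<alpha>2"
    have pos: "0 < norm (charfun s)" using charfun_bounds(1)[OF s] \<kappa> by linarith
    have "norm (N s) * ?X * \<kappa> \<le> 3 * n * norm (charfun s)"
    proof (cases "cmod s \<le> 1")
      case True
      have "norm (N s) * ?X * \<kappa> \<le> (n * (1 + ?X + ?Y)) * 1 * \<kappa>"
        using N_le[OF s(2)] small[OF True] \<kappa> nm by (intro mult_mono) auto
      also have "\<dots> \<le> (n * 3) * 1 * norm (charfun s)"
        using small[OF True] charfun_bounds(1)[OF s] \<kappa> nm by (intro mult_mono) auto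
      finally show ?thesis by simp
    next
      case False
      then have XY: "1 \<le> ?X" "?X \<le> ?Y" using large[of s] by auto
      have "norm (N s) * ?X * \<kappa> \<le> (n * (3 * ?Y)) * ?X * \<kappa>"
        using XY \<kappa> nm by (intro mult_right_mono order_trans[OF N_le[OF s(2)]] mult_left_mono) auto
      also have "\<dots> = 3 * n * (\<kappa> * ?X * ?Y)" by simp
      also have "\<dots> \<le> 3 * n * norm (charfun s)"
        using charfun_bounds(2)[OF s] nm by (intro mult_left_mono) auto
      finally show ?thesis .
    qed
    then show ?thesis using pos \<kappa> by (simp add: G_def norm_divide field_simps)
  qed
  have bd_inf: "norm (G s) \<le> C * cmod s powr (- \<alpha>1)" if s: "s \<in> sector \<phi>" "s \<noteq> 0" for s
  proof -
    have X: "0 < cmod s powr \<alpha>1" using s by simp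
    have "norm (G s) \<le> (3 * n / \<kappa>) / cmod s powr \<alpha>1" using G_X[OF s] by (simp only: pos_le_divide_eq[OF X])
    also have "\<dots> \<le> C / cmod s powr \<alpha>1" using nm \<kappa> by (intro divide_right_mono) (auto simp: C_def)
    finally show ?thesis by (simp add: powr_minus divide_inverse)
  qed
  have bd_0: "norm (G s - of_real c) \<le> C * cmod s powr \<alpha>1" if s: "s \<in> sector \<phi>" "s \<noteq> 0" for s
  proof (cases "cmod s \<le> 1")
    case True
    let ?X = "cmod s powr \<alpha>1" and ?Y = "cmod s powr \<alpha>2"
    have pos: "0 < norm (charfun s)" using charfun_bounds(1)[OF s] \<kappa> by linarith
    \<comment> \<open>The numerator of \<open>G s - c\<close>; the constant terms cancel because
      \<open>n0 = c * d\<close>.\<close>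
    define D where "D = of_real n1 * s powr of_real \<alpha>1 + of_real n2 * s powr of_real \<alpha>2
      - of_real c * (s powr of_real (\<alpha>1 + \<alpha>2) - of_real a11 * s powr of_real \<alpha>2 - of_real a22 * s powr of_real \<alpha>1)"
    have "N s - of_real c * charfun s = D + (of_real n0 - of_real c * of_real d)"
      by (simp add: N_def charfun_def D_def algebra_simps)
    also have "of_real n0 - of_real c * of_real d = (0 :: complex)"
      using d_pos by (simp add: c_def)
    finally have GD: "G s - of_real c = D / charfun s"
      using pos by (simp add: G_def field_simps)
    have "norm (s powr of_real (\<alpha>1 + \<alpha>2) - of_real a11 * s powr of_real \<alpha>2 - of_real a22 * s powr of_real \<alpha>1)
        \<le> cmod s powr (\<alpha>1 + \<alpha>2) + \<bar>a11\<bar> * ?Y + \<bar>a22\<bar> * ?X"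
      by (intro order_trans[OF norm_triangle_ineq4] add_mono)
        (use s in \<open>simp_all add: norm_mult norm_powr_of_real del: of_real_add\<close>)
    moreover have "\<bar>a11\<bar> * ?Y \<le> \<bar>a11\<bar> * ?X" using small[OF True] by (intro mult_left_mono) auto
    moreover have "cmod s powr (\<alpha>1 + \<alpha>2) \<le> ?X" using s True alpha by (intro powr_mono') auto
    ultimately have inner: "norm (s powr of_real (\<alpha>1 + \<alpha>2) - of_real a11 * s powr of_real \<alpha>2 - of_real a22 * s powr of_real \<alpha>1)
        \<le> (1 + \<bar>a11\<bar> + \<bar>a22\<bar>) * ?X" by (simp add: distrib_right)
    have "\<bar>n2\<bar> * ?Y \<le> \<bar>n2\<bar> * ?X" using small[OF True] by (intro mult_left_mono) auto
    have "norm D \<le> (\<bar>n1\<bar> * ?X + \<bar>n2\<bar> * ?X) + \<bar>c\<bar> * ((1 + \<bar>a11\<bar> + \<bar>a22\<bar>) * ?X)"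
      unfolding D_def
    proof (intro order_trans[OF norm_triangle_ineq4] add_mono order_trans[OF norm_triangle_ineq])
      show "norm (of_real c * (s powr of_real (\<alpha>1 + \<alpha>2) - of_real a11 * s powr of_real \<alpha>2 - of_real a22 * s powr of_real \<alpha>1))
         \<le> \<bar>c\<bar> * ((1 + \<bar>a11\<bar> + \<bar>a22\<bar>) * ?X)"
        unfolding norm_mult norm_of_real by (intro mult_left_mono inner) auto
    qed (use s \<open>\<bar>n2\<bar> * ?Y \<le> \<bar>n2\<bar> * ?X\<close> in \<open>simp_all add: norm_mult norm_powr_of_real\<close>)
    also have "\<dots> \<le> m * ?X" by (simp add: m_def n_def algebra_simps)
    finally have "norm D \<le> m * ?X" .
    then have "norm D / norm (charfun s) \<le> (m * ?X) / \<kappa>"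
      using charfun_bounds(1)[OF s] \<kappa> nm by (intro frac_le) auto
    also have "\<dots> = (m / \<kappa>) * ?X" by simp
    also have "\<dots> \<le> C * ?X" using nm \<kappa> by (intro mult_right_mono) (auto simp: C_def)
    finally show ?thesis by (simp add: GD norm_divide)
  next
    case False
    then have X: "1 \<le> cmod s powr \<alpha>1" using large[of s] by auto
    have "norm (G s) * 1 \<le> norm (G s) * cmod s powr \<alpha>1" using X by (intro mult_left_mono) auto
    then have "norm (G s) \<le> 3 * n / \<kappa>" using G_X[OF s] by linarith
    then have "norm (G s - of_real c) \<le> 3 * n / \<kappa> + \<bar>c\<bar>" by (intro order_trans[OF norm_triangle_ineq4]) simp
    also have "\<dots> \<le> C" using nm \<kappa> by (simp add: C_def)
    also have "\<dots> = C * 1" by simp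
    also have "\<dots> \<le> C * cmod s powr \<alpha>1" using X nm \<kappa> by (intro mult_left_mono) (auto simp: C_def)
    finally show ?thesis .
  qed
  interpret sectorial G \<phi> \<alpha>1 C c
  proof
    show "G field_differentiable (at s)" if s: "s \<in> sector \<phi>" "s \<noteq> 0" for s
    proof -
      have "charfun s \<noteq> 0" using charfun_bounds(1)[OF s] \<kappa> by auto
      moreover have "(\<lambda>s. s powr of_real b) field_differentiable (at s)" for b
        using sector_not_nonpos[OF s \<phi>0 \<phi>(2)] has_field_derivative_powr field_differentiable_def by blast
      ultimately show ?thesis
        unfolding G_def[abs_def] N_def charfun_def
        by (intro derivative_intros) (auto simp del: of_real_add)
    qed
    show "G 0 = of_real c" by (simp add: G_def N_def charfun_def c_def)
    show "Im (G (of_real z)) = 0" if "0 < z" for z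
      using that by (simp add: G_def N_def charfun_of_real powr_of_real)
  qed (use \<phi> alpha bd_inf bd_0 in auto)
  have L: "has_laplace kernel (\<lambda>z. (n0 + n1 * z powr \<alpha>1 + n2 * z powr \<alpha>2) / charfun_real z)"
    using kernel_laplace unfolding has_laplace_def
  proof (elim conjE, intro conjI allI impI)
    fix z :: real assume "0 < z"
    then have "G (of_real z) = of_real ((n0 + n1 * z powr \<alpha>1 + n2 * z powr \<alpha>2) / charfun_real z)"
      by (simp add: G_def N_def charfun_of_real powr_of_real)
    moreover assume "\<forall>z>0. has_bochner_integral lborel (\<lambda>t. exp (- (z * t)) * kernel t) (Re (G (of_real z)))"
    ultimately show "has_bochner_integral lborel (\<lambda>t. exp (- (z * t)) * kernel t)
        ((n0 + n1 * z powr \<alpha>1 + n2 * z powr \<alpha>2) / charfun_real z)"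
      using \<open>0 < z\<close> by (metis Re_complex_of_real)
  qed blast
  define B1 where "B1 = C * Gamma (1 - \<alpha>1) * (- cos \<phi>) powr (\<alpha>1 - 1) / pi"
  define B2 where "B2 = C * Gamma (1 + \<alpha>1) * (- cos \<phi>) powr (- \<alpha>1 - 1) / pi"
  have "decaying_kernel kernel (\<lambda>z. (n0 + n1 * z powr \<alpha>1 + n2 * z powr \<alpha>2) / charfun_real z) \<alpha>1 (max B1 B2)"
  proof
    fix t :: real assume t: "0 < t"
    show "\<bar>kernel t\<bar> \<le> max B1 B2 * t powr (\<alpha>1 - 1)"
      by (rule order_trans[OF kernel_bound_0[OF t, folded B1_def]]) (simp add: mult_right_mono)
    show "\<bar>kernel t\<bar> \<le> max B1 B2 * t powr (- \<alpha>1 - 1)"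
      by (rule order_trans[OF kernel_bound_inf[OF t, folded B2_def]]) (simp add: mult_right_mono)
  qed (use L a in auto)
  then show ?thesis by blast
qed

end

section \<open>Representation and estimates of solutions\<close>

text \<open>Unlike \<open>stop\<close> there is no freezing: it is meant for the forcing, which is
  bounded in the estimates.\<close>

definition cut :: "(real \<Rightarrow> real) \<Rightarrow> real \<Rightarrow> real" where
  "cut h t = (if t < 0 then 0 else h t)"

lemma subexponential_cut:
  assumes "continuous_on {0..} h" "\<And>t. 0 \<le> t \<Longrightarrow> \<bar>h t\<bar> \<le> B"
  shows "subexponential (cut h)"
  unfolding subexponential_def
proof (intro conjI allI impI)
  show "continuous_on {0..} (cut h)"
    by (rule continuous_on_eq[OF assms(1)]) (simp add: cut_def)
  have B: "0 \<le> B" using assms(2)[of 0] by simp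
  fix z :: real assume "0 < z"
  then have "\<bar>exp (- (z * t)) * cut h t\<bar> \<le> B" for t
    using mult_mono[of "exp (- (z * t))" 1 "\<bar>h t\<bar>" B] assms(2)[of t] B by (auto simp: cut_def abs_mult)
  then show "\<exists>B. \<forall>t. \<bar>exp (- (z * t)) * cut h t\<bar> \<le> B" by blast
qed (simp add: cut_def)

context spectral
begin

text \<open>\<open>(Fa, Fb)\<close> is the row \<open>(e1, e2) (diag(z^\<alpha>1, z^\<alpha>2) - A)\<^sup>-\<^sup>1\<close> of the resolvent.\<close>

lemma representation:
  fixes a12 a21 e1 e2 :: real
  assumes Ka: "has_laplace Ka Fa" and Kb: "has_laplace Kb Fb"
    and F1: "\<And>z. 0 < z \<Longrightarrow> Fa z * (z powr \<alpha>1 - a11) - Fb z * a21 = e1"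
    and F2: "\<And>z. 0 < z \<Longrightarrow> Fb z * (z powr \<alpha>2 - a22) - Fa z * a12 = e2"
    and y1: "continuous_on {0..} y1" "y1 0 = 0" and y2: "continuous_on {0..} y2" "y2 0 = 0"
    and h: "continuous_on {0..} h1" "continuous_on {0..} h2"
    and D1: "\<And>t. 0 < t \<Longrightarrow> (caputo_primitive \<alpha>1 y1 has_real_derivative a11 * y1 t + a12 * y2 t + h1 t) (at t)"
    and D2: "\<And>t. 0 < t \<Longrightarrow> (caputo_primitive \<alpha>2 y2 has_real_derivative a21 * y1 t + a22 * y2 t + h2 t) (at t)"
    and t: "0 < t"
  shows "e1 * y1 t + e2 * y2 t = conv Ka (cut h1) t + conv Kb (cut h2) t"
proof -
  \<comment> \<open>The margin beyond \<open>t\<close> is what \<open>integ_inject\<close>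
    requires.\<close>
  define T where "T = t + 1"
  have T: "0 \<le> T" "t < T" using t by (simp_all add: T_def)
  define Y1 Y2 H1 H2 where "Y1 = stop T y1" and "Y2 = stop T y2" and "H1 = stop T h1" and "H2 = stop T h2"
  have sub: "subexponential Y1" "subexponential Y2" "subexponential H1" "subexponential H2"
    unfolding Y1_def Y2_def H1_def H2_def by (intro subexponential_stop y1 y2 h T)+
  obtain L1 L2 M1 M2 where L: "has_laplace Y1 L1" "has_laplace Y2 L2" "has_laplace H1 M1" "has_laplace H2 M2"
    using sub[THEN subexponential_has_laplace] by blast
  note I = RL_kernel_laplace[OF zero_less_one]
  define P1 P2 where "P1 = stopped_primitive \<alpha>1 T y1" and "P2 = stopped_primitive \<alpha>2 T y2"
  have P: "subexponential P1" "subexponential P2"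
    unfolding P1_def P2_def using alpha by (intro subexponential_stopped_primitive y1 y2 T; simp)+
  have LP: "has_laplace P1 (\<lambda>z. z powr (\<alpha>1 - 1) * L1 z)" "has_laplace P2 (\<lambda>z. z powr (\<alpha>2 - 1) * L2 z)"
    unfolding P1_def P2_def using alpha L(1,2) unfolding Y1_def Y2_def by (intro stopped_primitive_laplace; simp)+
  \<comment> \<open>The integrated equation with the unknowns moved to the left. Its right-hand side
    \<open>integ H1\<close> is guaranteed only on \<open>{0..T}\<close>, since freezing may destroy
    the equation afterwards, whereas the transform of \<open>W1\<close> is known exactly.\<close>
  define W1 where "W1 s = P1 s + ((- a11) * integ Y1 s + (- a12) * integ Y2 s)" for s
  define W2 where "W2 s = P2 s + ((- a21) * integ Y1 s + (- a22) * integ Y2 s)" for s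
  have W: "subexponential W1" "subexponential W2"
    unfolding W1_def[abs_def] W2_def[abs_def]
    by (intro subexponential_add subexponential_cmult subexponential_conv[OF I] P sub)+
  have LW: "has_laplace W1 (\<lambda>z. z powr (\<alpha>1 - 1) * L1 z + ((- a11) * (z powr - 1 * L1 z) + (- a12) * (z powr - 1 * L2 z)))"
    "has_laplace W2 (\<lambda>z. z powr (\<alpha>2 - 1) * L2 z + ((- a21) * (z powr - 1 * L1 z) + (- a22) * (z powr - 1 * L2 z)))"
    unfolding W1_def[abs_def] W2_def[abs_def]
    by (intro has_laplace_add has_laplace_cmult has_laplace_conv[OF I] LP L)+
  have integ_lin: "integ (\<lambda>s. b1 * Y1 s + b2 * Y2 s + H s) s = b1 * integ Y1 s + b2 * integ Y2 s + integ H s"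
    if "subexponential H" for H b1 b2 s
    by (simp add: conv_add_right[OF I] conv_cmult_right subexponential_add subexponential_cmult sub that)
  have W_integ: "W1 s = integ H1 s" "W2 s = integ H2 s" if s: "0 \<le> s" "s \<le> T" for s
  proof -
    have w: "continuous_on {0..} (\<lambda>t. b1 * y1 t + b2 * y2 t + h t)" if "continuous_on {0..} h" for b1 b2 h
      by (intro continuous_intros y1 y2 that)
    have stop_lin: "stop T (\<lambda>t. b1 * y1 t + b2 * y2 t + h t) = (\<lambda>s. b1 * Y1 s + b2 * Y2 s + stop T h s)" for b1 b2 h
      by (auto simp: stop_def Y1_def Y2_def)
    have "P1 s = integ (stop T (\<lambda>t. a11 * y1 t + a12 * y2 t + h1 t)) s"
      unfolding P1_def using alpha by (intro stopped_primitive_integ y1 w h D1 s) auto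
    then show "W1 s = integ H1 s" unfolding stop_lin H1_def[symmetric] integ_lin[OF sub(3)] W1_def by simp
    have "P2 s = integ (stop T (\<lambda>t. a21 * y1 t + a22 * y2 t + h2 t)) s"
      unfolding P2_def using alpha by (intro stopped_primitive_integ y2 w h D2 s) auto
    then show "W2 s = integ H2 s" unfolding stop_lin H2_def[symmetric] integ_lin[OF sub(4)] W2_def by simp
  qed
  define E where "E s = e1 * Y1 s + e2 * Y2 s" for s
  have E: "subexponential E" "has_laplace E (\<lambda>z. e1 * L1 z + e2 * L2 z)"
    unfolding E_def[abs_def] by (intro subexponential_add subexponential_cmult sub has_laplace_add has_laplace_cmult L)+
  define V where "V s = conv Ka H1 s + conv Kb H2 s" for s
  have V: "subexponential V" "has_laplace V (\<lambda>z. Fa z * M1 z + Fb z * M2 z)"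
    unfolding V_def[abs_def]
    by (intro subexponential_add subexponential_conv[OF Ka] subexponential_conv[OF Kb] sub has_laplace_add has_laplace_conv Ka Kb L)+
  \<comment> \<open>Multiplication by the resolvent row removes the matrix. This is an identity of
    stopped functions at all times; the differential equation is not yet involved.\<close>
  have "integ E s = conv Ka W1 s + conv Kb W2 s" for s
  proof (rule laplace_unique[OF subexponential_conv[OF I E(1)] _ has_laplace_conv[OF I E(2)]])
    show "subexponential (\<lambda>s. conv Ka W1 s + conv Kb W2 s)"
      by (intro subexponential_add subexponential_conv[OF Ka] subexponential_conv[OF Kb] W)
    show "has_laplace (\<lambda>s. conv Ka W1 s + conv Kb W2 s)
      (\<lambda>z. Fa z * (z powr (\<alpha>1 - 1) * L1 z + ((- a11) * (z powr - 1 * L1 z) + (- a12) * (z powr - 1 * L2 z)))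
         + Fb z * (z powr (\<alpha>2 - 1) * L2 z + ((- a21) * (z powr - 1 * L1 z) + (- a22) * (z powr - 1 * L2 z))))"
      by (intro has_laplace_add has_laplace_conv Ka Kb LW)
    fix z :: real assume z: "0 < z"
    have pw: "z powr (b - 1) = z powr b * z powr - 1" for b using powr_add[of z b "- 1"] by simp
    have "z powr - 1 * (e1 * L1 z + e2 * L2 z)
      = z powr - 1 * ((Fa z * (z powr \<alpha>1 - a11) - Fb z * a21) * L1 z + (Fb z * (z powr \<alpha>2 - a22) - Fa z * a12) * L2 z)"
      by (simp only: F1[OF z] F2[OF z])
    also have "\<dots> = Fa z * (z powr (\<alpha>1 - 1) * L1 z + ((- a11) * (z powr - 1 * L1 z) + (- a12) * (z powr - 1 * L2 z)))
         + Fb z * (z powr (\<alpha>2 - 1) * L2 z + ((- a21) * (z powr - 1 * L1 z) + (- a22) * (z powr - 1 * L2 z)))"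
      unfolding pw by algebra
    finally show "z powr - 1 * (e1 * L1 z + e2 * L2 z) = \<dots>" .
  qed
  moreover have "integ V s = conv Ka (integ H1) s + conv Kb (integ H2) s" for s
  proof (rule laplace_unique[OF subexponential_conv[OF I V(1)] _ has_laplace_conv[OF I V(2)]])
    show "subexponential (\<lambda>s. conv Ka (integ H1) s + conv Kb (integ H2) s)"
      by (intro subexponential_add subexponential_conv[OF Ka] subexponential_conv[OF Kb] subexponential_conv[OF I] sub)
    show "has_laplace (\<lambda>s. conv Ka (integ H1) s + conv Kb (integ H2) s)
      (\<lambda>z. Fa z * (z powr - 1 * M1 z) + Fb z * (z powr - 1 * M2 z))"
      by (intro has_laplace_add has_laplace_conv Ka Kb L I)
  qed (simp add: algebra_simps)
  \<comment> \<open>The equation enters here: by causality a convolution at \<open>s \<le> T\<close>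
    sees \<open>W1\<close> and \<open>W2\<close> on \<open>{0..T}\<close> only.\<close>
  moreover have "conv Ka W1 s = conv Ka (integ H1) s" "conv Kb W2 s = conv Kb (integ H2) s" if "0 \<le> s" "s \<le> T" for s
    using that W_integ
    by (intro conv_local has_laplace_causal[OF Ka] has_laplace_causal[OF Kb] subexponential_causal[OF W(1)] subexponential_causal[OF W(2)]
        subexponential_causal[OF subexponential_conv[OF I sub(3)]] subexponential_causal[OF subexponential_conv[OF I sub(4)]]; simp)+
  ultimately have "integ E s = integ V s" if "0 \<le> s" "s \<le> T" for s using that by simp
  then have "E t = V t"
    using E(1) V(1) T t by (intro integ_inject[of E V T t]) (auto simp: subexponential_def)
  moreover have "conv Ka H1 t = conv Ka (cut h1) t" "conv Kb H2 t = conv Kb (cut h2) t"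
    by (rule conv_local[OF has_laplace_causal[OF Ka]] conv_local[OF has_laplace_causal[OF Kb]];
        use T in \<open>simp add: H1_def H2_def stop_def cut_def\<close>)+
  ultimately show ?thesis using T t by (simp add: E_def V_def Y1_def Y2_def stop_def)
qed

text \<open>Subtracting the initial value \<open>v\<close> adds the constant \<open>A v\<close> to
  the forcing. By \<open>bal\<close> the limit of its convolution cancels
  \<open>e1 * v1 + e2 * v2\<close>, which leaves a tail of order \<open>t powr - \<alpha>1\<close>.
  The bound \<open>e\<close> is quantified after \<open>M\<close>, \<open>N\<close> and
  \<open>t\<close>, so that it may depend on \<open>t\<close>.\<close>

lemma row_estimate:
  fixes a12 a21 e1 e2 v1 v2 :: real
  assumes Ka: "decaying_kernel Ka Fa \<alpha>1 Ca" and Kb: "decaying_kernel Kb Fb \<alpha>1 Cb"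
    and F1: "\<And>z. 0 < z \<Longrightarrow> Fa z * (z powr \<alpha>1 - a11) - Fb z * a21 = e1"
    and F2: "\<And>z. 0 < z \<Longrightarrow> Fb z * (z powr \<alpha>2 - a22) - Fa z * a12 = e2"
    and lim: "(Fa \<longlongrightarrow> ka) (at_right 0)" "(Fb \<longlongrightarrow> kb) (at_right 0)"
    and bal: "ka * (a11 * v1 + a12 * v2) + kb * (a21 * v1 + a22 * v2) = - (e1 * v1 + e2 * v2)"
    and x1: "continuous_on {0..} x1" "x1 0 = v1" and x2: "continuous_on {0..} x2" "x2 0 = v2"
    and f: "continuous_on {0..} f1" "continuous_on {0..} f2"
    and B: "\<And>t. 0 \<le> t \<Longrightarrow> \<bar>f1 t\<bar> \<le> B" "\<And>t. 0 \<le> t \<Longrightarrow> \<bar>f2 t\<bar> \<le> B"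
    and D1: "\<And>t. 0 < t \<Longrightarrow> (caputo_primitive \<alpha>1 (\<lambda>s. x1 s - v1) has_real_derivative a11 * x1 t + a12 * x2 t + f1 t) (at t)"
    and D2: "\<And>t. 0 < t \<Longrightarrow> (caputo_primitive \<alpha>2 (\<lambda>s. x2 s - v2) has_real_derivative a21 * x1 t + a22 * x2 t + f2 t) (at t)"
  shows "\<exists>M\<ge>0. \<exists>N. \<forall>t>0. \<forall>e\<ge>0. (\<forall>s\<ge>t / 2. \<bar>f1 s\<bar> \<le> e \<and> \<bar>f2 s\<bar> \<le> e) \<longrightarrow>
     \<bar>e1 * x1 t + e2 * x2 t\<bar> \<le> M * e + N * t powr - \<alpha>1"
proof -
  interpret Ka: decaying_kernel Ka Fa \<alpha>1 Ca by (rule Ka)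
  interpret Kb: decaying_kernel Kb Fb \<alpha>1 Cb by (rule Kb)
  define c1 c2 where "c1 = a11 * v1 + a12 * v2" and "c2 = a21 * v1 + a22 * v2"
  define M where "M = (LINT u|lborel. \<bar>Ka u\<bar>) + (LINT u|lborel. \<bar>Kb u\<bar>)"
  define N where "N = B * Ca / \<alpha>1 * 2 powr \<alpha>1 + B * Cb / \<alpha>1 * 2 powr \<alpha>1 + \<bar>c1\<bar> * (Ca / \<alpha>1) + \<bar>c2\<bar> * (Cb / \<alpha>1)"
  let ?one = "\<lambda>t :: real. if t < 0 then 0 else 1 :: real"
  have B0: "0 \<le> B" using B(1)[of 0] by simp
  have cf: "subexponential (cut f1)" "subexponential (cut f2)" "subexponential ?one"
    using subexponential_cut[OF f(1) B(1)] subexponential_cut[OF f(2) B(2)] subexponential_cut[of "\<lambda>_. 1" 1]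
    by (auto simp: cut_def[abs_def])
  have cB: "\<bar>cut f1 t\<bar> \<le> B" "\<bar>cut f2 t\<bar> \<le> B" for t using B B0 by (auto simp: cut_def)
  have "\<bar>e1 * x1 t + e2 * x2 t\<bar> \<le> M * e + N * t powr - \<alpha>1"
    if t: "0 < t" and e: "0 \<le> e" and fe: "\<And>s. t / 2 \<le> s \<Longrightarrow> \<bar>f1 s\<bar> \<le> e \<and> \<bar>f2 s\<bar> \<le> e" for t e
  proof -
    have "e1 * (x1 t - v1) + e2 * (x2 t - v2) = conv Ka (cut (\<lambda>s. f1 s + c1)) t + conv Kb (cut (\<lambda>s. f2 s + c2)) t"
    proof (rule representation[OF Ka.laplace Kb.laplace F1 F2 _ _ _ _ _ _ _ _ t])
      fix s :: real assume s: "0 < s"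
      show "(caputo_primitive \<alpha>1 (\<lambda>s. x1 s - v1) has_real_derivative a11 * (x1 s - v1) + a12 * (x2 s - v2) + (f1 s + c1)) (at s)"
        using D1[OF s] by (simp add: c1_def algebra_simps)
      show "(caputo_primitive \<alpha>2 (\<lambda>s. x2 s - v2) has_real_derivative a21 * (x1 s - v1) + a22 * (x2 s - v2) + (f2 s + c2)) (at s)"
        using D2[OF s] by (simp add: c2_def algebra_simps)
    qed (use x1 x2 f in \<open>auto intro!: continuous_intros\<close>)
    moreover have "cut (\<lambda>s. f1 s + c1) = (\<lambda>s. cut f1 s + c1 * ?one s)" "cut (\<lambda>s. f2 s + c2) = (\<lambda>s. cut f2 s + c2 * ?one s)"
      by (auto simp: cut_def)
    ultimately have "e1 * (x1 t - v1) + e2 * (x2 t - v2)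
       = conv Ka (cut f1) t + c1 * conv Ka ?one t + (conv Kb (cut f2) t + c2 * conv Kb ?one t)"
      by (simp only: conv_add_right[OF Ka.laplace cf(1) subexponential_cmult[OF cf(3)]]
          conv_add_right[OF Kb.laplace cf(2) subexponential_cmult[OF cf(3)]] conv_cmult_right)
    moreover have "ka * c1 + kb * c2 = - (e1 * v1 + e2 * v2)" using bal by (simp add: c1_def c2_def)
    ultimately have eq: "e1 * x1 t + e2 * x2 t = (conv Ka (cut f1) t + conv Kb (cut f2) t) + (c1 * (conv Ka ?one t - ka) + c2 * (conv Kb ?one t - kb))"
      by (simp add: algebra_simps)
    have half: "(t / 2) powr - \<alpha>1 = 2 powr \<alpha>1 * t powr - \<alpha>1"
      using t by (simp add: powr_divide powr_minus field_simps)
    have fe': "\<bar>cut f1 s\<bar> \<le> e" "\<bar>cut f2 s\<bar> \<le> e" if "t / 2 \<le> s" for s using fe[OF that] t that by (auto simp: cut_def)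
    have 1: "\<bar>conv Ka (cut f1) t\<bar> \<le> e * (LINT u|lborel. \<bar>Ka u\<bar>) + B * Ca / \<alpha>1 * (2 powr \<alpha>1 * t powr - \<alpha>1)"
      unfolding half[symmetric]
      by (rule Ka.conv_estimate[OF subexponential_measurable[OF cf(1)] _ cB(1) t e fe'(1)]) (simp add: cut_def)
    have 2: "\<bar>conv Kb (cut f2) t\<bar> \<le> e * (LINT u|lborel. \<bar>Kb u\<bar>) + B * Cb / \<alpha>1 * (2 powr \<alpha>1 * t powr - \<alpha>1)"
      unfolding half[symmetric]
      by (rule Kb.conv_estimate[OF subexponential_measurable[OF cf(2)] _ cB(2) t e fe'(2)]) (simp add: cut_def)
    have 3: "\<bar>c1 * (conv Ka ?one t - ka)\<bar> \<le> \<bar>c1\<bar> * (Ca / \<alpha>1 * t powr - \<alpha>1)"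
      unfolding abs_mult using Ka.conv_one_estimate[OF t] Ka.integral_eq_limit[OF lim(1)] by (intro mult_left_mono) auto
    have 4: "\<bar>c2 * (conv Kb ?one t - kb)\<bar> \<le> \<bar>c2\<bar> * (Cb / \<alpha>1 * t powr - \<alpha>1)"
      unfolding abs_mult using Kb.conv_one_estimate[OF t] Kb.integral_eq_limit[OF lim(2)] by (intro mult_left_mono) auto
    have "\<bar>e1 * x1 t + e2 * x2 t\<bar> \<le> (\<bar>conv Ka (cut f1) t\<bar> + \<bar>conv Kb (cut f2) t\<bar>)
        + (\<bar>c1 * (conv Ka ?one t - ka)\<bar> + \<bar>c2 * (conv Kb ?one t - kb)\<bar>)"
      unfolding eq by linarith
    also have "\<dots> \<le> M * e + N * t powr - \<alpha>1"
      using 1 2 3 4 by (simp add: M_def N_def algebra_simps)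
    finally show ?thesis .
  qed
  moreover have "0 \<le> M" by (simp add: M_def)
  ultimately show ?thesis by blast
qed

lemma charfun_real_tendsto: "(charfun_real \<longlongrightarrow> d) (at_right 0)"
proof -
  have p: "((\<lambda>z. z powr b) \<longlongrightarrow> 0 powr b) (at_right (0::real))" if "0 < b" for b
    by (rule tendsto_powr') (use that in \<open>auto simp: eventually_at_filter intro!: tendsto_intros always_eventually\<close>)
  have "((\<lambda>z. z powr (\<alpha>1 + \<alpha>2) - a11 * z powr \<alpha>2 - a22 * z powr \<alpha>1 + d) \<longlongrightarrow>
     0 powr (\<alpha>1 + \<alpha>2) - a11 * 0 powr \<alpha>2 - a22 * 0 powr \<alpha>1 + d) (at_right 0)"
    by (intro tendsto_intros p) (use alpha in auto)
  then show ?thesis by (simp add: charfun_real_def[abs_def])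
qed

lemma resolvent_tendsto:
  "((\<lambda>z. (n0 + n1 * z powr \<alpha>1 + n2 * z powr \<alpha>2) / charfun_real z) \<longlongrightarrow> n0 / d) (at_right 0)"
proof -
  have p: "((\<lambda>z. z powr b) \<longlongrightarrow> 0 powr b) (at_right (0::real))" if "0 < b" for b
    by (rule tendsto_powr') (use that in \<open>auto simp: eventually_at_filter intro!: tendsto_intros always_eventually\<close>)
  have "((\<lambda>z. (n0 + n1 * z powr \<alpha>1 + n2 * z powr \<alpha>2) / charfun_real z) \<longlongrightarrow>
      (n0 + n1 * 0 powr \<alpha>1 + n2 * 0 powr \<alpha>2) / d) (at_right 0)"
    by (intro tendsto_intros p charfun_real_tendsto) (use alpha d_pos in auto)
  then show ?thesis by simp
qed

text \<open>The four kernels belong to the entries of the inverse, written as adjugate over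
  determinant; the rows \<open>(1, 0)\<close> and \<open>(0, 1)\<close> single out the two
  components.\<close>

lemma solution_estimate:
  fixes a12 a21 v1 v2 :: real
  assumes d: "d = a11 * a22 - a12 * a21"
    and x1: "continuous_on {0..} x1" "x1 0 = v1" and x2: "continuous_on {0..} x2" "x2 0 = v2"
    and f: "continuous_on {0..} f1" "continuous_on {0..} f2"
    and B: "\<And>t. 0 \<le> t \<Longrightarrow> \<bar>f1 t\<bar> \<le> B" "\<And>t. 0 \<le> t \<Longrightarrow> \<bar>f2 t\<bar> \<le> B"
    and D1: "\<And>t. 0 < t \<Longrightarrow> (caputo_primitive \<alpha>1 (\<lambda>s. x1 s - v1) has_real_derivative a11 * x1 t + a12 * x2 t + f1 t) (at t)"
    and D2: "\<And>t. 0 < t \<Longrightarrow> (caputo_primitive \<alpha>2 (\<lambda>s. x2 s - v2) has_real_derivative a21 * x1 t + a22 * x2 t + f2 t) (at t)"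
  shows "\<exists>M\<ge>0. \<exists>N\<ge>0. \<forall>t>0. \<forall>e\<ge>0. (\<forall>s\<ge>t / 2. \<bar>f1 s\<bar> \<le> e \<and> \<bar>f2 s\<bar> \<le> e) \<longrightarrow>
     max \<bar>x1 t\<bar> \<bar>x2 t\<bar> \<le> M * e + N * t powr - \<alpha>1"
proof -
  let ?F = "\<lambda>n0 n1 n2 z. (n0 + n1 * z powr \<alpha>1 + n2 * z powr \<alpha>2) / charfun_real z"
  obtain K11 C11 where K11: "decaying_kernel K11 (?F (- a22) 0 1) \<alpha>1 C11" using kernel_exists by blast
  obtain K12 C12 where K12: "decaying_kernel K12 (?F a12 0 0) \<alpha>1 C12" using kernel_exists by blast
  obtain K21 C21 where K21: "decaying_kernel K21 (?F a21 0 0) \<alpha>1 C21" using kernel_exists by blast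
  obtain K22 C22 where K22: "decaying_kernel K22 (?F (- a11) 1 0) \<alpha>1 C22" using kernel_exists by blast
  have frac: "n / c * u - m / c * v = (n * u - m * v) / c" "n / c * u + m / c * v = (n * u + m * v) / c" for n m u v c :: real
    by (simp_all add: diff_divide_distrib add_divide_distrib)
  have q: "charfun_real z = (z powr \<alpha>1 - a11) * (z powr \<alpha>2 - a22) - a12 * a21" for z
    unfolding charfun_real_def using d by (simp add: powr_add algebra_simps)
  have "\<exists>M\<ge>0. \<exists>N. \<forall>t>0. \<forall>e\<ge>0. (\<forall>s\<ge>t / 2. \<bar>f1 s\<bar> \<le> e \<and> \<bar>f2 s\<bar> \<le> e) \<longrightarrow>
     \<bar>1 * x1 t + 0 * x2 t\<bar> \<le> M * e + N * t powr - \<alpha>1"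
  proof (rule row_estimate[OF K11 K12 _ _ resolvent_tendsto resolvent_tendsto _ x1 x2 f B D1 D2])
    fix z :: real assume "0 < z"
    note nz = charfun_real_nonzero[OF this]
    have num: "(- a22 + 0 * z powr \<alpha>1 + 1 * z powr \<alpha>2) * (z powr \<alpha>1 - a11) - (a12 + 0 * z powr \<alpha>1 + 0 * z powr \<alpha>2) * a21 = charfun_real z"
      unfolding q by algebra
    show "?F (- a22) 0 1 z * (z powr \<alpha>1 - a11) - ?F a12 0 0 z * a21 = 1"
      unfolding frac num using nz by simp
    show "?F a12 0 0 z * (z powr \<alpha>2 - a22) - ?F (- a22) 0 1 z * a12 = 0"
      unfolding frac by (simp add: algebra_simps)
  next
    show "(- a22) / d * (a11 * v1 + a12 * v2) + a12 / d * (a21 * v1 + a22 * v2) = - (1 * v1 + 0 * v2)"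
    proof -
      have "(- a22) * (a11 * v1 + a12 * v2) + a12 * (a21 * v1 + a22 * v2) = - v1 * d" unfolding d by algebra
      then show ?thesis unfolding frac using d_pos by simp
    qed
  qed
  then obtain M1 N1 where 1: "0 \<le> M1" "\<And>t e. 0 < t \<Longrightarrow> 0 \<le> e \<Longrightarrow> \<forall>s\<ge>t / 2. \<bar>f1 s\<bar> \<le> e \<and> \<bar>f2 s\<bar> \<le> e
      \<Longrightarrow> \<bar>x1 t\<bar> \<le> M1 * e + N1 * t powr - \<alpha>1" 
    unfolding mult_1_left mult_zero_left add_0_right by blast
  have "\<exists>M\<ge>0. \<exists>N. \<forall>t>0. \<forall>e\<ge>0. (\<forall>s\<ge>t / 2. \<bar>f1 s\<bar> \<le> e \<and> \<bar>f2 s\<bar> \<le> e) \<longrightarrow>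
     \<bar>0 * x1 t + 1 * x2 t\<bar> \<le> M * e + N * t powr - \<alpha>1"
  proof (rule row_estimate[OF K21 K22 _ _ resolvent_tendsto resolvent_tendsto _ x1 x2 f B D1 D2])
    fix z :: real assume "0 < z"
    note nz = charfun_real_nonzero[OF this]
    show "?F a21 0 0 z * (z powr \<alpha>1 - a11) - ?F (- a11) 1 0 z * a21 = 0"
      unfolding frac by (simp add: algebra_simps)
    have num: "(- a11 + 1 * z powr \<alpha>1 + 0 * z powr \<alpha>2) * (z powr \<alpha>2 - a22) - (a21 + 0 * z powr \<alpha>1 + 0 * z powr \<alpha>2) * a12 = charfun_real z"
      unfolding q by algebra
    show "?F (- a11) 1 0 z * (z powr \<alpha>2 - a22) - ?F a21 0 0 z * a12 = 1"
      unfolding frac num using nz by simp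
  next
    show "a21 / d * (a11 * v1 + a12 * v2) + (- a11) / d * (a21 * v1 + a22 * v2) = - (0 * v1 + 1 * v2)"
    proof -
      have "a21 * (a11 * v1 + a12 * v2) + (- a11) * (a21 * v1 + a22 * v2) = - v2 * d" unfolding d by algebra
      then show ?thesis unfolding frac using d_pos by simp
    qed
  qed
  then obtain M2 N2 where 2: "0 \<le> M2" "\<And>t e. 0 < t \<Longrightarrow> 0 \<le> e \<Longrightarrow> \<forall>s\<ge>t / 2. \<bar>f1 s\<bar> \<le> e \<and> \<bar>f2 s\<bar> \<le> e
      \<Longrightarrow> \<bar>x2 t\<bar> \<le> M2 * e + N2 * t powr - \<alpha>1" 
    unfolding mult_1_left mult_zero_left add_0_left by blast
  define M where "M = max M1 M2"
  define N where "N = max 0 (max N1 N2)"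
  have "max \<bar>x1 t\<bar> \<bar>x2 t\<bar> \<le> M * e + N * t powr - \<alpha>1"
    if "0 < t" "0 \<le> e" "\<forall>s\<ge>t / 2. \<bar>f1 s\<bar> \<le> e \<and> \<bar>f2 s\<bar> \<le> e" for t e
  proof -
    have "M1 * e + N1 * t powr - \<alpha>1 \<le> M * e + N * t powr - \<alpha>1" "M2 * e + N2 * t powr - \<alpha>1 \<le> M * e + N * t powr - \<alpha>1"
      unfolding M_def N_def using that by (intro add_mono mult_right_mono; simp)+
    then show ?thesis using 1(2)[OF that] 2(2)[OF that] by linarith
  qed
  moreover have "0 \<le> M" "0 \<le> N" using 1(1) by (auto simp: M_def N_def)
  ultimately show ?thesis by blast
qed

end

section \<open>Back to vector-valued solutions in the plane\<close>

lemma has_caputo_derivative_iff: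
  "has_caputo_derivative \<kappa> g D t \<longleftrightarrow> (caputo_primitive \<kappa> (\<lambda>s. g s - g 0) has_real_derivative D) (at t)"
proof (cases "\<kappa> = 1")
  case True
  have "((\<lambda>s. g s - g 0) has_real_derivative D) (at t) \<longleftrightarrow> (g has_real_derivative D) (at t)"
    using DERIV_add[of "\<lambda>s. g s - g 0" D t UNIV "\<lambda>_. g 0" 0] DERIV_diff[of g D t UNIV "\<lambda>_. g 0" 0] by auto
  then show ?thesis using True by (simp add: has_caputo_derivative_def caputo_primitive_def)
qed (simp add: has_caputo_derivative_def caputo_primitive_def)

lemma bounded_on_halfline:
  fixes g :: "real \<Rightarrow> real ^ 2"
  assumes "continuous_on {0..} g" "\<And>t. T \<le> t \<Longrightarrow> infnorm (g t) \<le> C"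
  shows "bounded (g ` {0..})"
proof -
  have "bounded (g ` {0..T})"
    by (intro compact_imp_bounded compact_continuous_image continuous_on_subset[OF assms(1)]) auto
  moreover have "bounded (g ` {T..})"
    unfolding bounded_iff
  proof (intro exI ballI)
    fix y assume "y \<in> g ` {T..}"
    then have "norm y \<le> sqrt DIM(real ^ 2) * infnorm y" "infnorm y \<le> C"
      using assms(2) norm_le_infnorm[of y] by auto
    then show "norm y \<le> sqrt DIM(real ^ 2) * C"
      by (meson mult_left_mono order_trans real_sqrt_ge_zero of_nat_0_le_iff)
  qed
  ultimately have "bounded (g ` {0..T} \<union> g ` {T..})" by simp
  then show ?thesis
  proof (rule bounded_subset)
    show "g ` {0..} \<subseteq> g ` {0..T} \<union> g ` {T..}"
      unfolding image_Un[symmetric] by (rule image_mono) auto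
  qed
qed

theorem corollary5p2:
  fixes \<alpha>1 \<alpha>2 q1 q2 :: real
    and A :: "real ^ 2 ^ 2"
    and f :: "real \<Rightarrow> real ^ 2"
  assumes \<alpha>: "0 < \<alpha>1" "\<alpha>1 < \<alpha>2" "\<alpha>2 \<le> 1"
    and q1: "q1 = sin (\<alpha>1 * pi / 2) / sin ((\<alpha>1 + \<alpha>2) * pi / 2)"
    and q2: "q2 = sin (\<alpha>2 * pi / 2) / sin ((\<alpha>1 + \<alpha>2) * pi / 2)"
    and f_cont: "continuous_on {0..} f"
    and f_exp: "exponentially_bounded f"
    and cond:
      "(A $ 1 $ 1 \<le> 0 \<and> A $ 2 $ 2 \<le> 0 \<and> det A > 0)
       \<or> (A $ 1 $ 1 = 0 \<and> A $ 2 $ 2 > 0 \<and> det A > 0 \<and>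
          (A $ 2 $ 2 * q1) powr (\<alpha>1 / \<alpha>2) * (A $ 2 $ 2) * q2 < det A)
       \<or> (A $ 2 $ 2 = 0 \<and> A $ 1 $ 1 > 0 \<and> det A > 0 \<and>
          (A $ 1 $ 1 * q2) powr (\<alpha>2 / \<alpha>1) * (A $ 1 $ 1) * q1 < det A)
       \<or> (A $ 1 $ 1 > 0 \<and> A $ 2 $ 2 > 0 \<and> det A > 0 \<and>
          ((A $ 1 $ 1 * q2 + A $ 2 $ 2 * q1 > 1 \<and>
            A $ 1 $ 1 * q2 * ((A $ 1 $ 1 + A $ 2 $ 2) * q2) powr (\<alpha>2 / \<alpha>1)
              + A $ 2 $ 2 * (A $ 1 $ 1 + A $ 2 $ 2) * q2\<^sup>2 \<le> det A)
           \<or> (A $ 1 $ 1 * q2 + A $ 2 $ 2 * q1 \<le> 1 \<and>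
              A $ 1 $ 1 * q1 + A $ 2 $ 2 * q2 < det A)))
       \<or> (A $ 1 $ 1 < 0 \<and> A $ 2 $ 2 > 0 \<and> det A > 0 \<and>
          ((A $ 1 $ 1 * q2 + A $ 2 $ 2 * q1 > 1 \<and>
            (A $ 2 $ 2 * q1) powr (\<alpha>1 / \<alpha>2) * (A $ 2 $ 2) * q2 \<le> det A)
           \<or> (A $ 1 $ 1 * q2 + A $ 2 $ 2 * q1 \<le> 1 \<and> A $ 2 $ 2 * q2 \<le> det A)))"
  shows
    "(bounded (f ` {0..}) \<longrightarrow>
        (\<forall>x0 x. caputo_solution (vector [\<alpha>1, \<alpha>2]) A f x0 x \<longrightarrow> bounded (x ` {0..})))
     \<and> ((f \<longlongrightarrow> 0) at_top \<longrightarrow>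
        (\<forall>x0 x. caputo_solution (vector [\<alpha>1, \<alpha>2]) A f x0 x \<longrightarrow> (x \<longlongrightarrow> 0) at_top))
     \<and> (\<forall>\<eta>>0. (\<lambda>t. infnorm (f t)) \<in> O[at_top](\<lambda>t. t powr (- \<eta>)) \<longrightarrow>
        (\<forall>x0 x. caputo_solution (vector [\<alpha>1, \<alpha>2]) A f x0 x \<longrightarrow>
           (\<lambda>t. infnorm (x t)) \<in> O[at_top](\<lambda>t. t powr (- Min {\<alpha>1, \<alpha>2, \<eta>}))))"
proof -
  interpret spectral \<alpha>1 \<alpha>2 q1 q2 "A $ 1 $ 1" "A $ 2 $ 2" "det A"
    by (rule spectral.intro[OF \<alpha> q1 q2 cond])
  have estimate: "\<exists>M\<ge>0. \<exists>N\<ge>0. \<forall>t>0. \<forall>e\<ge>0. (\<forall>s\<ge>t / 2. infnorm (f s) \<le> e) \<longrightarrow>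
       infnorm (x t) \<le> M * e + N * t powr - \<alpha>1"
    if sol: "caputo_solution (vector [\<alpha>1, \<alpha>2]) A f x0 x" and f_bd: "bounded (f ` {0..})" for x0 x
  proof -
    have x: "continuous_on {0..} x" "x 0 = x0" using sol by (auto simp: caputo_solution_def)
    obtain B where "\<forall>y\<in>f ` {0..}. norm y \<le> B" using f_bd unfolding bounded_iff by blast
    then have B: "\<bar>f t $ i\<bar> \<le> B" if "0 \<le> t" for t i
      using that component_le_norm_cart[of "f t" i] by force
    have D: "(caputo_primitive (vector [\<alpha>1, \<alpha>2] $ i) (\<lambda>s. x s $ i - x0 $ i) has_real_derivative (A *v x t + f t) $ i) (at t)"
      if "0 < t" for t and i :: 2
      using sol that unfolding caputo_solution_def has_caputo_derivative_vec_def has_caputo_derivative_iff by auto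
    have "\<exists>M\<ge>0. \<exists>N\<ge>0. \<forall>t>0. \<forall>e\<ge>0. (\<forall>s\<ge>t / 2. \<bar>f s $ 1\<bar> \<le> e \<and> \<bar>f s $ 2\<bar> \<le> e) \<longrightarrow>
       max \<bar>x t $ 1\<bar> \<bar>x t $ 2\<bar> \<le> M * e + N * t powr - \<alpha>1"
    proof (rule solution_estimate[OF det_2 _ _ _ _ _ _ B B])
      fix t :: real assume t: "0 < t"
      show "(caputo_primitive \<alpha>1 (\<lambda>s. x s $ 1 - x0 $ 1) has_real_derivative A $ 1 $ 1 * x t $ 1 + A $ 1 $ 2 * x t $ 2 + f t $ 1) (at t)"
        using D[OF t, of 1] by (simp add: matrix_vector_mult_def sum_2)
      show "(caputo_primitive \<alpha>2 (\<lambda>s. x s $ 2 - x0 $ 2) has_real_derivative A $ 2 $ 1 * x t $ 1 + A $ 2 $ 2 * x t $ 2 + f t $ 2) (at t)"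
        using D[OF t, of 2] by (simp add: matrix_vector_mult_def sum_2)
    qed (use x f_cont in \<open>auto intro!: continuous_intros\<close>)
    then show ?thesis by (simp add: infnorm_2)
  qed
  have solution_continuous: "continuous_on {0..} x" if "caputo_solution (vector [\<alpha>1, \<alpha>2]) A f x0 x" for x0 x
    using that by (simp add: caputo_solution_def)
  have part1: "bounded (x ` {0..})"
    if f_bd: "bounded (f ` {0..})" and sol: "caputo_solution (vector [\<alpha>1, \<alpha>2]) A f x0 x" for x0 x
  proof -
    obtain M N where MN: "0 \<le> M" "0 \<le> N" and est: "\<And>t e. 0 < t \<Longrightarrow> 0 \<le> e \<Longrightarrow> \<forall>s\<ge>t / 2. infnorm (f s) \<le> e
        \<Longrightarrow> infnorm (x t) \<le> M * e + N * t powr - \<alpha>1"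
      using estimate[OF sol f_bd] by blast
    obtain B where B: "0 < B" "\<forall>y\<in>f ` {0..}. norm y \<le> B" using f_bd bounded_pos by blast
    have "infnorm (x t) \<le> M * B + N" if t: "1 \<le> t" for t
    proof -
      have "infnorm (f s) \<le> B" if "t / 2 \<le> s" for s
      proof -
        have "norm (f s) \<le> B" using B(2) that t by auto
        then show ?thesis using infnorm_le_norm[of "f s"] by linarith
      qed
      then have "infnorm (x t) \<le> M * B + N * t powr - \<alpha>1" using est[of t B] t B by simp
      also have "t powr - \<alpha>1 \<le> t powr 0" using t \<alpha> by (intro powr_mono) auto
      then have "M * B + N * t powr - \<alpha>1 \<le> M * B + N" using MN t mult_left_mono[of "t powr - \<alpha>1" 1 N] by simp
      finally show ?thesis .
    qed
    then show ?thesis by (rule bounded_on_halfline[OF solution_continuous[OF sol]])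
  qed
  have decay: "((\<lambda>t. N * t powr - \<alpha>1) \<longlongrightarrow> 0) at_top" for N
    using tendsto_mult_right_zero[OF tendsto_neg_powr[OF _ filterlim_ident, of "- \<alpha>1"]] \<alpha> by simp
  have part2: "(x \<longlongrightarrow> 0) at_top"
    if f_lim: "(f \<longlongrightarrow> 0) at_top" and sol: "caputo_solution (vector [\<alpha>1, \<alpha>2]) A f x0 x" for x0 x
  proof -
    have f_small: "\<exists>T. \<forall>t\<ge>T. infnorm (f t) \<le> e" if "0 < e" for e
    proof -
      have "\<forall>\<^sub>F t in at_top. dist (f t) 0 < e" using f_lim that by (rule tendstoD)
      then obtain T where "\<And>t. T \<le> t \<Longrightarrow> norm (f t) < e" by (auto simp: eventually_at_top_linorder)
      then show ?thesis using infnorm_le_norm order_trans less_imp_le by metis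
    qed
    \<comment> \<open>A continuous forcing that tends to 0 is bounded, so that
      \<open>estimate\<close> applies.\<close>
    then obtain T where "\<And>t. T \<le> t \<Longrightarrow> infnorm (f t) \<le> 1" using zero_less_one by blast
    then have f_bd: "bounded (f ` {0..})" by (rule bounded_on_halfline[OF f_cont])
    obtain M N where MN: "0 \<le> M" "0 \<le> N" and est: "\<And>t e. 0 < t \<Longrightarrow> 0 \<le> e \<Longrightarrow> \<forall>s\<ge>t / 2. infnorm (f s) \<le> e
        \<Longrightarrow> infnorm (x t) \<le> M * e + N * t powr - \<alpha>1"
      using estimate[OF sol f_bd] by blast
    have "((\<lambda>t. infnorm (x t)) \<longlongrightarrow> 0) at_top"
    proof (rule tendstoI)
      fix e :: real assume e: "0 < e"
      \<comment> \<open>\<open>M + 1\<close> rather than \<open>M\<close> keeps the denominator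
        positive.\<close>
      define e' where "e' = e / (2 * (M + 1))"
      have e': "0 < e'" using e MN by (simp add: e'_def)
      obtain T where T: "\<And>t. T \<le> t \<Longrightarrow> infnorm (f t) \<le> e'" using f_small[OF e'] by blast
      have "\<forall>\<^sub>F t in at_top. N * t powr - \<alpha>1 < e / 2" by (rule order_tendstoD(2)[OF decay]) (use e in simp)
      then show "\<forall>\<^sub>F t in at_top. dist (infnorm (x t)) 0 < e"
        using eventually_gt_at_top[of 0] eventually_ge_at_top[of "2 * T"]
      proof eventually_elim
        case (elim t)
        have "infnorm (x t) \<le> M * e' + N * t powr - \<alpha>1" using elim e' T by (intro est) auto
        also have "M * e' \<le> (M + 1) * e'" using e' by simp
        also have "(M + 1) * e' = e / 2" using MN by (simp add: e'_def field_simps)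
        finally show ?case using elim infnorm_pos_le[of "x t"] by (simp add: dist_real_def)
      qed
    qed
    then have "((\<lambda>t. sqrt DIM(real ^ 2) * infnorm (x t)) \<longlongrightarrow> 0) at_top" by (rule tendsto_mult_right_zero)
    then show ?thesis
      by (rule Lim_null_comparison[rotated]) (intro always_eventually allI norm_le_infnorm)
  qed
  have part3: "(\<lambda>t. infnorm (x t)) \<in> O[at_top](\<lambda>t. t powr (- Min {\<alpha>1, \<alpha>2, \<eta>}))"
    if \<eta>: "0 < \<eta>" and f_O: "(\<lambda>t. infnorm (f t)) \<in> O[at_top](\<lambda>t. t powr (- \<eta>))"
      and sol: "caputo_solution (vector [\<alpha>1, \<alpha>2]) A f x0 x" for \<eta> x0 x
  proof -
    obtain c where c: "0 < c" "\<forall>\<^sub>F t in at_top. norm (infnorm (f t)) \<le> c * norm (t powr - \<eta>)"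
      using f_O by (rule landau_o.bigE)
    then obtain T0 where T0: "\<And>t. T0 \<le> t \<Longrightarrow> infnorm (f t) \<le> c * t powr - \<eta>"
      by (auto simp: eventually_at_top_linorder infnorm_pos_le)
    define T where "T = max 1 T0"
    have fT: "infnorm (f t) \<le> c * t powr - \<eta>" if "T \<le> t" for t using T0 that by (simp add: T_def)
    have "infnorm (f t) \<le> c" if "T \<le> t" for t
    proof -
      have "t powr - \<eta> \<le> t powr 0" using that \<eta> by (intro powr_mono) (auto simp: T_def)
      then have "c * t powr - \<eta> \<le> c * 1" using c(1) that by (intro mult_left_mono) (auto simp: T_def)
      then show ?thesis using fT[OF that] by linarith
    qed
    then have f_bd: "bounded (f ` {0..})" by (rule bounded_on_halfline[OF f_cont])
    obtain M N where MN: "0 \<le> M" "0 \<le> N" and est: "\<And>t e. 0 < t \<Longrightarrow> 0 \<le> e \<Longrightarrow> \<forall>s\<ge>t / 2. infnorm (f s) \<le> e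
        \<Longrightarrow> infnorm (x t) \<le> M * e + N * t powr - \<alpha>1"
      using estimate[OF sol f_bd] by blast
    define \<mu> where "\<mu> = Min {\<alpha>1, \<alpha>2, \<eta>}"
    have \<mu>: "\<mu> \<le> \<alpha>1" "\<mu> \<le> \<eta>" by (auto simp: \<mu>_def)
    have "infnorm (x t) \<le> (M * c * 2 powr \<eta> + N) * t powr - \<mu>" if t: "2 * T \<le> t" for t
    proof -
      have t1: "1 \<le> t" using t by (simp add: T_def)
      \<comment> \<open>The bound on the forcing beyond \<open>t / 2\<close> now depends on
        \<open>t\<close>, which the order of quantifiers in \<open>estimate\<close> permits.\<close>
      have "infnorm (f s) \<le> c * (t / 2) powr - \<eta>" if "t / 2 \<le> s" for s
      proof -
        have "s powr - \<eta> \<le> (t / 2) powr - \<eta>" using that t1 \<eta> by (intro powr_mono2') auto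
        then have "c * s powr - \<eta> \<le> c * (t / 2) powr - \<eta>" using c(1) by (intro mult_left_mono) auto
        then show ?thesis using fT[of s] that t by linarith
      qed
      then have "infnorm (x t) \<le> M * (c * (t / 2) powr - \<eta>) + N * t powr - \<alpha>1"
        using t1 c(1) by (intro est) auto
      also have "(t / 2) powr - \<eta> = 2 powr \<eta> * t powr - \<eta>"
        using t1 by (simp add: powr_divide powr_minus field_simps)
      also have "M * (c * (2 powr \<eta> * t powr - \<eta>)) + N * t powr - \<alpha>1 = M * c * 2 powr \<eta> * t powr - \<eta> + N * t powr - \<alpha>1" by simp
      also have "\<dots> \<le> M * c * 2 powr \<eta> * t powr - \<mu> + N * t powr - \<mu>"
        using t1 \<mu> MN c(1) by (intro add_mono mult_left_mono powr_mono) auto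
      finally show ?thesis by (simp add: distrib_right)
    qed
    then have "\<forall>\<^sub>F t in at_top. norm (infnorm (x t)) \<le> (M * c * 2 powr \<eta> + N) * norm (t powr - \<mu>)"
      by (auto simp: eventually_at_top_linorder infnorm_pos_le)
    then show ?thesis unfolding \<mu>_def by (rule bigoI)
  qed
  show ?thesis using part1 part2 part3 by blast
qed

end
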